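(* Let $(\rho_\epsilon)_{\epsilon>0}\subset L^1(\mathbb{R}^N)$ be a family of non-negative radial functions such that, for every $\delta>0$, $$\lim_{\epsilon\to0}\int_{|h|<\delta}\rho_\epsilon(h)\,dh=1\quad\text{and}\quad\lim_{\epsilon\to0}\int_{|h|>\delta}\rho_\epsilon(h)\,dh=0.$$ Let $u\in BV(\mathbb{R}^N)$, and define $R^1_\epsilon u:\mathbb{R}^N\to\mathbb{R}$ by $$R^1_\epsilon u(x)=\int_{\mathbb{R}^N}\frac{|u(x+h)-u(x)-\nabla u(x)\cdot h|}{|h|}\rho_\epsilon(h)\,dh.$$ Then, for every bounded continuous function $\varphi:\mathbb{R}^N\to\mathbb{R}$, $$\lim_{\epsilon\to0}\int_{\mathbb{R}^N}R^1_\epsilon u\,\varphi=K_{1,N}\int_{\mathbb{R}^N}\varphi\,d|D^su|.$$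
   Context: $BV(\mathbb{R}^N)$ is the space of $u\in L^1(\mathbb{R}^N)$ whose distributional derivative $Du$ is a Radon measure with finite total variation. One decomposes $Du=\nabla u\,\mathcal{L}^N+D^su$, where $\nabla u$ is the Radon-Nikodym density of $Du$ with respect to Lebesgue measure $\mathcal{L}^N$ and $D^su$ is singular with respect to $\mathcal{L}^N$. The constant is $K_{1,N}=C_{1,N}/\mathcal{H}^{N-1}(\mathbb{S}^{N-1})$, where $\mathcal{H}^{N-1}$ is the $(N-1)$-dimensional Hausdorff measure and $C_{1,N}=\int_{\mathbb{S}^{N-1}}|e\cdot v|\,d\mathcal{H}^{N-1}(v)$ for any unit vector $e\in\mathbb{R}^N$; $C_{1,N}=2\omega_{N-1}$ with $\omega_{N-1}$ the volume of the unit ball of $\mathbb{R}^{N-1}$. *)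

theory Defs
  imports "HOL-Analysis.Analysis"
begin

section \<open>Finite vector-valued Borel measures\<close>

text \<open>
  A finite vector measure is a set function, of which only the values on Borel sets matter.
  On a Euclidean space every such measure with finite total variation is Radon.
\<close>

definition vector_measure :: "('a::euclidean_space set \<Rightarrow> 'b::euclidean_space) \<Rightarrow> bool" where
  "vector_measure \<mu> \<longleftrightarrow>
     \<mu> {} = 0 \<and>
     (\<forall>A::nat \<Rightarrow> 'a set. range A \<subseteq> sets borel \<longrightarrow> disjoint_family A \<longrightarrow>
        (\<lambda>i. \<mu> (A i)) sums \<mu> (\<Union>i. A i))"

text \<open>The total variation measure \<open>|\<mu>|\<close>, as a supremum over countable Borel partitions.\<close>

definition variation :: "('a::euclidean_space set \<Rightarrow> 'b::euclidean_space) \<Rightarrow> 'a measure" where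
  "variation \<mu> = measure_of UNIV (sets borel)
     (\<lambda>B. SUP A\<in>{A::nat \<Rightarrow> 'a set. range A \<subseteq> sets borel \<and> disjoint_family A \<and> (\<Union>i. A i) = B}.
            \<Sum>i. ennreal (norm (\<mu> (A i))))"

text \<open>
  The positive part in the Jordan decomposition of a signed measure \<open>\<nu>\<close>; the negative part is
  the positive part of \<open>-\<nu>\<close>. The coercion \<^const>\<open>ennreal\<close> sends negative reals to \<open>0\<close>,
  which is harmless here since \<open>A = {}\<close> is a competitor in the supremum.
\<close>

definition jordan_pos :: "('a::euclidean_space set \<Rightarrow> real) \<Rightarrow> 'a measure" where
  "jordan_pos \<nu> = measure_of UNIV (sets borel)
     (\<lambda>B. SUP A\<in>{A. A \<in> sets borel \<and> A \<subseteq> B}. ennreal (\<nu> A))"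

definition signed_integral :: "('a::euclidean_space set \<Rightarrow> real) \<Rightarrow> ('a \<Rightarrow> real) \<Rightarrow> real" where
  "signed_integral \<nu> f =
     (LINT x|jordan_pos \<nu>. f x) - (LINT x|jordan_pos (\<lambda>A. - \<nu> A). f x)"

definition singular_lborel :: "('a::euclidean_space set \<Rightarrow> 'b::euclidean_space) \<Rightarrow> bool" where
  "singular_lborel \<nu> \<longleftrightarrow>
     (\<exists>Z\<in>null_sets lborel. \<forall>A\<in>sets borel. A \<inter> Z = {} \<longrightarrow> \<nu> A = 0)"

text \<open>
  The Lebesgue decomposition of \<open>\<mu>\<close>: the density of its absolutely continuous part is the
  (almost everywhere unique) integrable \<open>g\<close> for which the remainder is singular.
\<close>

definition ac_density ::
    "('a::euclidean_space set \<Rightarrow> 'b::euclidean_space) \<Rightarrow> 'a \<Rightarrow> 'b" where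
  "ac_density \<mu> =
     (SOME g. integrable lborel g \<and> singular_lborel (\<lambda>A. \<mu> A - (LINT x:A|lborel. g x)))"

definition singular_part ::
    "('a::euclidean_space set \<Rightarrow> 'b::euclidean_space) \<Rightarrow> 'a set \<Rightarrow> 'b" where
  "singular_part \<mu> A = \<mu> A - (LINT x:A|lborel. ac_density \<mu> x)"


section \<open>Functions of bounded variation\<close>

primrec Ck :: "nat \<Rightarrow> ('a::euclidean_space \<Rightarrow> real) \<Rightarrow> bool" where
  "Ck 0 f \<longleftrightarrow> continuous_on UNIV f"
| "Ck (Suc k) f \<longleftrightarrow>
     (\<forall>x. f differentiable (at x)) \<and>
     (\<forall>b\<in>Basis. Ck k (\<lambda>x. frechet_derivative f (at x) b))"

definition test_function :: "('a::euclidean_space \<Rightarrow> real) \<Rightarrow> bool" where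
  "test_function \<psi> \<longleftrightarrow> (\<forall>k. Ck k \<psi>) \<and> compact (closure {x. \<psi> x \<noteq> 0})"

text \<open>
  \<open>\<mu>\<close> is the distributional derivative of \<open>u\<close>; the number \<open>\<mu> A \<bullet> b\<close> is the component
  of \<open>\<mu> A\<close> in the coordinate direction \<open>b\<close>.
\<close>

definition is_distributional_derivative ::
    "('a::euclidean_space \<Rightarrow> real) \<Rightarrow> ('a set \<Rightarrow> 'a) \<Rightarrow> bool" where
  "is_distributional_derivative u \<mu> \<longleftrightarrow>
     vector_measure \<mu> \<and>
     (\<forall>\<psi>. test_function \<psi> \<longrightarrow> (\<forall>b\<in>Basis.
        (LINT x|lebesgue. u x * frechet_derivative \<psi> (at x) b)
          = - signed_integral (\<lambda>A. \<mu> A \<bullet> b) \<psi>))"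

definition BV :: "('a::euclidean_space \<Rightarrow> real) set" where
  "BV = {u. integrable lebesgue u \<and>
            (\<exists>\<mu>. is_distributional_derivative u \<mu> \<and> emeasure (variation \<mu>) UNIV < \<infinity>)}"

text \<open>For \<open>u\<close> in \<open>BV\<close> the measure \<open>Du\<close> is uniquely determined on the Borel sets.\<close>

definition distr_deriv :: "('a::euclidean_space \<Rightarrow> real) \<Rightarrow> 'a set \<Rightarrow> 'a" where
  "distr_deriv u =
     (SOME \<mu>. is_distributional_derivative u \<mu> \<and> emeasure (variation \<mu>) UNIV < \<infinity>)"

definition BV_grad :: "('a::euclidean_space \<Rightarrow> real) \<Rightarrow> 'a \<Rightarrow> 'a" where
  "BV_grad u = ac_density (distr_deriv u)"

definition singular_deriv :: "('a::euclidean_space \<Rightarrow> real) \<Rightarrow> 'a set \<Rightarrow> 'a" where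
  "singular_deriv u = singular_part (distr_deriv u)"


section \<open>Hausdorff measure and the constant\<close>

text \<open>
  Hausdorff measure of integer dimension \<open>s\<close>, normalised to agree with Lebesgue measure on
  \<open>s\<close>-dimensional space. Empty sets in a cover count \<open>0\<close> and nonempty sets of
  diameter \<open>0\<close> count \<open>0 ^ s\<close>, so that \<open>s = 0\<close> gives the counting measure.
\<close>

definition hausdorff_outer :: "nat \<Rightarrow> 'a::euclidean_space set \<Rightarrow> ennreal" where
  "hausdorff_outer s A =
     ennreal (unit_ball_vol (real s) / 2 ^ s) *
     (SUP \<delta>\<in>{0::real<..}.
        INF U\<in>{U::nat \<Rightarrow> 'a set. A \<subseteq> (\<Union>i. U i) \<and> (\<forall>i. bounded (U i) \<and> diameter (U i) \<le> \<delta>)}.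
          \<Sum>i. if U i = {} then 0 else ennreal (diameter (U i) ^ s))"

definition hausdorff_measure :: "nat \<Rightarrow> 'a::euclidean_space measure" where
  "hausdorff_measure s = measure_of UNIV (sets borel) (hausdorff_outer s)"

text \<open>
  The constants do not depend on the unit vector \<open>e\<close>, which is kept as a parameter.
\<close>

definition C1 :: "'a::euclidean_space \<Rightarrow> real" where
  "C1 e = (LINT v:sphere 0 1|hausdorff_measure (DIM('a) - 1). \<bar>e \<bullet> v\<bar>)"

definition K1 :: "'a::euclidean_space \<Rightarrow> real" where
  "K1 e = C1 e / measure (hausdorff_measure (DIM('a) - 1)) (sphere (0::'a) 1)"


section \<open>The nonlocal first-order remainder\<close>

definition radial :: "('a::euclidean_space \<Rightarrow> real) \<Rightarrow> bool" where
  "radial f \<longleftrightarrow> (\<exists>g. \<forall>h. f h = g (norm h))"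

definition R1 ::
    "('a::euclidean_space \<Rightarrow> real) \<Rightarrow> ('a \<Rightarrow> real) \<Rightarrow> 'a \<Rightarrow> real" where
  "R1 r u x =
     (LINT h|lebesgue. \<bar>u (x + h) - u x - BV_grad u x \<bullet> h\<bar> / norm h * r h)"

end

theory Submission
  imports Defs
begin

text \<open>
  Write \<open>Du = g dx + s W\<close> with \<open>g = \<nabla>u\<close>, \<open>W\<close> the total variation of \<open>D\<^sup>su\<close> and \<open>s\<close> its polar density,
  so that \<open>|s| = 1\<close> holds \<open>W\<close>-almost everywhere. For fixed \<open>h\<close>, the increment \<open>u(x + h) - u(x)\<close> is, as a
  measure, the average over \<open>t \<in> [0,1]\<close> of the translates of \<open>h \<cdot> Du\<close> by \<open>-th\<close>. The part with density
  \<open>g\<close> differs from \<open>g(x) \<cdot> h\<close> by at most \<open>|h|\<close> times an \<open>L\<^sup>1\<close> modulus of continuity of \<open>g\<close>. Hence, for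
  every bounded Borel \<open>\<psi>\<close>, the integral \<open>\<integral> \<psi>(x) (u(x + h) - u(x) - g(x) \<cdot> h) dx\<close> equals the average over \<open>t \<in> [0,1]\<close>
  of \<open>\<integral> \<psi>(y - th) s(y) \<cdot> h dW(y)\<close>, up to an error that is \<open>o(|h|)\<close> uniformly for \<open>|\<psi>| \<le> 1\<close>
  (lemma \<open>integral_remainder_approx\<close>). Absolute values enter through the choice of \<open>\<psi>\<close>. Taking
  \<open>\<psi> = \<phi> sgn(remainder)\<close> with \<open>\<phi> \<ge> 0\<close> bounds \<open>\<integral> |remainder| \<phi> / |h|\<close> from above by
  \<open>\<integral> (|s \<cdot> h| / |h|) \<phi> dW + o(1)\<close>; taking for \<open>\<psi>\<close> a continuous approximation to the sign of \<open>s \<cdot> h\<close>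
  gives the matching lower bound for \<open>\<phi> = 1\<close>. The upper bounds for \<open>C + \<phi>\<close> and \<open>C - \<phi>\<close> and the limit for
  \<open>1\<close> yield both bounds for every bounded continuous \<open>\<phi>\<close> (lemma \<open>quotient_minus_singular_tendsto\<close>):
  the two quantities differ by a bounded function of \<open>h\<close> that tends to \<open>0\<close> at the origin.

  By Fubini, \<open>\<integral> R\<^sup>1u \<phi>\<close> is the integral of the first quantity against the kernel. As the kernels concentrate
  at the origin, only the second quantity survives (lemma \<open>concentrating_kernel\<close>), and by rotation
  invariance \<open>\<integral> (|w \<cdot> h| / |h|) \<rho>(h) dh = K |w| \<integral> \<rho>\<close> for every \<open>w\<close>. The value of \<open>K\<close> comes from
  integrating this identity over unit vectors \<open>w\<close> with respect to the Hausdorff measure of the sphere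
  and exchanging the integrals (lemma \<open>integral_abs_inner_radial\<close>). The properties of that
  measure which enter are countable additivity, invariance under isometries, and that the sphere has finite
  and positive measure.

  Three constructions precede the argument: smooth functions increasing to indicators of boxes, which
  extend the weak formulation of \<open>Du\<close> from test functions to bounded Borel functions; the
  polar and Lebesgue decompositions of a vector measure with finite variation; and Caratheodory's theorem for
  the Hausdorff outer measure, with packing and covering bounds for the sphere.
\<close>

section \<open>Test functions\<close>

lemma Ck_SucI:
  assumes "\<And>x. (f has_derivative f' x) (at x)"
    and "\<And>b. b \<in> Basis \<Longrightarrow> Ck k (\<lambda>x. f' x b)"
  shows "Ck (Suc k) f"
proof -
  have "frechet_derivative f (at x) = f' x" for x
    using assms(1) frechet_derivative_at by metis
  then show ?thesis
    using assms by (auto simp: differentiable_def)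
qed

lemma Ck_Suc_has_derivative:
  assumes "Ck (Suc k) f"
  shows "(f has_derivative frechet_derivative f (at x)) (at x)"
  using assms frechet_derivative_works by auto

lemma Ck_SucD: "Ck (Suc k) f \<Longrightarrow> Ck k f"
proof (induction k arbitrary: f)
  case 0
  then show ?case
    by (auto intro!: continuous_at_imp_continuous_on differentiable_imp_continuous_within)
next
  case (Suc k)
  then show ?case by (auto simp del: Ck.simps(1))
qed

lemma Ck_continuous: "Ck k f \<Longrightarrow> continuous_on UNIV f"
  by (induction k) (auto dest: Ck_SucD simp del: Ck.simps(2))

lemma Ck_const: "Ck k (\<lambda>x. c)"
proof (induction k arbitrary: c)
  case (Suc k)
  show ?case
    by (rule Ck_SucI[where f' = "\<lambda>x h. 0"]) (auto intro: Suc)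
qed auto

lemma Ck_add: "Ck k f \<Longrightarrow> Ck k g \<Longrightarrow> Ck k (\<lambda>x. f x + g x)"
proof (induction k arbitrary: f g)
  case (Suc k)
  show ?case
    by (rule Ck_SucI[where f' = "\<lambda>x h. frechet_derivative f (at x) h + frechet_derivative g (at x) h"])
      (use Suc in \<open>auto intro!: has_derivative_add simp: frechet_derivative_works[symmetric]\<close>)
qed (auto intro: continuous_on_add)

lemma Ck_mult: "Ck k f \<Longrightarrow> Ck k g \<Longrightarrow> Ck k (\<lambda>x. f x * g x)"
proof (induction k arbitrary: f g)
  case (Suc k)
  show ?case
  proof (rule Ck_SucI)
    show "((\<lambda>x. f x * g x) has_derivative
        (\<lambda>h. f x * frechet_derivative g (at x) h + frechet_derivative f (at x) h * g x)) (at x)" for x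
      using Suc.prems by (intro has_derivative_mult Ck_Suc_has_derivative)
    show "Ck k (\<lambda>x. f x * frechet_derivative g (at x) b + frechet_derivative f (at x) b * g x)"
      if "b \<in> Basis" for b
      using Suc.prems that by (intro Ck_add Suc.IH) (auto dest: Ck_SucD simp del: Ck.simps(2), auto)
  qed
qed (auto intro: continuous_on_mult)

lemma Ck_prod: "finite I \<Longrightarrow> (\<And>i. i \<in> I \<Longrightarrow> Ck k (f i)) \<Longrightarrow> Ck k (\<lambda>x. \<Prod>i\<in>I. f i x)"
  by (induction I rule: finite_induct) (auto intro: Ck_const Ck_mult)

lemma frechet_derivative_translate:
  fixes f :: "'a::euclidean_space \<Rightarrow> real"
  assumes "f differentiable (at (x + v))"
  shows "((\<lambda>x. f (x + v)) has_derivative frechet_derivative f (at (x + v))) (at x)"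
proof -
  have "((\<lambda>x. x + v) has_derivative (\<lambda>h. h)) (at x)"
    by (auto intro!: derivative_eq_intros)
  from has_derivative_compose[OF this] assms show ?thesis
    by (simp add: frechet_derivative_works)
qed

lemma Ck_translate: "Ck k f \<Longrightarrow> Ck k (\<lambda>x. f (x + v))"
proof (induction k arbitrary: f)
  case 0
  then show ?case
    by (auto intro!: continuous_intros continuous_on_compose2[of UNIV f])
next
  case (Suc k)
  show ?case
  proof (rule Ck_SucI)
    show "((\<lambda>x. f (x + v)) has_derivative frechet_derivative f (at (x + v))) (at x)" for x
      using Suc.prems by (intro frechet_derivative_translate) simp
    show "Ck k (\<lambda>x. frechet_derivative f (at (x + v)) b)" if "b \<in> Basis" for b
      using Suc.prems that by (intro Suc.IH[of "\<lambda>x. frechet_derivative f (at x) b"]) simp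
  qed
qed

text \<open>
  Powers of \<open>1/t\<close> times the smooth function \<open>exp(-1/t)\<close>, extended by \<open>0\<close> to \<open>t \<le> 0\<close>. The linear span
  of the family is closed under differentiation, so smoothness of all orders follows by one induction.
\<close>

definition flat :: "nat \<Rightarrow> real \<Rightarrow> real" where
  "flat m t = (if t > 0 then inverse t ^ m * exp (- inverse t) else 0)"

lemma flat_tendsto_0: "(flat m \<longlongrightarrow> 0) (at_right 0)"
proof -
  have "((\<lambda>s::real. s ^ m / exp s) \<longlongrightarrow> 0) at_top"
    by (rule tendsto_power_div_exp_0)
  then have "((\<lambda>t::real. inverse t ^ m / exp (inverse t)) \<longlongrightarrow> 0) (at_right 0)"
    by (rule filterlim_compose[OF _ filterlim_inverse_at_top_right])
  then show ?thesis
    by (rule Lim_transform_eventually)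
      (rule eventually_mono[OF eventually_at_right_less[of 0]],
        simp add: flat_def exp_minus divide_inverse)
qed

text \<open>
  At \<open>t = 0\<close> the difference quotient of \<open>flat m\<close> is \<open>flat (m + 1)\<close>, which tends to \<open>0\<close> from the right.
\<close>

lemma flat_has_real_derivative:
  "(flat m has_real_derivative (flat (m + 2) t - m * flat (m + 1) t)) (at t)"
proof -
  consider "t > 0" | "t < 0" | "t = 0" by linarith
  then show ?thesis
  proof cases
    case 1
    have "((\<lambda>t. inverse t ^ m * exp (- inverse t)) has_real_derivative
        (flat (m + 2) t - m * flat (m + 1) t)) (at t)"
      using 1 by (cases m)
        (auto intro!: derivative_eq_intros simp: flat_def field_simps power2_eq_square,
          metis One_nat_def power_eq_if)
    then show ?thesis
      by (rule has_field_derivative_transform_within_open[of _ _ _ "{0<..}"])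
        (use 1 in \<open>auto simp: flat_def\<close>)
  next
    case 2
    have "((\<lambda>t. 0) has_real_derivative (flat (m + 2) t - m * flat (m + 1) t)) (at t)"
      using 2 by (auto simp: flat_def)
    then show ?thesis
      by (rule has_field_derivative_transform_within_open[of _ _ _ "{..<0}"])
        (use 2 in \<open>auto simp: flat_def\<close>)
  next
    case 3
    have "((\<lambda>y. (flat m y - flat m 0) / (y - 0)) \<longlongrightarrow> 0) (at_right 0)"
      using flat_tendsto_0[of "Suc m"]
      by (rule Lim_transform_eventually)
        (rule eventually_mono[OF eventually_at_right_less[of 0]], simp add: flat_def field_simps)
    moreover have "((\<lambda>y. (flat m y - flat m 0) / (y - 0)) \<longlongrightarrow> 0) (at_left 0)"
      by (rule tendsto_eventually)
        (rule eventually_mono[OF eventually_at_left_real[of "-1" 0]], auto simp: flat_def)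
    ultimately have "(flat m has_real_derivative 0) (at 0)"
      by (auto simp: has_field_derivative_iff filterlim_split_at)
    then show ?thesis using 3 by (simp add: flat_def)
  qed
qed

text \<open>
  The induction runs over \<open>k\<close> for all exponents \<open>m\<close> at once, since differentiation raises the exponent.
\<close>

lemma Ck_flat: "Ck k (\<lambda>x::'a::euclidean_space. flat m (v \<bullet> x + d))"
proof (induction k arbitrary: m)
  case 0
  have "continuous_on UNIV (flat m)"
    by (meson DERIV_isCont continuous_at_imp_continuous_on flat_has_real_derivative)
  then show ?case
    by (auto intro!: continuous_intros continuous_on_compose2[of UNIV "flat m"])
next
  case (Suc k)
  show ?case
  proof (rule Ck_SucI)
    show "((\<lambda>x. flat m (v \<bullet> x + d)) has_derivative
        (\<lambda>h. (v \<bullet> h) * (flat (m + 2) (v \<bullet> x + d) + (- real m) * flat (m + 1) (v \<bullet> x + d)))) (at x)" for x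
    proof -
      have "((\<lambda>x. v \<bullet> x + d) has_derivative (\<lambda>h. v \<bullet> h)) (at x)"
        by (auto intro!: derivative_eq_intros)
      from has_derivative_compose[OF this flat_has_real_derivative[unfolded has_field_derivative_def]]
      show ?thesis by (simp add: mult.commute)
    qed
  qed (intro Ck_mult Ck_add Ck_const Suc)
qed

text \<open>
  In each coordinate \<open>exp(-1/(n t))\<close> tends to \<open>1\<close> for \<open>t > 0\<close> and vanishes for \<open>t \<le> 0\<close>; the product over the
  faces of the box is smooth with support in the closed box. As boxes generate the Borel sets, this is
  what carries identities from test functions to Borel functions.
\<close>

lemma box_indicator_limit_test_functions:
  fixes a b :: "'a::euclidean_space"
  obtains \<psi> :: "nat \<Rightarrow> 'a \<Rightarrow> real"
  where "\<And>n. test_function (\<psi> n)" "\<And>n x. 0 \<le> \<psi> n x \<and> \<psi> n x \<le> 1"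
    "\<And>x. (\<lambda>n. \<psi> n x) \<longlonglongrightarrow> indicator (box a b) x"
proof
  define \<psi> where "\<psi> n x = (\<Prod>i\<in>Basis. flat 0 (Suc n * (x \<bullet> i - a \<bullet> i)) * flat 0 (Suc n * (b \<bullet> i - x \<bullet> i)))"
    for n :: nat and x
  have flat_bounds: "0 \<le> flat 0 t" "flat 0 t \<le> 1" for t
    by (auto simp: flat_def)
  have out: "\<psi> n x = 0" if "x \<notin> box a b" for n x
  proof -
    from that obtain i where "i \<in> Basis" "x \<bullet> i - a \<bullet> i \<le> 0 \<or> b \<bullet> i - x \<bullet> i \<le> 0"
      by (force simp: box_def not_less)
    then show ?thesis
      unfolding \<psi>_def prod_zero_iff[OF finite_Basis]
      by (intro bexI[of _ i]) (auto simp: flat_def zero_less_mult_iff)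
  qed
  show "test_function (\<psi> n)" for n
  proof -
    have "closure {x. \<psi> n x \<noteq> 0} \<subseteq> cbox a b"
      using out box_subset_cbox by (intro closure_minimal) (auto, blast)
    then have "compact (closure {x. \<psi> n x \<noteq> 0})"
      by (metis bounded_cbox bounded_subset closed_closure compact_eq_bounded_closed)
    moreover have "Ck k (\<psi> n)" for k
    proof -
      have "\<psi> n = (\<lambda>x. \<Prod>i\<in>Basis. flat 0 ((Suc n *\<^sub>R i) \<bullet> x + (- Suc n * (a \<bullet> i)))
          * flat 0 ((- Suc n *\<^sub>R i) \<bullet> x + Suc n * (b \<bullet> i)))"
        unfolding \<psi>_def by (auto simp: algebra_simps inner_commute)
      then show ?thesis
        by (simp only:) (intro Ck_prod Ck_mult Ck_flat finite_Basis)
    qed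
    ultimately show ?thesis by (simp add: test_function_def)
  qed
  show "0 \<le> \<psi> n x \<and> \<psi> n x \<le> 1" for n x
    unfolding \<psi>_def using flat_bounds
    by (intro conjI prod_nonneg prod_le_1 mult_nonneg_nonneg ballI) (auto intro: mult_le_one)
  have lim1: "(\<lambda>n. flat 0 (Suc n * t)) \<longlonglongrightarrow> 1" if "t > 0" for t :: real
  proof -
    have "(\<lambda>n. exp (- (inverse t * inverse (real (Suc n))))) \<longlonglongrightarrow> exp (- (inverse t * 0))"
      by (intro tendsto_intros LIMSEQ_inverse_real_of_nat)
    moreover have "flat 0 (Suc n * t) = exp (- (inverse t * inverse (real (Suc n))))" for n
      using that by (simp add: flat_def inverse_mult_distrib mult.commute del: of_nat_Suc)
    ultimately show ?thesis by simp
  qed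
  show "(\<lambda>n. \<psi> n x) \<longlonglongrightarrow> indicator (box a b) x" for x
  proof (cases "x \<in> box a b")
    case True
    have "(\<lambda>n. \<psi> n x) \<longlonglongrightarrow> (\<Prod>i\<in>(Basis::'a set). 1 * 1)"
      unfolding \<psi>_def using True
      by (intro tendsto_prod tendsto_mult lim1) (auto simp: mem_box)
    then show ?thesis using True by simp
  next
    case False
    then show ?thesis by (simp add: out)
  qed
qed

lemma test_function_translate:
  assumes "test_function \<psi>"
  shows "test_function (\<lambda>x. \<psi> (x + v))"
proof -
  have "{x. \<psi> (x + v) \<noteq> 0} = (\<lambda>x. x - v) ` {x. \<psi> x \<noteq> 0}"
    by (auto simp: image_iff) (metis add_diff_cancel)
  then have "compact (closure {x. \<psi> (x + v) \<noteq> 0})"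
    using assms closure_translation_subtract[of v "{x. \<psi> x \<noteq> 0}"]
    by (auto simp: test_function_def compact_translation_subtract)
  then show ?thesis
    using assms by (auto simp: test_function_def Ck_translate)
qed

lemma bounded_if_continuous_compact_support:
  fixes f :: "'a::euclidean_space \<Rightarrow> real"
  assumes "continuous_on UNIV f" "compact K" "\<And>x. x \<notin> K \<Longrightarrow> f x = 0"
  shows "\<exists>C. \<forall>x. \<bar>f x\<bar> \<le> C"
proof -
  have "bounded (f ` K)"
    using assms by (meson compact_continuous_image compact_imp_bounded continuous_on_subset top_greatest)
  then obtain C where "\<forall>x\<in>K. \<bar>f x\<bar> \<le> C" by (auto simp: bounded_iff)
  then have "\<bar>f x\<bar> \<le> max C 0" for x
    using assms(3)[of x] by (cases "x \<in> K") auto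
  then show ?thesis by blast
qed

lemma test_function_derivative:
  assumes "test_function \<psi>"
  shows "(\<psi> has_derivative (\<lambda>h. \<Sum>b\<in>Basis. (h \<bullet> b) * frechet_derivative \<psi> (at x) b)) (at x)"
proof -
  have D: "(\<psi> has_derivative frechet_derivative \<psi> (at x)) (at x)"
    using assms Ck_Suc_has_derivative unfolding test_function_def by blast
  then have lin: "linear (frechet_derivative \<psi> (at x))"
    by (rule has_derivative_linear)
  have "frechet_derivative \<psi> (at x) h = (\<Sum>b\<in>Basis. (h \<bullet> b) * frechet_derivative \<psi> (at x) b)" for h
  proof -
    have "frechet_derivative \<psi> (at x) h = frechet_derivative \<psi> (at x) (\<Sum>b\<in>Basis. (h \<bullet> b) *\<^sub>R b)"
      by (simp add: euclidean_representation)
    also have "\<dots> = (\<Sum>b\<in>Basis. (h \<bullet> b) * frechet_derivative \<psi> (at x) b)"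
      by (simp add: linear_sum[OF lin] linear_cmul[OF lin])
    finally show ?thesis .
  qed
  then have "frechet_derivative \<psi> (at x) = (\<lambda>h. \<Sum>b\<in>Basis. (h \<bullet> b) * frechet_derivative \<psi> (at x) b)"
    by (rule ext)
  with D show ?thesis by simp
qed

lemma test_function_partial_continuous:
  assumes "test_function \<psi>" "b \<in> Basis"
  shows "continuous_on UNIV (\<lambda>x. frechet_derivative \<psi> (at x) b)"
proof -
  have "Ck (Suc 0) \<psi>" using assms unfolding test_function_def by blast
  then show ?thesis using assms(2) by simp
qed

lemma test_function_bounded:
  assumes "test_function \<psi>"
  shows "\<exists>C. \<forall>x. \<bar>\<psi> x\<bar> \<le> C" "b \<in> Basis \<Longrightarrow> \<exists>C. \<forall>x. \<bar>frechet_derivative \<psi> (at x) b\<bar> \<le> C"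
proof -
  let ?K = "closure {x. \<psi> x \<noteq> 0}"
  have K: "compact ?K" using assms by (simp add: test_function_def)
  have out: "\<psi> x = 0" if "x \<notin> ?K" for x
    using that closure_subset[of "{x. \<psi> x \<noteq> 0}"] by auto
  show "\<exists>C. \<forall>x. \<bar>\<psi> x\<bar> \<le> C"
    using assms Ck_continuous
    by (intro bounded_if_continuous_compact_support[OF _ K out]) (auto simp: test_function_def)
  have zero: "frechet_derivative \<psi> (at x) b = 0" if "x \<notin> ?K" for x b
  proof -
    have "((\<lambda>_. 0) has_derivative (\<lambda>_. 0)) (at x)" by simp
    then have "(\<psi> has_derivative (\<lambda>_. 0)) (at x)"
    proof (rule has_derivative_transform_within_open)
      show "open (- ?K)" by (rule open_Compl[OF closed_closure])
      show "x \<in> - ?K" using that by (simp only: Compl_iff not_False_eq_True)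
      show "0 = \<psi> y" if "y \<in> - ?K" for y
        by (rule sym, rule out) (use that in \<open>simp only: Compl_iff not_False_eq_True\<close>)
    qed
    then have "frechet_derivative \<psi> (at x) = (\<lambda>_. 0)"
      by (rule frechet_derivative_at[symmetric])
    then show ?thesis by simp
  qed
  show "\<exists>C. \<forall>x. \<bar>frechet_derivative \<psi> (at x) b\<bar> \<le> C" if "b \<in> Basis"
    using test_function_partial_continuous[OF assms that]
    by (rule bounded_if_continuous_compact_support[OF _ K zero])
qed

section \<open>Finite vector measures and their variation\<close>

lemma sums_set_integral:
  fixes f :: "'a \<Rightarrow> 'b::{banach, second_countable_topology}"
  assumes "integrable M f" "range A \<subseteq> sets M" "disjoint_family A"
  shows "(\<lambda>i. LINT x:A i|M. f x) sums (LINT x:(\<Union>i. A i)|M. f x)"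
proof -
  have A: "A i \<in> sets M" for i using assms by auto
  have "(\<lambda>n. LINT x:(\<Union>i<n. A i)|M. f x) \<longlonglongrightarrow> (LINT x:(\<Union>i. A i)|M. f x)"
    unfolding set_lebesgue_integral_def
  proof (rule integral_dominated_convergence[where w = "\<lambda>x. norm (f x)"])
    show "AE x in M. (\<lambda>n. indicator (\<Union>i<n. A i) x *\<^sub>R f x) \<longlonglongrightarrow> indicator (\<Union>i. A i) x *\<^sub>R f x"
      by (intro AE_I2 tendsto_intros LIMSEQ_indicator_UN)
  qed (use assms A in \<open>auto split: split_indicator\<close>)
  moreover have "(LINT x:(\<Union>i<n. A i)|M. f x) = (\<Sum>i<n. LINT x:A i|M. f x)" for n
    using assms A
    by (intro set_integral_finite_Union)
      (auto simp: disjoint_family_on_def set_integrable_def intro: integrable_mult_indicator)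
  ultimately show ?thesis by (simp add: sums_def)
qed

lemma vector_measure_set_integral:
  assumes "sets M = sets borel" "integrable M f"
  shows "vector_measure (\<lambda>A. LINT x:A|M. f x)"
  using assms sums_set_integral[of M f] by (auto simp: vector_measure_def set_lebesgue_integral_def)

lemma vector_measure_diff:
  assumes "vector_measure \<mu>" "vector_measure \<nu>"
  shows "vector_measure (\<lambda>A. \<mu> A - \<nu> A)"
  using assms by (auto simp: vector_measure_def intro: sums_diff)

abbreviation borel_partitions :: "'a::euclidean_space set \<Rightarrow> (nat \<Rightarrow> 'a set) set" where
  "borel_partitions B \<equiv> {A. range A \<subseteq> sets borel \<and> disjoint_family A \<and> (\<Union>i. A i) = B}"

lemma borel_partition_trivial:
  assumes "B \<in> sets borel"
  shows "(\<lambda>i. if i = 0 then B else {}) \<in> borel_partitions B"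
  using assms by (auto simp: disjoint_family_on_def split: if_splits)

lemma ennreal_norm_le_suminf:
  assumes "f sums s"
  shows "ennreal (norm s) \<le> (\<Sum>i. ennreal (norm (f i)))"
proof (rule LIMSEQ_le_const2)
  show "(\<lambda>n. ennreal (norm (\<Sum>i<n. f i))) \<longlonglongrightarrow> ennreal (norm s)"
    using assms unfolding sums_def by (intro tendsto_ennrealI tendsto_norm)
  have "ennreal (norm (\<Sum>i<n. f i)) \<le> (\<Sum>i. ennreal (norm (f i)))" for n
  proof -
    have "ennreal (norm (\<Sum>i<n. f i)) \<le> (\<Sum>i<n. ennreal (norm (f i)))"
      by (simp add: sum_ennreal norm_sum ennreal_leI)
    also have "\<dots> \<le> (\<Sum>i. ennreal (norm (f i)))"
      by (intro sum_le_suminf) auto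
    finally show ?thesis .
  qed
  then show "\<exists>N. \<forall>n\<ge>N. ennreal (norm (\<Sum>i<n. f i)) \<le> (\<Sum>i. ennreal (norm (f i)))" by blast
qed

lemma suminf_swap_ennreal:
  fixes f :: "nat \<Rightarrow> nat \<Rightarrow> ennreal"
  shows "(\<Sum>i. \<Sum>j. f i j) = (\<Sum>j. \<Sum>i. f i j)"
proof -
  interpret pair_sigma_finite "count_space (UNIV::nat set)" "count_space (UNIV::nat set)"
    by (intro pair_sigma_finite.intro sigma_finite_measure_count_space)
  show ?thesis
    using Fubini'[of "\<lambda>i j. f i j"] by (simp add: nn_integral_count_space_nat pair_measure_countable)
qed

text \<open>
  The supremum in the definition is countably additive. Near-optimal partitions of the pieces combine into
  one partition of the union; conversely a partition of the union is refined by the pieces, and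
  refining increases the sum because \<open>|\<mu> A| \<le> \<Sum>\<^sub>j |\<mu> (A \<inter> B j)|\<close>.
\<close>

lemma
  fixes \<mu> :: "'a::euclidean_space set \<Rightarrow> 'b::euclidean_space"
  assumes \<mu>: "vector_measure \<mu>"
  shows sets_variation[simp]: "sets (variation \<mu>) = sets borel"
    and space_variation[simp]: "space (variation \<mu>) = UNIV"
    and emeasure_variation: "B \<in> sets borel \<Longrightarrow>
      emeasure (variation \<mu>) B = (SUP A\<in>borel_partitions B. \<Sum>i. ennreal (norm (\<mu> (A i))))"
proof -
  define v where "v B = (SUP A\<in>borel_partitions B. \<Sum>i. ennreal (norm (\<mu> (A i))))" for B
  have \<mu>0: "\<mu> {} = 0" using \<mu> by (simp add: vector_measure_def)
  show "sets (variation \<mu>) = sets borel" "space (variation \<mu>) = UNIV"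
    by (simp_all add: variation_def sigma_algebra.sets_measure_of_eq sets.sigma_algebra_axioms)
      (metis sets.sigma_sets_eq space_borel)
  have "positive (sets borel) v"
  proof -
    have "(\<Sum>i. ennreal (norm (\<mu> (A i)))) = 0" if "(\<Union>i. A i) = {}" for A :: "nat \<Rightarrow> 'a set"
      using that \<mu>0 by simp
    then have "v {} = 0"
      unfolding v_def by (intro antisym SUP_least) auto
    then show ?thesis by (simp add: positive_def)
  qed
  moreover have "countably_additive (sets borel) v"
  proof (rule countably_additiveI)
    fix B :: "nat \<Rightarrow> 'a set"
    assume B: "range B \<subseteq> sets borel" "disjoint_family B" "(\<Union>i. B i) \<in> sets borel"
    have Bj: "B j \<in> sets borel" for j using B by auto
    show "(\<Sum>j. v (B j)) = v (\<Union>j. B j)"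
    proof (rule antisym)
      have "\<exists>f. incseq f \<and> range f \<subseteq> (\<lambda>A. \<Sum>i. ennreal (norm (\<mu> (A i)))) ` borel_partitions (B j)
          \<and> v (B j) = (SUP k. f k)" for j
        unfolding v_def using borel_partition_trivial[OF Bj[of j]]
        by (intro ennreal_Sup_countable_SUP) blast
      then have "\<forall>j. \<exists>f. incseq f \<and> range f \<subseteq> (\<lambda>A. \<Sum>i. ennreal (norm (\<mu> (A i)))) ` borel_partitions (B j)
          \<and> v (B j) = (SUP k. f k)" ..
      from choice[OF this] obtain f
        where F: "\<forall>j. incseq (f j) \<and> range (f j) \<subseteq> (\<lambda>A. \<Sum>i. ennreal (norm (\<mu> (A i)))) ` borel_partitions (B j)
          \<and> v (B j) = (SUP k. f j k)" ..
      note f = F[THEN spec, THEN conjunct1] F[THEN spec, THEN conjunct2, THEN conjunct2]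
        F[THEN spec, THEN conjunct2, THEN conjunct1]
      have "(\<Sum>j. v (B j)) = (SUP k. \<Sum>j. f j k)"
        using f by (simp add: ennreal_suminf_SUP_eq)
      also have "\<dots> \<le> v (\<Union>j. B j)"
      proof (rule SUP_least)
        fix k
        have "\<exists>A. A \<in> borel_partitions (B j) \<and> f j k = (\<Sum>i. ennreal (norm (\<mu> (A i))))" for j
          using subsetD[OF f(3) rangeI[of "f j" k]] by (rule imageE) (rule exI, rule conjI)
        then have "\<forall>j. \<exists>A. A \<in> borel_partitions (B j) \<and> f j k = (\<Sum>i. ennreal (norm (\<mu> (A i))))" ..
        from choice[OF this] obtain A
          where "\<forall>j. A j \<in> borel_partitions (B j) \<and> f j k = (\<Sum>i. ennreal (norm (\<mu> (A j i))))" ..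
        note A = this[THEN spec, THEN conjunct1] this[THEN spec, THEN conjunct2]
        define A' where "A' n = A (fst (prod_decode n)) (snd (prod_decode n))" for n
        have sub: "A j i \<subseteq> B j" for i j using A(1)[of j] by auto
        have "disjoint_family A'"
          unfolding disjoint_family_on_def
        proof (intro ballI impI)
          fix m n :: nat assume "m \<noteq> n"
          then have ne: "prod_decode m \<noteq> prod_decode n" by (simp add: prod_decode_eq)
          show "A' m \<inter> A' n = {}"
          proof (cases "fst (prod_decode m) = fst (prod_decode n)")
            case True
            with ne have "snd (prod_decode m) \<noteq> snd (prod_decode n)" by (auto simp: prod_eq_iff)
            then show ?thesis
              using A(1)[of "fst (prod_decode n)"] True by (auto simp: A'_def disjoint_family_on_def)
          next
            case False
            then have "B (fst (prod_decode m)) \<inter> B (fst (prod_decode n)) = {}"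
              using B(2) by (auto simp: disjoint_family_on_def)
            then show ?thesis unfolding A'_def using sub by blast
          qed
        qed
        moreover have "(\<Union>n. A' n) = (\<Union>j. B j)"
        proof (intro equalityI subsetI)
          fix x assume "x \<in> (\<Union>j. B j)"
          then obtain j where "x \<in> B j" by blast
          with A(1)[of j] obtain i where "x \<in> A j i" by blast
          then have "x \<in> A' (prod_encode (j, i))" by (simp add: A'_def)
          then show "x \<in> (\<Union>n. A' n)" by blast
        qed (use sub in \<open>auto simp: A'_def\<close>)
        moreover have "A j i \<in> sets borel" for i j using A(1)[of j] by auto
        then have "range A' \<subseteq> sets borel" by (auto simp: A'_def)
        ultimately have "A' \<in> borel_partitions (\<Union>j. B j)" by auto
        then have "(\<Sum>n. ennreal (norm (\<mu> (A' n)))) \<le> v (\<Union>j. B j)"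
          unfolding v_def by (rule SUP_upper)
        also have "(\<Sum>n. ennreal (norm (\<mu> (A' n)))) = (\<Sum>j. f j k)"
          unfolding A'_def
          by (rule suminf_ennreal_2dimen[where f = "\<lambda>p. ennreal (norm (\<mu> (A (fst p) (snd p))))"])
            (simp only: A(2) fst_conv snd_conv)
        finally show "(\<Sum>j. f j k) \<le> v (\<Union>j. B j)" .
      qed
      finally show "(\<Sum>j. v (B j)) \<le> v (\<Union>j. B j)" .
    next
      show "v (\<Union>j. B j) \<le> (\<Sum>j. v (B j))"
        unfolding v_def[of "\<Union>j. B j"]
      proof (rule SUP_least)
        fix A assume A: "A \<in> borel_partitions (\<Union>j. B j)"
        have "ennreal (norm (\<mu> (A i))) \<le> (\<Sum>j. ennreal (norm (\<mu> (A i \<inter> B j))))" for i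
        proof -
          have "range (\<lambda>j. A i \<inter> B j) \<subseteq> sets borel" "disjoint_family (\<lambda>j. A i \<inter> B j)"
            using A B by (auto simp: disjoint_family_on_def)
          then have "(\<lambda>j. \<mu> (A i \<inter> B j)) sums \<mu> (\<Union>j. A i \<inter> B j)"
            by (rule \<mu>[unfolded vector_measure_def, THEN conjunct2, rule_format])
          moreover have "(\<Union>j. A i \<inter> B j) = A i" using A by blast
          ultimately show ?thesis by (metis ennreal_norm_le_suminf)
        qed
        then have "(\<Sum>i. ennreal (norm (\<mu> (A i)))) \<le> (\<Sum>i. \<Sum>j. ennreal (norm (\<mu> (A i \<inter> B j))))"
          by (intro suminf_le) auto
        also have "\<dots> = (\<Sum>j. \<Sum>i. ennreal (norm (\<mu> (A i \<inter> B j))))"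
          by (rule suminf_swap_ennreal)
        also have "\<dots> \<le> (\<Sum>j. v (B j))"
        proof (intro suminf_le allI)
          fix j
          have A': "range A \<subseteq> sets borel" "disjoint_family A" "(\<Union>i. A i) = (\<Union>j. B j)"
            using A by simp_all
          have "disjoint_family (\<lambda>i. A i \<inter> B j)"
            by (rule disjoint_family_subset[OF A'(2)]) (rule Int_lower1)
          moreover have "(\<Union>i. A i \<inter> B j) = B j"
            unfolding Int_commute[of _ "B j"] Int_UN_distrib[symmetric] A'(3) by blast
          moreover have "range (\<lambda>i. A i \<inter> B j) \<subseteq> sets borel"
            using A'(1) Bj by (intro image_subsetI sets.Int) (simp_all add: image_subset_iff)
          ultimately have "(\<lambda>i. A i \<inter> B j) \<in> borel_partitions (B j)"
            by simp
          then show "(\<Sum>i. ennreal (norm (\<mu> (A i \<inter> B j)))) \<le> v (B j)"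
            unfolding v_def by (rule SUP_upper2) simp
        qed auto
        finally show "(\<Sum>i. ennreal (norm (\<mu> (A i)))) \<le> (\<Sum>j. v (B j))" .
      qed
    qed
  qed
  ultimately show "emeasure (variation \<mu>) B = (SUP A\<in>borel_partitions B. \<Sum>i. ennreal (norm (\<mu> (A i))))"
    if "B \<in> sets borel"
    using that unfolding variation_def v_def
    by (intro emeasure_measure_of_sigma) (metis sets.sigma_algebra_axioms space_borel, auto)
qed

lemma norm_le_variation:
  assumes "vector_measure \<mu>" "B \<in> sets borel"
  shows "ennreal (norm (\<mu> B)) \<le> emeasure (variation \<mu>) B"
proof -
  have \<mu>0: "\<mu> {} = 0" using assms by (simp add: vector_measure_def)
  have "ennreal (norm (\<mu> B)) = (\<Sum>i. ennreal (norm (\<mu> (if i = (0::nat) then B else {}))))"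
    using \<mu>0 by (subst suminf_finite[of "{0}"]) auto
  also have "\<dots> \<le> emeasure (variation \<mu>) B"
    unfolding emeasure_variation[OF assms]
    by (rule SUP_upper[OF borel_partition_trivial[OF assms(2)], of "\<lambda>A. \<Sum>i. ennreal (norm (\<mu> (A i)))"])
  finally show ?thesis .
qed



text \<open>
  Adding \<open>V\<close> makes the set function nonnegative, so the Radon-Nikodym theorem for positive measures
  applies to \<open>V + \<nu>\<close>; subtracting \<open>1\<close> from that density gives the density of \<open>\<nu>\<close>.
\<close>

lemma signed_measure_density:
  fixes \<nu> :: "'a::euclidean_space set \<Rightarrow> real"
  assumes \<nu>: "vector_measure \<nu>" and V: "finite_measure V" "sets V = sets borel"
    and le: "\<And>A. A \<in> sets borel \<Longrightarrow> \<bar>\<nu> A\<bar> \<le> measure V A"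
  obtains \<tau> where "integrable V \<tau>" "\<And>A. A \<in> sets borel \<Longrightarrow> \<nu> A = (LINT x:A|V. \<tau> x)"
proof -
  interpret V: finite_measure V by fact
  define n where "n A = ennreal (measure V A + \<nu> A)" for A
  define N where "N = measure_of UNIV (sets borel) n"
  have sp: "space V = UNIV" using V(2) sets_eq_imp_space_eq by fastforce
  have [simp]: "sets N = sets borel" "space N = UNIV"
    by (simp_all add: N_def) (metis sets.sigma_sets_eq space_borel)
  have \<nu>0: "\<nu> {} = 0" using \<nu> by (simp add: vector_measure_def)
  have nonneg: "0 \<le> measure V A + \<nu> A" if "A \<in> sets borel" for A
    using le[OF that] by linarith
  have N: "emeasure N A = n A" if "A \<in> sets borel" for A
    using that unfolding N_def
  proof (intro emeasure_measure_of_sigma)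
    show "sigma_algebra UNIV (sets borel)" by (metis sets.sigma_algebra_axioms space_borel)
    show "positive (sets borel) n" by (simp add: positive_def n_def \<nu>0)
    show "countably_additive (sets borel) n"
    proof (rule countably_additiveI)
      fix B :: "nat \<Rightarrow> 'a set"
      assume B: "range B \<subseteq> sets borel" "disjoint_family B" "(\<Union>i. B i) \<in> sets borel"
      have "(\<lambda>i. measure V (B i) + \<nu> (B i)) sums (measure V (\<Union>i. B i) + \<nu> (\<Union>i. B i))"
        using B \<nu> V(2) by (intro sums_add V.finite_measure_UNION) (auto simp: vector_measure_def)
      then show "(\<Sum>i. n (B i)) = n (\<Union>i. B i)"
        unfolding n_def using B nonneg by (intro suminf_ennreal_eq) auto
    qed
  qed
  have "absolutely_continuous V N"
    unfolding absolutely_continuous_def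
  proof
    fix A assume "A \<in> null_sets V"
    then have A: "A \<in> sets borel" "measure V A = 0"
      using V(2) by (auto simp: null_sets_def measure_def)
    then have "\<nu> A = 0" using le[of A] by simp
    then show "A \<in> null_sets N"
      using A by (auto simp: null_sets_def N n_def)
  qed
  then obtain f where f: "f \<in> borel_measurable V" "density V f = N"
    using V.Radon_Nikodym[of N] by (auto simp: V(2))
  define g where "g x = enn2real (f x)" for x
  have g[measurable]: "g \<in> borel_measurable V" unfolding g_def using f(1) by measurable
  have g_nonneg: "0 \<le> g x" for x by (simp add: g_def)
  have Nf: "n A = (\<integral>\<^sup>+x. f x * indicator A x \<partial>V)" if "A \<in> sets borel" for A
    unfolding N[OF that, symmetric] f(2)[symmetric]
    using that V(2) f(1) by (intro emeasure_density) auto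
  have "(\<integral>\<^sup>+x. f x \<partial>V) \<noteq> \<infinity>"
    using Nf[of UNIV, symmetric] by (simp add: n_def)
  then have "AE x in V. f x \<noteq> \<infinity>" using f(1) by (intro nn_integral_PInf_AE)
  then have fg: "AE x in V. f x = ennreal (g x)" by (auto simp: g_def less_top)
  have gA: "(\<integral>\<^sup>+x. ennreal (indicator A x * g x) \<partial>V) = n A" if "A \<in> sets borel" for A
    unfolding Nf[OF that] using fg
    by (intro nn_integral_cong_AE) (auto split: split_indicator)
  have "integrable V g"
    using gA[of UNIV] by (intro integrableI_nonneg) (auto simp: n_def g_def less_top[symmetric])
  moreover have "(LINT x:A|V. g x) = measure V A + \<nu> A" if "A \<in> sets borel" for A
    unfolding set_lebesgue_integral_def using gA[OF that] nonneg[OF that] that V(2)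
    by (subst integral_eq_nn_integral) (auto simp: n_def g_nonneg)
  moreover have "(LINT x:A|V. 1) = measure V A" if "A \<in> sets borel" for A
    using that V(2) sp by (simp add: set_lebesgue_integral_def)
  moreover have "(LINT x:A|V. g x - 1) = (LINT x:A|V. g x) - (LINT x:A|V. 1)" if "A \<in> sets borel" for A
    using that V(2) \<open>integrable V g\<close> V.integrable_const[of "1::real"] unfolding set_integrable_def
    by (intro set_integral_diff; unfold set_integrable_def; intro integrable_mult_indicator) auto
  ultimately show ?thesis
    by (intro that[of "\<lambda>x. g x - 1"]) auto
qed

text \<open>
  Countably many \<open>w\<close> suffice: if \<open>|y| > 1\<close>, the open set of all \<open>w\<close> with \<open>|w| < y \<cdot> w\<close> contains \<open>y\<close> and hence a
  point of any dense set.
\<close>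

lemma AE_norm_le_if_inner_le:
  fixes \<sigma> :: "'a \<Rightarrow> 'b::euclidean_space"
  assumes "\<And>w. AE x in M. \<sigma> x \<bullet> w \<le> norm w"
  shows "AE x in M. norm (\<sigma> x) \<le> 1"
proof -
  obtain D :: "'b set" where D: "countable D" "\<And>X. open X \<Longrightarrow> X \<noteq> {} \<Longrightarrow> \<exists>d\<in>D. d \<in> X"
    using countable_dense_setE by metis
  have "AE x in M. \<forall>w\<in>D. \<sigma> x \<bullet> w \<le> norm w"
    using D(1) assms by (simp add: AE_ball_countable)
  moreover have "norm y \<le> 1" if "\<forall>w\<in>D. y \<bullet> w \<le> norm w" for y :: 'b
  proof (rule ccontr)
    assume "\<not> norm y \<le> 1"
    then have "norm y * 1 < norm y * norm y" by (intro mult_strict_left_mono) auto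
    then have "y \<in> {w. norm w < y \<bullet> w}"
      by (simp add: power2_eq_square flip: power2_norm_eq_inner)
    moreover have "open {w. norm w < y \<bullet> w}" by (intro open_Collect_less continuous_intros)
    ultimately obtain w where "w \<in> D" "norm w < y \<bullet> w" using D(2) by blast
    with that show False by force
  qed
  ultimately show ?thesis by auto
qed

lemma variation_UNIV_le_nn_integral:
  fixes f :: "'a::euclidean_space \<Rightarrow> 'b::euclidean_space"
  assumes M: "sets M = sets borel" "integrable M f" and \<mu>: "vector_measure \<mu>"
    and eq: "\<And>A. A \<in> sets borel \<Longrightarrow> \<mu> A = (LINT x:A|M. f x)"
  shows "emeasure (variation \<mu>) UNIV \<le> (\<integral>\<^sup>+x. ennreal (norm (f x)) \<partial>M)"
proof -
  have sp: "space M = UNIV" using M(1) sets_eq_imp_space_eq by fastforce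
  have [measurable]: "f \<in> borel_measurable M" using M by simp
  let ?D = "density M (\<lambda>x. ennreal (norm (f x)))"
  have le: "(\<Sum>i. ennreal (norm (\<mu> (A i)))) \<le> emeasure ?D UNIV" if A: "A \<in> borel_partitions UNIV" for A
  proof -
    have m: "A i \<in> sets borel" for i using A by auto
    have "ennreal (norm (\<mu> (A i))) \<le> emeasure ?D (A i)" for i
    proof -
      have "ennreal (norm (\<mu> (A i))) \<le> (\<integral>\<^sup>+x. ennreal (norm (indicator (A i) x *\<^sub>R f x)) \<partial>M)"
        unfolding eq[OF m] set_lebesgue_integral_def
        using m M by (intro integral_norm_bound_ennreal integrable_mult_indicator) auto
      also have "\<dots> = emeasure ?D (A i)"
        using m M by (subst emeasure_density)
          (auto intro!: nn_integral_cong split: split_indicator)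
      finally show ?thesis .
    qed
    then have "(\<Sum>i. ennreal (norm (\<mu> (A i)))) \<le> (\<Sum>i. emeasure ?D (A i))"
      by (intro suminf_le) auto
    also have "\<dots> = emeasure ?D UNIV"
      using A M by (subst suminf_emeasure) auto
    finally show ?thesis .
  qed
  have "emeasure (variation \<mu>) UNIV \<le> emeasure ?D UNIV"
    using le by (subst emeasure_variation[OF \<mu>]) (auto intro!: SUP_least simp del: UNIV_I)
  also have "\<dots> = (\<integral>\<^sup>+x. ennreal (norm (f x)) \<partial>M)"
    using M sp by (subst emeasure_density) auto
  finally show ?thesis .
qed

text \<open>
  The bound \<open>|\<sigma>| \<le> 1\<close> expresses \<open>|\<mu> A \<bullet> w| \<le> |w| |\<mu>|(A)\<close>. Equality holds almost everywhere because the total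
  variation is at most \<open>\<integral> |\<sigma>| d|\<mu>|\<close>, so that \<open>1 - |\<sigma>|\<close>, which is nonnegative, has integral at most \<open>0\<close>. A change on a
  null set makes the bound valid at every point.
\<close>

lemma polar_decomposition:
  fixes \<mu> :: "'a::euclidean_space set \<Rightarrow> 'b::euclidean_space"
  assumes \<mu>: "vector_measure \<mu>" and fin: "emeasure (variation \<mu>) UNIV < \<infinity>"
  obtains \<sigma> where "\<sigma> \<in> borel_measurable borel" "\<And>x. norm (\<sigma> x) \<le> 1"
    "AE x in variation \<mu>. norm (\<sigma> x) = 1"
    "\<And>A. A \<in> sets borel \<Longrightarrow> \<mu> A = (LINT x:A|variation \<mu>. \<sigma> x)"
proof -
  let ?V = "variation \<mu>"
  have sV[simp, measurable_cong]: "sets ?V = sets borel" "space ?V = UNIV" using \<mu> by simp_all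
  interpret V: finite_measure ?V using fin by (intro finite_measureI) auto
  have norm_le: "norm (\<mu> A) \<le> measure ?V A" if "A \<in> sets borel" for A
    using norm_le_variation[OF \<mu> that] by (simp add: V.emeasure_eq_measure)
  have "\<exists>\<tau>. integrable ?V \<tau> \<and> (\<forall>A\<in>sets borel. \<mu> A \<bullet> b = (LINT x:A|?V. \<tau> x))" if "b \<in> Basis" for b
  proof -
    have "vector_measure (\<lambda>A. \<mu> A \<bullet> b)"
      using \<mu> by (auto simp: vector_measure_def intro: bounded_linear.sums[OF bounded_linear_inner_left])
    moreover have "\<bar>\<mu> A \<bullet> b\<bar> \<le> measure ?V A" if "A \<in> sets borel" for A
      using norm_le[OF that] Basis_le_norm[OF \<open>b \<in> Basis\<close>, of "\<mu> A"] by linarith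
    ultimately show ?thesis
      by (rule signed_measure_density[OF _ V.finite_measure_axioms sV(1)]) auto
  qed
  then obtain \<tau> where \<tau>: "\<And>b. b \<in> Basis \<Longrightarrow> integrable ?V (\<tau> b)"
    "\<And>b A. b \<in> Basis \<Longrightarrow> A \<in> sets borel \<Longrightarrow> \<mu> A \<bullet> b = (LINT x:A|?V. \<tau> b x)"
    by metis
  define s where "s x = (\<Sum>b\<in>Basis. \<tau> b x *\<^sub>R b)" for x
  have s_int: "integrable ?V s"
    unfolding s_def using \<tau>(1) by (intro Bochner_Integration.integrable_sum integrable_scaleR_left)
  then have s[measurable]: "s \<in> borel_measurable borel"
    by (metis borel_measurable_integrable measurable_cong_sets sV(1))
  have inner_left: "(LINT x:A|?V. s x) \<bullet> w = (LINT x:A|?V. s x \<bullet> w)" if A: "A \<in> sets borel" for A w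
  proof -
    have "integrable ?V (\<lambda>x. indicator A x *\<^sub>R s x)"
      using A s_int by (intro integrable_mult_indicator) auto
    then show ?thesis
      unfolding set_lebesgue_integral_def
      by (subst integral_inner_left[symmetric]) simp_all
  qed
  have s_eq: "(LINT x:A|?V. s x) = \<mu> A" if A: "A \<in> sets borel" for A
  proof (rule euclidean_eqI)
    fix b :: 'b assume b: "b \<in> Basis"
    then have "(\<lambda>x. s x \<bullet> b) = \<tau> b" by (simp add: s_def)
    then show "(LINT x:A|?V. s x) \<bullet> b = \<mu> A \<bullet> b"
      using \<tau>(2)[OF b A] by (simp add: inner_left[OF A])
  qed
  have s_inner: "(LINT x:A|?V. s x \<bullet> w) = \<mu> A \<bullet> w" if A: "A \<in> sets borel" for A w
    using inner_left[OF A, of w] s_eq[OF A] by simp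
  \<comment> \<open>On the set where the bound fails, the integral of the positive excess would be at most \<open>0\<close>.\<close>
  have "AE x in ?V. s x \<bullet> w \<le> norm w" for w
  proof -
    define A where "A = {x. norm w < s x \<bullet> w}"
    have A: "A \<in> sets borel" unfolding A_def by measurable
    have int: "integrable ?V (\<lambda>x. indicator A x *\<^sub>R (s x \<bullet> w - norm w))"
      using A s_int by (intro integrable_mult_indicator) auto
    have "(LINT x:A|?V. s x \<bullet> w - norm w) = \<mu> A \<bullet> w - norm w * measure ?V A"
    proof -
      have "integrable ?V (\<lambda>x. indicator A x *\<^sub>R (s x \<bullet> w))"
        "integrable ?V (\<lambda>x. indicator A x *\<^sub>R norm w)"
        using A s_int by (intro integrable_mult_indicator; simp)+
      then have "(LINT x:A|?V. s x \<bullet> w - norm w) = (LINT x:A|?V. s x \<bullet> w) - (LINT x:A|?V. norm w)"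
        by (intro set_integral_diff) (simp_all add: set_integrable_def)
      moreover have "(LINT x:A|?V. norm w) = norm w * measure ?V A"
        using A by (simp add: set_lebesgue_integral_def)
      ultimately show ?thesis using s_inner[OF A, of w] by simp
    qed
    also have "\<dots> \<le> 0"
      using Cauchy_Schwarz_ineq2[of "\<mu> A" w] norm_le[OF A]
        mult_right_mono[OF norm_le[OF A], of "norm w"] by (simp add: mult.commute)
    finally have "(LINT x|?V. indicator A x *\<^sub>R (s x \<bullet> w - norm w)) \<le> 0"
      by (simp add: set_lebesgue_integral_def)
    moreover have nn: "0 \<le> indicator A x *\<^sub>R (s x \<bullet> w - norm w)" for x
      by (auto simp: A_def split: split_indicator)
    ultimately have "(LINT x|?V. indicator A x *\<^sub>R (s x \<bullet> w - norm w)) = 0"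
      by (intro antisym integral_nonneg_AE) auto
    then have "AE x in ?V. indicator A x *\<^sub>R (s x \<bullet> w - norm w) = 0"
      using integral_nonneg_eq_0_iff_AE[OF int] nn by auto
    then show ?thesis
      by eventually_elim (auto simp: A_def split: split_indicator_asm)
  qed
  then have s_le: "AE x in ?V. norm (s x) \<le> 1" by (rule AE_norm_le_if_inner_le)
  define \<sigma> where "\<sigma> x = (if norm (s x) \<le> 1 then s x else 0)" for x
  have \<sigma>[measurable]: "\<sigma> \<in> borel_measurable borel" unfolding \<sigma>_def by measurable
  have \<sigma>_le: "norm (\<sigma> x) \<le> 1" for x by (simp add: \<sigma>_def)
  have \<sigma>_int: "integrable ?V \<sigma>"
    by (rule V.integrable_const_bound[of _ 1]) (auto simp: \<sigma>_le measurable_cong_sets[OF sV(1) refl])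
  have \<sigma>_eq: "\<mu> A = (LINT x:A|?V. \<sigma> x)" if A: "A \<in> sets borel" for A
  proof -
    have "(LINT x:A|?V. \<sigma> x) = (LINT x:A|?V. s x)"
      unfolding set_lebesgue_integral_def using s_le A
      by (intro integral_cong_AE) (auto simp: \<sigma>_def measurable_cong_sets[OF sV(1) refl] elim!: eventually_mono)
    then show ?thesis by (simp add: s_eq[OF A])
  qed
  have "emeasure ?V UNIV \<le> (\<integral>\<^sup>+x. ennreal (norm (\<sigma> x)) \<partial>?V)"
    using \<sigma>_int \<mu> \<sigma>_eq by (intro variation_UNIV_le_nn_integral) auto
  also have "\<dots> = ennreal (LINT x|?V. norm (\<sigma> x))"
    using \<sigma>_int by (intro nn_integral_eq_integral) auto
  finally have "measure ?V UNIV \<le> (LINT x|?V. norm (\<sigma> x))"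
    by (simp add: V.emeasure_eq_measure)
  then have "(LINT x|?V. 1 - norm (\<sigma> x)) \<le> 0"
    using \<sigma>_int by simp
  then have "(LINT x|?V. 1 - norm (\<sigma> x)) = 0"
    using \<sigma>_le by (intro antisym integral_nonneg_AE) auto
  then have "AE x in ?V. 1 - norm (\<sigma> x) = 0"
    using \<sigma>_int \<sigma>_le by (subst (asm) integral_nonneg_eq_0_iff_AE) auto
  then show ?thesis
    by (intro that[OF \<sigma> \<sigma>_le _ \<sigma>_eq]) auto
qed


lemma variation_diff_le:
  assumes "vector_measure \<mu>" "vector_measure \<nu>"
  shows "emeasure (variation (\<lambda>A. \<mu> A - \<nu> A)) UNIV \<le> emeasure (variation \<mu>) UNIV + emeasure (variation \<nu>) UNIV"
proof -
  have "(\<Sum>i. ennreal (norm (\<mu> (A i) - \<nu> (A i)))) \<le> emeasure (variation \<mu>) UNIV + emeasure (variation \<nu>) UNIV"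
    if A: "A \<in> borel_partitions UNIV" for A
  proof -
    have "(\<Sum>i. ennreal (norm (\<mu> (A i) - \<nu> (A i)))) \<le> (\<Sum>i. ennreal (norm (\<mu> (A i))) + ennreal (norm (\<nu> (A i))))"
      by (intro suminf_le allI) (simp_all add: norm_triangle_ineq4 flip: ennreal_plus)
    also have "\<dots> = (\<Sum>i. ennreal (norm (\<mu> (A i)))) + (\<Sum>i. ennreal (norm (\<nu> (A i))))"
      by (intro suminf_add[symmetric]) auto
    also have "\<dots> \<le> emeasure (variation \<mu>) UNIV + emeasure (variation \<nu>) UNIV"
      unfolding emeasure_variation[OF assms(1) sets.top[of borel, unfolded space_borel]]
        emeasure_variation[OF assms(2) sets.top[of borel, unfolded space_borel]]
      using A by (intro add_mono SUP_upper)
    finally show ?thesis .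
  qed
  then show ?thesis
    by (subst emeasure_variation[OF vector_measure_diff[OF assms]])
      (auto intro!: SUP_least simp del: UNIV_I)
qed

section \<open>Jordan parts and the Lebesgue decomposition\<close>

text \<open>
  Among the Borel subsets \<open>A\<close> of \<open>B\<close>, the integral of \<open>\<tau>\<close> over \<open>A\<close> is largest for \<open>A = B \<inter> {\<tau> > 0}\<close>.
\<close>

lemma jordan_pos_density:
  assumes M: "sets M = sets borel" "integrable M \<tau>"
    and \<nu>: "\<And>A. A \<in> sets borel \<Longrightarrow> \<nu> A = (LINT x:A|M. \<tau> x)"
  shows "jordan_pos \<nu> = density M (\<lambda>x. ennreal (\<tau> x))"
proof -
  have sp: "space M = UNIV" using M(1) sets_eq_imp_space_eq by fastforce
  have [measurable]: "\<tau> \<in> borel_measurable M" using M by simp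
  let ?D = "density M (\<lambda>x. ennreal (\<tau> x))"
  have eq: "(SUP A\<in>{A. A \<in> sets borel \<and> A \<subseteq> B}. ennreal (\<nu> A)) = emeasure ?D B"
    if B: "B \<in> sets borel" for B
  proof (rule antisym)
    have pos: "ennreal (LINT x|M. indicator A x * max 0 (\<tau> x)) = (\<integral>\<^sup>+x. ennreal (\<tau> x) * indicator A x \<partial>M)"
      if "A \<in> sets borel" for A
    proof -
      have "integrable M (\<lambda>x. indicator A x *\<^sub>R max 0 (\<tau> x))"
        using that M by (intro integrable_mult_indicator) auto
      then have "ennreal (LINT x|M. indicator A x * max 0 (\<tau> x)) = (\<integral>\<^sup>+x. ennreal (indicator A x * max 0 (\<tau> x)) \<partial>M)"
        by (intro nn_integral_eq_integral[symmetric]) auto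
      also have "\<dots> = (\<integral>\<^sup>+x. ennreal (\<tau> x) * indicator A x \<partial>M)"
        by (intro nn_integral_cong) (auto split: split_indicator simp: max_def ennreal_neg)
      finally show ?thesis .
    qed
    show "(SUP A\<in>{A. A \<in> sets borel \<and> A \<subseteq> B}. ennreal (\<nu> A)) \<le> emeasure ?D B"
    proof (rule SUP_least)
      fix A assume A: "A \<in> {A. A \<in> sets borel \<and> A \<subseteq> B}"
      then have "\<nu> A \<le> (LINT x|M. indicator A x * max 0 (\<tau> x))"
        using M
        by (subst \<nu>) (auto simp: set_lebesgue_integral_def split: split_indicator
          intro!: integral_mono integrable_mult_indicator[of A M "\<lambda>x. max 0 (\<tau> x)", simplified]
            integrable_mult_indicator[of A M "\<tau>", simplified])
      then have "ennreal (\<nu> A) \<le> (\<integral>\<^sup>+x. ennreal (\<tau> x) * indicator A x \<partial>M)"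
        using A by (subst pos[symmetric]) (auto intro: ennreal_leI)
      also have "\<dots> = emeasure ?D A" using A M by (subst emeasure_density) auto
      also have "\<dots> \<le> emeasure ?D B" using A B M by (intro emeasure_mono) auto
      finally show "ennreal (\<nu> A) \<le> emeasure ?D B" .
    qed
    define P where "P = B \<inter> {x \<in> space M. 0 < \<tau> x}"
    have "{x \<in> space M. 0 < \<tau> x} \<in> sets M" by measurable
    then have P: "P \<in> sets borel" using B M by (auto simp: P_def)
    have "\<nu> P = (LINT x|M. indicator B x * max 0 (\<tau> x))"
      unfolding \<nu>[OF P] set_lebesgue_integral_def
      by (intro Bochner_Integration.integral_cong) (auto simp: P_def split: split_indicator)
    then have "emeasure ?D B = ennreal (\<nu> P)"
      using B M pos[OF B] by (subst emeasure_density) auto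
    also have "\<dots> \<le> (SUP A\<in>{A. A \<in> sets borel \<and> A \<subseteq> B}. ennreal (\<nu> A))"
      using P by (intro SUP_upper) (auto simp: P_def)
    finally show "emeasure ?D B \<le> (SUP A\<in>{A. A \<in> sets borel \<and> A \<subseteq> B}. ennreal (\<nu> A))" .
  qed
  have "jordan_pos \<nu> = measure_of UNIV (sets borel) (emeasure ?D)"
    unfolding jordan_pos_def
    by (rule measure_of_eq) (auto simp: eq sets.sigma_sets_eq[of borel, unfolded space_borel])
  also have "\<dots> = ?D"
    using measure_of_of_measure[of ?D] M sp by simp
  finally show ?thesis .
qed

lemma signed_integral_density:
  assumes M: "sets M = sets borel" "integrable M \<tau>"
    and \<nu>: "\<And>A. A \<in> sets borel \<Longrightarrow> \<nu> A = (LINT x:A|M. \<tau> x)"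
    and \<psi>: "\<psi> \<in> borel_measurable borel" "\<And>x. \<bar>\<psi> x\<bar> \<le> C"
  shows "signed_integral \<nu> \<psi> = (LINT x|M. \<psi> x * \<tau> x)"
proof -
  have [measurable]: "\<tau> \<in> borel_measurable M" "\<psi> \<in> borel_measurable M"
    using M \<psi>(1) by (simp_all add: measurable_cong_sets[OF M(1) refl])
  have neg: "- \<nu> A = (LINT x:A|M. - \<tau> x)" if "A \<in> sets borel" for A
    using \<nu>[OF that] by (simp add: set_lebesgue_integral_def)
  have dens: "density M (\<lambda>x. ennreal (t x)) = density M (\<lambda>x. ennreal (max 0 (t x)))" for t :: "_ \<Rightarrow> real"
    by (rule arg_cong[where f = "density M"]) (auto simp: max_def ennreal_neg)
  have int: "integrable M (\<lambda>x. max 0 (t x) * \<psi> x)" if "integrable M t" for t :: "_ \<Rightarrow> real"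
  proof (rule Bochner_Integration.integrable_bound[where f = "\<lambda>x. t x * C"])
    have "\<bar>max 0 (t x)\<bar> * \<bar>\<psi> x\<bar> \<le> \<bar>t x\<bar> * \<bar>C\<bar>" for x
      by (rule mult_mono) (auto intro: order_trans[OF \<psi>(2)])
    then show "AE x in M. norm (max 0 (t x) * \<psi> x) \<le> norm (t x * C)"
      by (simp add: abs_mult)
  qed (use that in auto)
  have pos_part: "jordan_pos \<nu> = density M (\<lambda>x. ennreal (max 0 (\<tau> x)))"
    unfolding dens[symmetric] by (rule jordan_pos_density[OF M \<nu>])
  have neg_part: "jordan_pos (\<lambda>A. - \<nu> A) = density M (\<lambda>x. ennreal (max 0 (- \<tau> x)))"
    unfolding dens[symmetric] by (rule jordan_pos_density[OF M(1) integrable_minus[OF M(2)] neg])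
  have "signed_integral \<nu> \<psi> = (LINT x|M. max 0 (\<tau> x) * \<psi> x) - (LINT x|M. max 0 (- \<tau> x) * \<psi> x)"
    unfolding signed_integral_def pos_part neg_part by (simp add: integral_density)
  also have "\<dots> = (LINT x|M. max 0 (\<tau> x) * \<psi> x - max 0 (- \<tau> x) * \<psi> x)"
    using int M by (intro Bochner_Integration.integral_diff[symmetric]) auto
  also have "\<dots> = (LINT x|M. \<psi> x * \<tau> x)"
    by (intro Bochner_Integration.integral_cong) (auto simp: max_def)
  finally show ?thesis .
qed

text \<open>
  \<open>Z\<close> is the union of a sequence of null sets whose \<open>V\<close>-measures approach the supremum. A null set disjoint
  from \<open>Z\<close> with positive \<open>V\<close>-measure could be added to \<open>Z\<close>, and the union would exceed the supremum.
\<close>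

lemma maximal_null_set:
  assumes V: "finite_measure V" "sets V = sets borel"
  obtains Z where "Z \<in> null_sets lborel"
    "\<And>A. A \<in> null_sets lborel \<Longrightarrow> A \<inter> Z = {} \<Longrightarrow> emeasure V A = 0"
proof -
  interpret V: finite_measure V by fact
  let ?\<alpha> = "SUP Z\<in>null_sets lborel. emeasure V Z"
  obtain f :: "nat \<Rightarrow> ennreal" where f: "range f \<subseteq> emeasure V ` null_sets lborel" "?\<alpha> = (SUP i. f i)"
    using ennreal_SUP_countable_SUP[of "null_sets lborel" "emeasure V"] by auto
  then have "\<forall>i. \<exists>Z. Z \<in> null_sets lborel \<and> f i = emeasure V Z" by blast
  then obtain Z where Z: "\<And>i. Z i \<in> null_sets lborel" "\<And>i. f i = emeasure V (Z i)" by metis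
  let ?Z = "\<Union>i. Z i"
  have null: "?Z \<in> null_sets lborel" using Z by auto
  then have mZ: "?Z \<in> sets V" using null_setsD2[OF null] V(2) by simp
  have "?\<alpha> \<le> emeasure V ?Z"
    unfolding f(2) Z(2) using mZ by (intro SUP_least emeasure_mono) auto
  show ?thesis
  proof (rule that[OF null])
    fix A assume A: "A \<in> null_sets lborel" "A \<inter> ?Z = {}"
    then have "A \<union> ?Z \<in> null_sets lborel" using null by (intro null_sets.Un)
    then have "emeasure V (A \<union> ?Z) \<le> ?\<alpha>" by (rule SUP_upper)
    also note \<open>?\<alpha> \<le> emeasure V ?Z\<close>
    finally have "emeasure V A + emeasure V ?Z \<le> emeasure V ?Z"
      using A mZ V(2) null_setsD2[OF A(1)] by (subst plus_emeasure) simp_all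
    then show "emeasure V A = 0"
      using measure_nonneg[of V A] by (simp add: V.emeasure_eq_measure flip: ennreal_plus)
  qed
qed

text \<open>
  Off a maximal Lebesgue null set \<open>Z\<close>, the variation is absolutely continuous, with some density \<open>k\<close>. The
  polar density times \<open>k\<close> is the required \<open>g\<close>, and the remainder lives on \<open>Z\<close>.
\<close>

lemma lebesgue_decomposition_exists:
  fixes \<mu> :: "'a::euclidean_space set \<Rightarrow> 'b::euclidean_space"
  assumes \<mu>: "vector_measure \<mu>" and fin: "emeasure (variation \<mu>) UNIV < \<infinity>"
  shows "\<exists>g. integrable lborel g \<and> singular_lborel (\<lambda>A. \<mu> A - (LINT x:A|lborel. g x))"
proof -
  let ?V = "variation \<mu>"
  have sV[simp, measurable_cong]: "sets ?V = sets borel" "space ?V = UNIV" using \<mu> by simp_all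
  interpret V: finite_measure ?V using fin by (intro finite_measureI) auto
  obtain \<sigma> where \<sigma>[measurable]: "\<sigma> \<in> borel_measurable borel" and \<sigma>_le: "\<And>x. norm (\<sigma> x) \<le> 1"
    and \<mu>\<sigma>: "\<And>A. A \<in> sets borel \<Longrightarrow> \<mu> A = (LINT x:A|?V. \<sigma> x)"
    using polar_decomposition[OF assms] by metis
  obtain Z where Z: "Z \<in> null_sets lborel"
    and Zmax: "\<And>A. A \<in> null_sets lborel \<Longrightarrow> A \<inter> Z = {} \<Longrightarrow> emeasure ?V A = 0"
    using maximal_null_set[OF V.finite_measure_axioms sV(1)] by metis
  have [measurable]: "Z \<in> sets borel" using Z by auto
  define W where "W = density ?V (\<lambda>x. ennreal (indicator (- Z) x))"
  have [simp]: "sets W = sets borel" "space W = UNIV" by (simp_all add: W_def)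
  have W: "emeasure W A = emeasure ?V (A - Z)" if "A \<in> sets borel" for A
  proof -
    have "emeasure W A = (\<integral>\<^sup>+x. ennreal (indicator (- Z) x) * indicator A x \<partial>?V)"
      unfolding W_def using that by (intro emeasure_density) auto
    also have "\<dots> = (\<integral>\<^sup>+x. indicator (A - Z) x \<partial>?V)"
      by (intro nn_integral_cong) (auto split: split_indicator)
    finally show ?thesis using that by simp
  qed
  have "absolutely_continuous lborel W"
    unfolding absolutely_continuous_def
  proof
    fix A :: "'a set" assume A: "A \<in> null_sets lborel"
    then have "A - Z \<in> null_sets lborel" using Z by auto
    then have "emeasure ?V (A - Z) = 0" by (rule Zmax) auto
    then show "A \<in> null_sets W" using A W[of A] by (auto simp: null_sets_def)
  qed
  then obtain f where f: "f \<in> borel_measurable lborel" "density lborel f = W"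
    using sigma_finite_measure.Radon_Nikodym[OF sigma_finite_lborel, of W] by auto
  have [measurable]: "f \<in> borel_measurable borel" using f(1) by simp
  define k where "k x = enn2real (f x)" for x
  have [measurable]: "k \<in> borel_measurable borel" unfolding k_def by measurable
  have "(\<integral>\<^sup>+x. f x \<partial>lborel) = emeasure W UNIV"
    using f(1) unfolding f(2)[symmetric] by (subst emeasure_density) auto
  also have "\<dots> \<noteq> \<infinity>" by (simp add: W)
  finally have "AE x in lborel. f x \<noteq> \<infinity>" using f(1) by (intro nn_integral_PInf_AE)
  then have "AE x in lborel. f x = ennreal (k x)" by (auto simp: k_def less_top)
  then have Wk: "W = density lborel (\<lambda>x. ennreal (k x))"
    unfolding f(2)[symmetric] using f(1) by (intro density_cong) auto
  have "integrable W \<sigma>"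
  proof (rule Bochner_Integration.integrable_bound[where f = "\<lambda>x. 1::real"])
    show "integrable W (\<lambda>x. 1::real)"
      by (auto intro!: finite_measure.integrable_const finite_measureI simp: W)
  qed (auto simp: \<sigma>_le measurable_cong_sets[OF \<open>sets W = sets borel\<close> refl])
  then have "integrable lborel (\<lambda>x. k x *\<^sub>R \<sigma> x)"
    unfolding Wk by (subst (asm) integrable_density) (auto simp: k_def)
  moreover have "\<mu> A - (LINT x:A|lborel. k x *\<^sub>R \<sigma> x) = 0" if A: "A \<in> sets borel" "A \<inter> Z = {}" for A
  proof -
    have "(LINT x:A|lborel. k x *\<^sub>R \<sigma> x) = (LINT x|lborel. k x *\<^sub>R (indicator A x *\<^sub>R \<sigma> x))"
      unfolding set_lebesgue_integral_def
      by (intro Bochner_Integration.integral_cong) (auto split: split_indicator)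
    also have "\<dots> = (LINT x|W. indicator A x *\<^sub>R \<sigma> x)"
      unfolding Wk using A by (subst integral_density) (auto simp: k_def)
    also have "\<dots> = (LINT x|?V. indicator (- Z) x *\<^sub>R (indicator A x *\<^sub>R \<sigma> x))"
      unfolding W_def using A by (subst integral_density) auto
    also have "\<dots> = \<mu> A"
      unfolding \<mu>\<sigma>[OF A(1)] set_lebesgue_integral_def using A(2)
      by (intro Bochner_Integration.integral_cong) (auto split: split_indicator)
    finally show ?thesis by simp
  qed
  then have "singular_lborel (\<lambda>A. \<mu> A - (LINT x:A|lborel. k x *\<^sub>R \<sigma> x))"
    unfolding singular_lborel_def using Z by blast
  ultimately show ?thesis by blast
qed

text \<open>
  By the existence of a Lebesgue decomposition, the choice in \<^const>\<open>ac_density\<close> selects an actual density.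
\<close>

lemma
  fixes \<mu> :: "'a::euclidean_space set \<Rightarrow> 'b::euclidean_space"
  assumes \<mu>: "vector_measure \<mu>" and fin: "emeasure (variation \<mu>) UNIV < \<infinity>"
  shows integrable_ac_density: "integrable lborel (ac_density \<mu>)"
    and vector_measure_singular_part: "vector_measure (singular_part \<mu>)"
    and finite_variation_singular_part: "emeasure (variation (singular_part \<mu>)) UNIV < \<infinity>"
proof -
  show int: "integrable lborel (ac_density \<mu>)"
    unfolding ac_density_def using someI_ex[OF lebesgue_decomposition_exists[OF assms]] by blast
  let ?\<alpha> = "\<lambda>A. LINT x:A|lborel. ac_density \<mu> x"
  have \<alpha>: "vector_measure ?\<alpha>" using int by (intro vector_measure_set_integral) auto
  have eq: "singular_part \<mu> = (\<lambda>A. \<mu> A - ?\<alpha> A)" by (auto simp: singular_part_def)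
  show "vector_measure (singular_part \<mu>)"
    unfolding eq by (rule vector_measure_diff[OF \<mu> \<alpha>])
  have "emeasure (variation ?\<alpha>) UNIV \<le> (\<integral>\<^sup>+x. ennreal (norm (ac_density \<mu> x)) \<partial>lborel)"
    using int \<alpha> by (intro variation_UNIV_le_nn_integral) auto
  also have "\<dots> < \<infinity>" using int by (simp add: integrable_iff_bounded)
  finally have "emeasure (variation \<mu>) UNIV + emeasure (variation ?\<alpha>) UNIV < \<infinity>"
    using fin by simp
  then show "emeasure (variation (singular_part \<mu>)) UNIV < \<infinity>"
    unfolding eq using variation_diff_le[OF \<mu> \<alpha>] by (rule le_less_trans[rotated])
qed

section \<open>Functionals on bounded Borel functions\<close>

definition bounded_borel :: "('a::euclidean_space \<Rightarrow> real) \<Rightarrow> bool" where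
  "bounded_borel f \<longleftrightarrow> f \<in> borel_measurable borel \<and> (\<exists>C. \<forall>x. \<bar>f x\<bar> \<le> C)"

text \<open>
  The model is \<open>\<psi> \<mapsto> \<integral> \<psi>(p(z)) \<tau>(z) dM(z)\<close>, the image under \<open>p\<close> of a signed measure on an auxiliary space,
  together with linear combinations of such functionals over different spaces.
\<close>

definition dominated_functional :: "(('a::euclidean_space \<Rightarrow> real) \<Rightarrow> real) \<Rightarrow> bool" where
  "dominated_functional T \<longleftrightarrow>
    (\<forall>f g c. bounded_borel f \<longrightarrow> bounded_borel g \<longrightarrow> T (\<lambda>x. f x + c * g x) = T f + c * T g) \<and>
    (\<forall>F f C. (\<forall>n. F n \<in> borel_measurable borel) \<longrightarrow> (\<forall>n x. \<bar>F n x\<bar> \<le> C) \<longrightarrow>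
      (\<forall>x. (\<lambda>n. F n x) \<longlonglongrightarrow> f x) \<longrightarrow> (\<lambda>n. T (F n)) \<longlonglongrightarrow> T f)"

lemma bounded_borelI:
  "f \<in> borel_measurable borel \<Longrightarrow> (\<And>x. \<bar>f x\<bar> \<le> C) \<Longrightarrow> bounded_borel f"
  by (auto simp: bounded_borel_def)

lemma bounded_borel_indicator: "A \<in> sets borel \<Longrightarrow> bounded_borel (indicator A)"
  by (rule bounded_borelI[of _ 1]) (auto split: split_indicator)

lemma bounded_borel_add_mult:
  assumes "bounded_borel f" "bounded_borel g"
  shows "bounded_borel (\<lambda>x. f x + c * g x)"
proof -
  from assms obtain C D where CD: "\<And>x. \<bar>f x\<bar> \<le> C" "\<And>x. \<bar>g x\<bar> \<le> D"
    by (auto simp: bounded_borel_def)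
  have "\<bar>f x + c * g x\<bar> \<le> C + \<bar>c\<bar> * D" for x
  proof -
    have "\<bar>f x + c * g x\<bar> \<le> \<bar>f x\<bar> + \<bar>c\<bar> * \<bar>g x\<bar>"
      by (metis abs_mult abs_triangle_ineq)
    also have "\<dots> \<le> C + \<bar>c\<bar> * D"
      using CD[of x] by (intro add_mono mult_left_mono) auto
    finally show ?thesis .
  qed
  then show ?thesis
    using assms by (intro bounded_borelI) (auto simp: bounded_borel_def)
qed

lemma integrable_bounded_borel_mult:
  fixes \<tau> :: "'z \<Rightarrow> real"
  assumes "bounded_borel f" "integrable M \<tau>" "p \<in> M \<rightarrow>\<^sub>M borel"
  shows "integrable M (\<lambda>z. f (p z) * \<tau> z)"
proof -
  obtain C where C: "\<And>x. \<bar>f x\<bar> \<le> C" and [measurable]: "f \<in> borel_measurable borel"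
    using assms(1) by (auto simp: bounded_borel_def)
  have [measurable]: "p \<in> M \<rightarrow>\<^sub>M borel" by fact
  have "\<bar>f (p z)\<bar> * \<bar>\<tau> z\<bar> \<le> \<bar>C\<bar> * \<bar>\<tau> z\<bar>" for z
    by (intro mult_right_mono order_trans[OF C]) auto
  then show ?thesis
    using assms(2) by (intro Bochner_Integration.integrable_bound[OF integrable_mult_right[OF assms(2), of C]])
      (auto simp: abs_mult)
qed

lemma dominated_functional_integral:
  fixes \<tau> :: "'z \<Rightarrow> real" and p :: "'z \<Rightarrow> 'a::euclidean_space"
  assumes "integrable M \<tau>" "p \<in> M \<rightarrow>\<^sub>M borel"
  shows "dominated_functional (\<lambda>\<psi>. LINT z|M. \<psi> (p z) * \<tau> z)"
  unfolding dominated_functional_def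
proof (intro conjI allI impI)
  fix f g :: "'a \<Rightarrow> real" and c assume fg: "bounded_borel f" "bounded_borel g"
  have "(LINT z|M. (f (p z) + c * g (p z)) * \<tau> z) = (LINT z|M. f (p z) * \<tau> z + c * (g (p z) * \<tau> z))"
    by (simp add: algebra_simps)
  also have "\<dots> = (LINT z|M. f (p z) * \<tau> z) + c * (LINT z|M. g (p z) * \<tau> z)"
    using integrable_bounded_borel_mult[OF fg(1) assms] integrable_bounded_borel_mult[OF fg(2) assms]
    by simp
  finally show "(LINT z|M. (f (p z) + c * g (p z)) * \<tau> z) = (LINT z|M. f (p z) * \<tau> z) + c * (LINT z|M. g (p z) * \<tau> z)" .
next
  fix F :: "nat \<Rightarrow> 'a \<Rightarrow> real" and f C
  assume F: "\<forall>n. F n \<in> borel_measurable borel" "\<forall>n x. \<bar>F n x\<bar> \<le> C" "\<forall>x. (\<lambda>n. F n x) \<longlonglongrightarrow> f x"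
  have [measurable]: "p \<in> M \<rightarrow>\<^sub>M borel" "\<And>n. F n \<in> borel_measurable borel" "\<tau> \<in> borel_measurable M"
    using assms F by auto
  have [measurable]: "f \<in> borel_measurable borel"
    by (rule borel_measurable_LIMSEQ_metric[of F]) (simp_all add: F(1,3))
  show "(\<lambda>n. LINT z|M. F n (p z) * \<tau> z) \<longlonglongrightarrow> (LINT z|M. f (p z) * \<tau> z)"
  proof (rule integral_dominated_convergence[where w = "\<lambda>z. C * \<bar>\<tau> z\<bar>"])
    show "AE z in M. norm (F n (p z) * \<tau> z) \<le> C * \<bar>\<tau> z\<bar>" for n
      by (intro AE_I2) (simp add: abs_mult mult_right_mono F(2)[rule_format])
    show "AE z in M. (\<lambda>n. F n (p z) * \<tau> z) \<longlonglongrightarrow> f (p z) * \<tau> z"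
      by (intro AE_I2 tendsto_mult tendsto_const F(3)[rule_format])
    show "integrable M (\<lambda>z. C * \<bar>\<tau> z\<bar>)"
      using assms(1) by simp
  qed measurable
qed

lemma dominated_functional_add_mult:
  assumes "dominated_functional S" "dominated_functional T"
  shows "dominated_functional (\<lambda>\<psi>. S \<psi> + c * T \<psi>)"
  unfolding dominated_functional_def
proof (intro conjI allI impI)
  fix f g :: "'a \<Rightarrow> real" and d assume "bounded_borel f" "bounded_borel g"
  then have "S (\<lambda>x. f x + d * g x) = S f + d * S g" "T (\<lambda>x. f x + d * g x) = T f + d * T g"
    using assms unfolding dominated_functional_def by blast+
  then show "S (\<lambda>x. f x + d * g x) + c * T (\<lambda>x. f x + d * g x) = S f + c * T f + d * (S g + c * T g)"
    by (simp add: algebra_simps)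
next
  fix F :: "nat \<Rightarrow> 'a \<Rightarrow> real" and f C
  assume "\<forall>n. F n \<in> borel_measurable borel" "\<forall>n x. \<bar>F n x\<bar> \<le> C" "\<forall>x. (\<lambda>n. F n x) \<longlonglongrightarrow> f x"
  then have "(\<lambda>n. S (F n)) \<longlonglongrightarrow> S f" "(\<lambda>n. T (F n)) \<longlonglongrightarrow> T f"
    using assms unfolding dominated_functional_def by blast+
  then show "(\<lambda>n. S (F n) + c * T (F n)) \<longlonglongrightarrow> S f + c * T f"
    by (intro tendsto_intros)
qed

context
  fixes T :: "('a::euclidean_space \<Rightarrow> real) \<Rightarrow> real"
  assumes T: "dominated_functional T"
begin

lemma dominated_functional_linear:
  "bounded_borel f \<Longrightarrow> bounded_borel g \<Longrightarrow> T (\<lambda>x. f x + c * g x) = T f + c * T g"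
  using T unfolding dominated_functional_def by blast

lemma dominated_functional_tendsto:
  "(\<And>n. F n \<in> borel_measurable borel) \<Longrightarrow> (\<And>n x. \<bar>F n x\<bar> \<le> C) \<Longrightarrow>
    (\<And>x. (\<lambda>n. F n x) \<longlonglongrightarrow> f x) \<Longrightarrow> (\<lambda>n. T (F n)) \<longlonglongrightarrow> T f"
  using T unfolding dominated_functional_def by blast

lemma dominated_functional_zero: "T (\<lambda>x. 0) = 0"
  using dominated_functional_linear[of "\<lambda>x. 0" "\<lambda>x. 0" 1] bounded_borel_indicator[of "{}"]
  by (simp add: indicator_def[abs_def])

lemma dominated_functional_eq_0_if_indicator:
  assumes ind: "\<And>A. A \<in> sets borel \<Longrightarrow> T (indicator A) = 0" and f: "bounded_borel f"
  shows "T f = 0"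
proof -
  have sum0: "bounded_borel (\<lambda>x. \<Sum>y\<in>I. y * indicator (A y) x) \<and> T (\<lambda>x. \<Sum>y\<in>I. y * indicator (A y) x) = 0"
    if "finite I" "\<And>y. A y \<in> sets borel" for I :: "real set" and A
    using that(1)
  proof induction
    case empty
    then show ?case
      using dominated_functional_zero bounded_borelI[of "\<lambda>x. 0" 0] by simp
  next
    case (insert y I)
    let ?S = "\<lambda>x. \<Sum>y\<in>I. y * indicator (A y) x"
    have "(\<lambda>x. \<Sum>y\<in>insert y I. y * indicator (A y) x) = (\<lambda>x. ?S x + y * indicator (A y) x)"
      by (rule ext, subst sum.insert[OF insert.hyps], rule add.commute)
    moreover have "T (\<lambda>x. ?S x + y * indicator (A y) x) = T ?S + y * T (indicator (A y))"
      using insert bounded_borel_indicator[OF that(2)] by (intro dominated_functional_linear) auto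
    moreover have "bounded_borel (\<lambda>x. ?S x + y * indicator (A y) x)"
      using insert bounded_borel_indicator[OF that(2)] by (intro bounded_borel_add_mult) auto
    ultimately show ?case using insert ind[OF that(2)] by simp
  qed
  obtain C where C: "\<And>x. \<bar>f x\<bar> \<le> C" and fm: "f \<in> borel_measurable borel"
    using f by (auto simp: bounded_borel_def)
  obtain F where F: "\<And>i. simple_function borel (F i)" "\<And>x. (\<lambda>i. F i x) \<longlonglongrightarrow> f x"
    "\<And>i x. dist (F i x) 0 \<le> 2 * dist (f x) 0"
    using borel_measurable_implies_sequence_metric[OF fm, of 0] by auto
  have "T (F i) = 0" for i
  proof -
    have "F i = (\<lambda>x. \<Sum>y\<in>F i ` UNIV. y * indicator (F i -` {y}) x)"
      using simple_function_indicator_representation_banach[OF F(1)[of i], of]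
      by (intro ext) (simp only: space_borel Int_UNIV_right UNIV_I real_scaleR_def mult.commute)
    moreover have "F i -` {y} \<in> sets borel" for y
      using measurable_sets[OF borel_measurable_simple_function[OF F(1)[of i]], of "{y}"] by simp
    moreover have "finite (F i ` UNIV)" using simple_functionD(1)[OF F(1)[of i]] by simp
    ultimately show ?thesis using sum0[of "F i ` UNIV" "\<lambda>y. F i -` {y}"] by (simp only:)
  qed
  moreover have "(\<lambda>i. T (F i)) \<longlonglongrightarrow> T f"
  proof (rule dominated_functional_tendsto)
    show "\<bar>F i x\<bar> \<le> 2 * C" for i x
      using F(3)[of i x] C[of x] by (simp add: dist_real_def)
  qed (use F(2) borel_measurable_simple_function[OF F(1)] in auto)
  ultimately show ?thesis by (simp add: LIMSEQ_const_iff)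
qed

text \<open>
  Test functions converge boundedly to indicators of boxes, boxes form an intersection-stable generator of
  the Borel sets, and the Borel sets on which \<open>T\<close> vanishes form a Dynkin system.
\<close>

lemma dominated_functional_eq_0_if_test_function:
  assumes test: "\<And>\<psi>. test_function \<psi> \<Longrightarrow> T \<psi> = 0" and f: "bounded_borel f"
  shows "T f = 0"
proof (rule dominated_functional_eq_0_if_indicator[OF _ f])
  have box: "T (indicator (box a b)) = 0" for a b
  proof -
    obtain \<psi> :: "nat \<Rightarrow> 'a \<Rightarrow> real" where \<psi>: "\<And>n. test_function (\<psi> n)"
      "\<And>n x. 0 \<le> \<psi> n x \<and> \<psi> n x \<le> 1" "\<And>x. (\<lambda>n. \<psi> n x) \<longlonglongrightarrow> indicator (box a b) x"
      using box_indicator_limit_test_functions[of a b] by blast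
    have "(\<lambda>n. T (\<psi> n)) \<longlonglongrightarrow> T (indicator (box a b))"
      using \<psi> by (intro dominated_functional_tendsto[of \<psi> 1])
        (auto simp: test_function_def intro!: borel_measurable_continuous_onI Ck_continuous)
    then show ?thesis using test[OF \<psi>(1)] by (simp add: LIMSEQ_const_iff)
  qed
  have univ: "T (indicator UNIV) = 0"
  proof -
    have "(\<lambda>n. indicator (box (- real n *\<^sub>R One) (real n *\<^sub>R One)) x) \<longlonglongrightarrow> (indicator UNIV x :: real)" for x :: 'a
    proof (rule tendsto_eventually)
      obtain N where "norm x < real N" using reals_Archimedean2 by blast
      then have "x \<in> box (- real n *\<^sub>R One) (real n *\<^sub>R One)" if "n \<ge> N" for n
        using that by (auto simp: mem_box abs_less_iff[symmetric]
          intro!: order_le_less_trans[OF Basis_le_norm])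
          (smt (verit) Basis_le_norm of_nat_mono)+
      then show "\<forall>\<^sub>F n in sequentially. indicator (box (- real n *\<^sub>R One) (real n *\<^sub>R One)) x = (indicator UNIV x :: real)"
        unfolding eventually_sequentially by (intro exI[of _ N]) simp
    qed
    then have "(\<lambda>n. T (indicator (box (- real n *\<^sub>R One) (real n *\<^sub>R One)))) \<longlonglongrightarrow> T (indicator UNIV)"
      by (intro dominated_functional_tendsto[of _ 1]) (auto split: split_indicator)
    then show ?thesis using box by (simp add: LIMSEQ_const_iff)
  qed
  fix A :: "'a set" assume "A \<in> sets borel"
  then have A: "A \<in> sigma_sets UNIV (range (\<lambda>(a, b). box a b :: 'a set))"
    by (simp add: borel_eq_box)
  have subset: "range (\<lambda>(a, b). box a b :: 'a set) \<subseteq> Pow UNIV" by simp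
  have stable: "Int_stable (range (\<lambda>(a, b). box a b :: 'a set))"
    by (auto simp: Int_stable_def box_Int_box)
  from stable subset A show "T (indicator A) = 0"
  proof (induction rule: sigma_sets_induct_disjoint)
    case (compl A)
    then have A: "A \<in> sets borel" by (simp add: borel_eq_box)
    have "indicator (UNIV - A) = (\<lambda>x. indicator UNIV x + (- 1) * indicator A x :: real)"
      by (auto split: split_indicator)
    then have "T (indicator (UNIV - A)) = T (indicator UNIV) + (- 1) * T (indicator A)"
      using A by (simp only:) (intro dominated_functional_linear bounded_borel_indicator; simp)
    then show ?case using univ compl by simp
  next
    case (union A)
    then have A: "A i \<in> sets borel" for i using union(2) by (auto simp: borel_eq_box)
    have fin: "T (indicator (\<Union>i<n. A i)) = 0" for n
    proof (induction n)
      case 0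
      then show ?case using dominated_functional_zero by (simp add: indicator_def[abs_def])
    next
      case (Suc n)
      have "(\<Union>i<n. A i) \<inter> A n = {}"
        using union(1) by (auto simp: disjoint_family_on_def) (metis disjoint_iff less_irrefl)
      then have "indicator (\<Union>i<Suc n. A i) = (\<lambda>x. indicator (\<Union>i<n. A i) x + 1 * indicator (A n) x :: real)"
        by (intro ext) (auto simp: lessThan_Suc split: split_indicator)
      then have "T (indicator (\<Union>i<Suc n. A i)) = T (indicator (\<Union>i<n. A i)) + 1 * T (indicator (A n))"
        using A by (simp only:) (intro dominated_functional_linear bounded_borel_indicator; auto)
      then show ?case using Suc union by simp
    qed
    have "(\<lambda>n. T (indicator (\<Union>i<n. A i))) \<longlonglongrightarrow> T (indicator (\<Union>i. A i))"
      using A by (intro dominated_functional_tendsto[of _ 1] LIMSEQ_indicator_UN)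
        (auto split: split_indicator)
    then show ?case using fin by (simp add: LIMSEQ_const_iff)
  qed (use box dominated_functional_zero in \<open>auto simp: indicator_def[abs_def]\<close>)
qed

end

section \<open>Approximation by continuous functions and translation in mean\<close>

text \<open>
  The closure in \<open>L\<^sup>1(M)\<close> of the continuous functions with compact support.
\<close>

definition L1_approximable :: "'a::euclidean_space measure \<Rightarrow> ('a \<Rightarrow> 'b::euclidean_space) \<Rightarrow> bool" where
  "L1_approximable M f \<longleftrightarrow> (\<forall>e>0. \<exists>c r. continuous_on UNIV c \<and> (\<forall>x. r \<le> norm x \<longrightarrow> c x = 0) \<and>
     integrable M c \<and> (LINT x|M. norm (f x - c x)) < e)"

lemma L1_approximableD:
  assumes "L1_approximable M f" "e > 0"
  obtains c r where "continuous_on UNIV c" "\<And>x. r \<le> norm x \<Longrightarrow> c x = 0"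
    "integrable M c" "(LINT x|M. norm (f x - c x)) < e"
  using assms unfolding L1_approximable_def by blast

lemma L1_approximable_near:
  assumes f: "integrable M f"
    and near: "\<And>e. e > 0 \<Longrightarrow> \<exists>g. integrable M g \<and> L1_approximable M g \<and> (LINT x|M. norm (f x - g x)) < e"
  shows "L1_approximable M f"
  unfolding L1_approximable_def
proof (intro allI impI)
  fix e :: real assume "e > 0"
  then obtain g where g: "integrable M g" "L1_approximable M g" "(LINT x|M. norm (f x - g x)) < e / 2"
    using near[of "e / 2"] by auto
  obtain c r where c: "continuous_on UNIV c" "\<And>x. r \<le> norm x \<Longrightarrow> c x = 0"
    "integrable M c" "(LINT x|M. norm (g x - c x)) < e / 2"
    using L1_approximableD[OF g(2), of "e / 2"] \<open>e > 0\<close> by auto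
  have "(LINT x|M. norm (f x - c x)) \<le> (LINT x|M. norm (f x - g x) + norm (g x - c x))"
    using f g(1) c(3)
    by (intro integral_mono integrable_norm Bochner_Integration.integrable_diff
        Bochner_Integration.integrable_add norm_diff_triangle_le[OF order_refl order_refl])
  also have "\<dots> = (LINT x|M. norm (f x - g x)) + (LINT x|M. norm (g x - c x))"
    using f g(1) c(3) by (intro Bochner_Integration.integral_add) auto
  also have "\<dots> < e" using g(3) c(4) by simp
  finally show "\<exists>c r. continuous_on UNIV c \<and> (\<forall>x. r \<le> norm x \<longrightarrow> c x = 0) \<and>
     integrable M c \<and> (LINT x|M. norm (f x - c x)) < e"
    using c by blast
qed

lemma L1_approximable_limit:
  assumes "\<And>n. L1_approximable M (s n)" "\<And>n. integrable M (s n)" "f \<in> borel_measurable M"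
    and "\<And>x. (\<lambda>n. s n x) \<longlonglongrightarrow> f x" "\<And>n x. norm (s n x) \<le> w x" "integrable M w"
  shows "integrable M f" "L1_approximable M f"
proof -
  have fw: "norm (f x) \<le> w x" for x
    using assms(4,5) by (intro LIMSEQ_le_const2[OF tendsto_norm[OF assms(4)]]) auto
  show f: "integrable M f"
    by (rule Bochner_Integration.integrable_bound[OF assms(6,3)])
      (use fw in \<open>auto intro!: AE_I2 order_trans[OF _ abs_ge_self]\<close>)
  have [measurable]: "f \<in> borel_measurable M" "\<And>n. s n \<in> borel_measurable M" "w \<in> borel_measurable M"
    using assms by auto
  have "(\<lambda>n. LINT x|M. norm (f x - s n x)) \<longlonglongrightarrow> (LINT x|M. 0)"
  proof (rule integral_dominated_convergence[where w = "\<lambda>x. 2 * w x"])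
    show "AE x in M. (\<lambda>n. norm (f x - s n x)) \<longlonglongrightarrow> 0"
    proof (rule AE_I2)
      fix x
      have "(\<lambda>n. norm (f x - s n x)) \<longlonglongrightarrow> norm (f x - f x)"
        by (intro tendsto_intros assms(4))
      then show "(\<lambda>n. norm (f x - s n x)) \<longlonglongrightarrow> 0" by simp
    qed
    show "AE x in M. norm (norm (f x - s n x)) \<le> 2 * w x" for n
    proof (rule AE_I2)
      fix x show "norm (norm (f x - s n x)) \<le> 2 * w x"
        using norm_triangle_ineq4[of "f x" "s n x"] fw[of x] assms(5)[of n x] by simp
    qed
  qed (use assms(6) in auto)
  then have lim: "(\<lambda>n. LINT x|M. norm (f x - s n x)) \<longlonglongrightarrow> 0" by simp
  show "L1_approximable M f"
  proof (rule L1_approximable_near[OF f])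
    fix e :: real assume "e > 0"
    with lim have "\<forall>\<^sub>F n in sequentially. (LINT x|M. norm (f x - s n x)) < e"
      by (rule order_tendstoD)
    then obtain n where "(LINT x|M. norm (f x - s n x)) < e"
      by (auto simp: eventually_sequentially)
    then show "\<exists>g. integrable M g \<and> L1_approximable M g \<and> (LINT x|M. norm (f x - g x)) < e"
      using assms by blast
  qed
qed

lemma L1_approximable_add:
  assumes f: "integrable M f" "L1_approximable M f" and g: "integrable M g" "L1_approximable M g"
  shows "L1_approximable M (\<lambda>x. f x + g x)"
  unfolding L1_approximable_def
proof (intro allI impI)
  fix e :: real assume "e > 0"
  obtain c r where c: "continuous_on UNIV c" "\<And>x. r \<le> norm x \<Longrightarrow> c x = 0"
    "integrable M c" "(LINT x|M. norm (f x - c x)) < e / 2"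
    using L1_approximableD[OF f(2), of "e / 2"] \<open>e > 0\<close> by auto
  obtain d q where d: "continuous_on UNIV d" "\<And>x. q \<le> norm x \<Longrightarrow> d x = 0"
    "integrable M d" "(LINT x|M. norm (g x - d x)) < e / 2"
    using L1_approximableD[OF g(2), of "e / 2"] \<open>e > 0\<close> by auto
  have "(LINT x|M. norm (f x + g x - (c x + d x))) \<le> (LINT x|M. norm (f x - c x) + norm (g x - d x))"
    using f g c d by (intro integral_mono norm_diff_triangle_ineq) auto
  also have "\<dots> = (LINT x|M. norm (f x - c x)) + (LINT x|M. norm (g x - d x))"
    using f g c d by (intro Bochner_Integration.integral_add) auto
  also have "\<dots> < e" using c d by simp
  finally show "\<exists>c r. continuous_on UNIV c \<and> (\<forall>x. r \<le> norm x \<longrightarrow> c x = 0) \<and>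
     integrable M c \<and> (LINT x|M. norm (f x + g x - c x)) < e"
    using c d by (intro exI[of _ "\<lambda>x. c x + d x"] exI[of _ "max r q"])
      (auto intro!: continuous_intros)
qed

lemma L1_approximable_scaleR:
  fixes f :: "'a::euclidean_space \<Rightarrow> real" and v :: "'b::euclidean_space"
  assumes f: "L1_approximable M f"
  shows "L1_approximable M (\<lambda>x. f x *\<^sub>R v)"
  unfolding L1_approximable_def
proof (intro allI impI)
  fix e :: real assume "e > 0"
  then obtain c r where c: "continuous_on UNIV c" "\<And>x. r \<le> norm x \<Longrightarrow> c x = 0"
    "integrable M c" "(LINT x|M. norm (f x - c x)) < e / (norm v + 1)"
    using L1_approximableD[OF f, of "e / (norm v + 1)"] by (auto simp: add_nonneg_pos)
  have "(LINT x|M. norm (f x *\<^sub>R v - c x *\<^sub>R v)) = (LINT x|M. norm (f x - c x)) * norm v"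
    by (simp add: scaleR_diff_left[symmetric])
  also have "\<dots> \<le> (LINT x|M. norm (f x - c x)) * (norm v + 1)"
    by (intro mult_left_mono integral_nonneg_AE) auto
  also have "\<dots> < e"
    using c(4) by (simp add: pos_less_divide_eq add_nonneg_pos)
  finally show "\<exists>c r. continuous_on UNIV c \<and> (\<forall>x. r \<le> norm x \<longrightarrow> c x = 0) \<and>
     integrable M c \<and> (LINT x|M. norm (f x *\<^sub>R v - c x)) < e"
    using c(1-3) by (intro exI[of _ "\<lambda>x. c x *\<^sub>R v"] exI[of _ r]) (auto intro!: continuous_intros)
qed

context
  fixes M :: "'a::euclidean_space measure"
  assumes sets_M: "sets M = sets borel" and finite_ball: "\<And>r. emeasure M (ball 0 r) < \<infinity>"
begin

lemma integrable_indicator_bounded: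
  assumes "A \<in> sets borel"
  shows "integrable M (indicator (A \<inter> ball 0 r) :: 'a \<Rightarrow> real)"
proof -
  have "emeasure M (A \<inter> ball 0 r) \<le> emeasure M (ball 0 r)"
    using assms sets_M by (intro emeasure_mono) auto
  then show ?thesis
    using assms sets_M finite_ball[of r] by (intro integrable_real_indicator) (auto intro: le_less_trans)
qed

text \<open>
  The functions \<open>min 1 (n dist(x, U\<^sup>c))\<close> increase to the indicator of \<open>U\<close>.
\<close>

lemma L1_approximable_open:
  assumes U: "open U" "U \<subseteq> ball 0 r"
  shows "L1_approximable M (indicator U :: 'a \<Rightarrow> real)"
proof -
  define c where "c n x = min 1 (real n * infdist x (- U))" for n :: nat and x
  have ne: "- U \<noteq> {}"
  proof
    assume "- U = {}"
    then have "bounded (UNIV :: 'a set)" using U(2) bounded_ball bounded_subset by (metis Compl_empty_eq double_compl)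
    then show False using not_bounded_UNIV by blast
  qed
  have out: "c n x = 0" if "x \<notin> U" for n x
    using that by (simp add: c_def)
  have cont: "continuous_on UNIV (c n)" for n
    unfolding c_def by (intro continuous_intros)
  have le: "norm (c n x) \<le> indicator (UNIV \<inter> ball 0 r) x" for n x
    using U(2) out[of x n] infdist_nonneg[of x "- U"] by (cases "x \<in> U") (auto simp: c_def)
  have int_r: "integrable M (indicator (UNIV \<inter> ball 0 r) :: 'a \<Rightarrow> real)"
    by (rule integrable_indicator_bounded) simp
  have int: "integrable M (c n)" for n
    using cont le by (intro Bochner_Integration.integrable_bound[OF int_r])
      (auto simp: measurable_cong_sets[OF sets_M refl] intro!: borel_measurable_continuous_onI AE_I2)
  have lim: "(\<lambda>n. c n x) \<longlonglongrightarrow> indicator U x" for x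
  proof (cases "x \<in> U")
    case True
    then have pos: "infdist x (- U) > 0"
      using U(1) ne by (intro infdist_pos_not_in_closed) auto
    obtain N where "1 / infdist x (- U) < real N" using reals_Archimedean2 by blast
    then have "c n x = 1" if "n \<ge> N" for n
    proof -
      have "1 / infdist x (- U) \<le> real n" using \<open>_ < real N\<close> that by simp
      then show ?thesis using pos by (simp add: c_def field_simps)
    qed
    then show ?thesis
      using True by (intro tendsto_eventually) (auto simp: eventually_sequentially)
  qed (simp add: out)
  have approx: "L1_approximable M (c n)" for n
    unfolding L1_approximable_def
    by (intro allI impI exI[of _ "c n"] exI[of _ r])
      (auto intro!: out cont int dest: subsetD[OF U(2)])
  show ?thesis
    by (rule L1_approximable_limit(2)[OF approx int _ lim le int_r])
      (use U in \<open>simp add: measurable_cong_sets[OF sets_M refl]\<close>)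
qed

text \<open>
  Intersecting with a fixed ball keeps all indicators integrable, also those of complements, so the sets in
  question form a Dynkin system.
\<close>

lemma L1_approximable_bounded_set:
  assumes "A \<in> sets borel"
  shows "L1_approximable M (indicator (A \<inter> ball 0 r) :: 'a \<Rightarrow> real)"
proof -
  have "Int_stable {S :: 'a set. open S}" by (auto intro: Int_stableI)
  moreover have "{S :: 'a set. open S} \<subseteq> Pow UNIV" by simp
  moreover have "A \<in> sigma_sets UNIV {S. open S}"
    using assms by (simp add: borel_def)
  ultimately show ?thesis
  proof (induction rule: sigma_sets_induct_disjoint)
    fix A :: "'a set" assume "A \<in> {S. open S}"
    then show "L1_approximable M (indicator (A \<inter> ball 0 r) :: 'a \<Rightarrow> real)"
      by (intro L1_approximable_open) auto
  next
    have "L1_approximable M (indicator {} :: 'a \<Rightarrow> real)"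
      by (rule L1_approximable_open[of _ 0]) auto
    then show "L1_approximable M (indicator ({} \<inter> ball 0 r) :: 'a \<Rightarrow> real)" by simp
  next
    fix A :: "'a set" assume A: "A \<in> sigma_sets UNIV {S. open S}"
      "L1_approximable M (indicator (A \<inter> ball 0 r) :: 'a \<Rightarrow> real)"
    have A': "A \<in> sets borel" using A(1) by (simp add: borel_def)
    have "indicator ((UNIV - A) \<inter> ball 0 r) = (\<lambda>x. indicator (ball 0 r) x + indicator (A \<inter> ball 0 r) x *\<^sub>R (- 1) :: real)"
      by (auto split: split_indicator)
    moreover have "integrable M (indicator (ball 0 r) :: 'a \<Rightarrow> real)"
      using integrable_indicator_bounded[of UNIV r] by simp
    moreover have "L1_approximable M (indicator (ball 0 r) :: 'a \<Rightarrow> real)"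
      by (rule L1_approximable_open[of _ r]) auto
    ultimately show "L1_approximable M (indicator ((UNIV - A) \<inter> ball 0 r) :: 'a \<Rightarrow> real)"
      using L1_approximable_scaleR[OF A(2), of "- 1 :: real"]
        integrable_scaleR_left[OF integrable_indicator_bounded[OF A', of r], of "- 1 :: real"]
      by (simp only:) (rule L1_approximable_add)
  next
    fix A :: "nat \<Rightarrow> 'a set" assume A: "disjoint_family A" "range A \<subseteq> sigma_sets UNIV {S. open S}"
      "\<And>i. L1_approximable M (indicator (A i \<inter> ball 0 r) :: 'a \<Rightarrow> real)"
    have A': "A i \<in> sets borel" for i using A(2) by (auto simp: borel_def)
    have int: "integrable M (indicator ((\<Union>i<n. A i) \<inter> ball 0 r) :: 'a \<Rightarrow> real)" for n
      using A' by (intro integrable_indicator_bounded) auto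
    have fin: "L1_approximable M (indicator ((\<Union>i<n. A i) \<inter> ball 0 r) :: 'a \<Rightarrow> real)" for n
    proof (induction n)
      case 0
      have "L1_approximable M (indicator {} :: 'a \<Rightarrow> real)"
        by (rule L1_approximable_open[of _ 0]) auto
      then show ?case by (simp add: indicator_def[abs_def])
    next
      case (Suc n)
      have "(\<Union>i<n. A i) \<inter> A n = {}"
        using A(1) by (auto simp: disjoint_family_on_def) (metis disjoint_iff less_irrefl)
      then have "indicator ((\<Union>i<Suc n. A i) \<inter> ball 0 r) =
          (\<lambda>x. indicator ((\<Union>i<n. A i) \<inter> ball 0 r) x + indicator (A n \<inter> ball 0 r) x :: real)"
        by (intro ext) (auto simp: lessThan_Suc split: split_indicator)
      then show ?case
        using Suc A(3)[of n] int[of n] integrable_indicator_bounded[OF A'[of n], of r]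
        by (simp only:) (rule L1_approximable_add)
    qed
    show "L1_approximable M (indicator ((\<Union>i. A i) \<inter> ball 0 r) :: 'a \<Rightarrow> real)"
    proof (rule L1_approximable_limit(2)[OF fin int])
      show "indicator ((\<Union>i. A i) \<inter> ball 0 r) \<in> borel_measurable M"
        using A' sets_M by (auto intro!: borel_measurable_indicator)
      show "(\<lambda>n. indicator ((\<Union>i<n. A i) \<inter> ball 0 r) x) \<longlonglongrightarrow> (indicator ((\<Union>i. A i) \<inter> ball 0 r) x :: real)" for x
        unfolding indicator_inter_arith by (intro tendsto_mult LIMSEQ_indicator_UN tendsto_const)
      show "norm (indicator ((\<Union>i<n. A i) \<inter> ball 0 r) x :: real) \<le> indicator (UNIV \<inter> ball 0 r) x" for n x
        by (auto split: split_indicator)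
      show "integrable M (indicator (UNIV \<inter> ball 0 r) :: 'a \<Rightarrow> real)"
        by (rule integrable_indicator_bounded) simp
    qed
  qed
qed

lemma integrable_L1_approximable:
  fixes f :: "'a \<Rightarrow> 'b::euclidean_space"
  assumes "integrable M f"
  shows "L1_approximable M f"
  using assms
proof (induction rule: integrable_induct)
  case (base A v)
  have A: "A \<in> sets borel" using base sets_M by simp
  have "L1_approximable M (indicator A :: 'a \<Rightarrow> real)"
  proof (rule L1_approximable_limit(2))
    show "L1_approximable M (indicator (A \<inter> ball 0 (real n)) :: 'a \<Rightarrow> real)" for n
      by (rule L1_approximable_bounded_set[OF A])
    show "integrable M (indicator (A \<inter> ball 0 (real n)) :: 'a \<Rightarrow> real)" for n
      by (rule integrable_indicator_bounded[OF A])
    show "(\<lambda>n. indicator (A \<inter> ball 0 (real n)) x) \<longlonglongrightarrow> (indicator A x :: real)" for x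
    proof (rule tendsto_eventually)
      obtain N where "norm x < real N" using reals_Archimedean2 by blast
      then show "\<forall>\<^sub>F n in sequentially. indicator (A \<inter> ball 0 (real n)) x = (indicator A x :: real)"
        unfolding eventually_sequentially
        by (intro exI[of _ N]) (auto split: split_indicator)
    qed
    show "integrable M (indicator A :: 'a \<Rightarrow> real)" using base by (intro integrable_real_indicator) auto
  qed (use base in \<open>auto split: split_indicator\<close>)
  then show ?case by (rule L1_approximable_scaleR)
next
  case (add f g)
  then show ?case by (intro L1_approximable_add)
next
  case (lim f s)
  have "space M = UNIV" using sets_eq_imp_space_eq[OF sets_M] by simp
  then show ?case
    by (intro L1_approximable_limit(2)[of M s f "\<lambda>x. 2 * norm (f x)"] lim(1-3,5)
        borel_measurable_integrable integrable_mult_right integrable_norm lim(4)) simp_all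
qed

end

lemma distr_lborel_translate: "distr lborel borel (\<lambda>x. x + z) = (lborel :: 'a::euclidean_space measure)"
proof -
  have "(\<lambda>x. x + z) = (+) z" by (auto simp: add.commute)
  then show ?thesis by (simp only: lborel_distr_plus)
qed

lemma
  fixes f :: "'a::euclidean_space \<Rightarrow> 'b::{banach, second_countable_topology}"
  assumes [measurable]: "f \<in> borel_measurable borel"
  shows lborel_integral_translate: "(LINT x|lborel. f (x + z)) = (LINT x|lborel. f x)"
    and lborel_integrable_translate: "integrable lborel (\<lambda>x. f (x + z)) \<longleftrightarrow> integrable lborel f"
  using integral_distr[of "\<lambda>x. x + z" lborel borel f] integrable_distr_eq[of "\<lambda>x. x + z" lborel borel f]
  by (simp_all add: distr_lborel_translate)

text \<open>
  Replacing \<open>g\<close> by a continuous \<open>c\<close> with compact support costs the same before and after the translation. For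
  \<open>c\<close> dominated convergence applies, since the translates are supported in one common ball.
\<close>

lemma L1_translation_continuous:
  fixes g :: "'a::euclidean_space \<Rightarrow> 'b::euclidean_space"
  assumes g: "integrable lborel g" and z: "z \<longlonglongrightarrow> 0"
  shows "(\<lambda>n. LINT x|lborel. norm (g (x + z n) - g x)) \<longlonglongrightarrow> 0"
proof (rule LIMSEQ_I)
  fix e :: real assume e: "e > 0"
  have [measurable]: "g \<in> borel_measurable borel" using g by auto
  have "L1_approximable lborel g"
    by (rule integrable_L1_approximable) (simp_all add: g emeasure_bounded_finite[simplified])
  then obtain c r where c: "continuous_on UNIV c" "\<And>x. r \<le> norm x \<Longrightarrow> c x = 0"
    "integrable lborel c" "(LINT x|lborel. norm (g x - c x)) < e / 3"
    by (rule L1_approximableD[of _ _ "e / 3"]) (use e in auto)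
  have [measurable]: "c \<in> borel_measurable borel" using c by auto
  have "bounded (c ` cball 0 r)"
    using c(1) by (intro compact_imp_bounded compact_continuous_image continuous_on_subset[OF c(1)]) auto
  then obtain B where B: "\<And>x. x \<in> cball 0 r \<Longrightarrow> norm (c x) \<le> B" unfolding bounded_iff by blast
  then have B: "norm (c x) \<le> max B 0" for x
    using c(2)[of x] B[of x] by (cases "norm x \<le> r") (simp_all add: max.coboundedI1)
  obtain R where R: "\<And>n. norm (z n) \<le> R"
    using convergent_imp_Bseq[OF convergentI[OF z]] by (auto simp: Bseq_def)
  have "(\<lambda>n. LINT x|lborel. norm (c (x + z n) - c x)) \<longlonglongrightarrow> (LINT x|(lborel :: 'a measure). 0)"
  proof (rule integral_dominated_convergence[where w = "\<lambda>x. indicator (cball 0 (r + R)) x *\<^sub>R (2 * max B 0)"])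
    show "integrable lborel (\<lambda>x::'a. indicator (cball 0 (r + R)) x *\<^sub>R (2 * max B 0))"
      by (intro integrable_scaleR_left integrable_real_indicator) (auto simp: emeasure_bounded_finite[simplified])
    show "AE x in lborel. (\<lambda>n. norm (c (x + z n) - c x)) \<longlonglongrightarrow> 0"
    proof (rule AE_I2)
      fix x
      have "(\<lambda>n. c (x + z n)) \<longlonglongrightarrow> c (x + 0)"
        by (intro continuous_on_tendsto_compose[OF c(1)] tendsto_intros z) auto
      then have "(\<lambda>n. norm (c (x + z n) - c x)) \<longlonglongrightarrow> norm (c (x + 0) - c x)"
        by (intro tendsto_intros)
      then show "(\<lambda>n. norm (c (x + z n) - c x)) \<longlonglongrightarrow> 0" by simp
    qed
    show "AE x in lborel. norm (norm (c (x + z n) - c x)) \<le> indicator (cball 0 (r + R)) x *\<^sub>R (2 * max B 0)" for n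
    proof (rule AE_I2)
      fix x
      show "norm (norm (c (x + z n) - c x)) \<le> indicator (cball 0 (r + R)) x *\<^sub>R (2 * max B 0)"
      proof (cases "x \<in> cball 0 (r + R)")
        case True
        then show ?thesis
          using norm_triangle_ineq4[of "c (x + z n)" "c x"] B[of "x + z n"] B[of x] by simp
      next
        case False
        then have "r + R < norm x" by simp
        then have "r \<le> norm x" "r \<le> norm (x + z n)"
          using R[of n] norm_diff_ineq[of x "z n"] norm_ge_zero[of "z n"] by linarith+
        then show ?thesis using False c(2) by simp
      qed
    qed
  qed measurable
  then have "(\<lambda>n. LINT x|lborel. norm (c (x + z n) - c x)) \<longlonglongrightarrow> 0" by simp
  then have "\<forall>\<^sub>F n in sequentially. (LINT x|lborel. norm (c (x + z n) - c x)) < e / 3"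
    by (rule order_tendstoD) (use e in simp)
  then obtain N where N: "\<And>n. n \<ge> N \<Longrightarrow> (LINT x|lborel. norm (c (x + z n) - c x)) < e / 3"
    by (auto simp: eventually_sequentially)
  have "(LINT x|lborel. norm (g (x + z n) - g x)) < e" if "n \<ge> N" for n
  proof -
    have int: "integrable lborel (\<lambda>x. g (x + z n))" "integrable lborel (\<lambda>x. c (x + z n))"
      using g c(3) by (simp_all add: lborel_integrable_translate)
    have "(LINT x|lborel. norm (g (x + z n) - g x)) \<le>
        (LINT x|lborel. norm (g (x + z n) - c (x + z n)) + (norm (c (x + z n) - c x) + norm (g x - c x)))"
    proof (rule integral_mono)
      fix x
      have "g (x + z n) - g x = (g (x + z n) - c (x + z n)) + ((c (x + z n) - c x) - (g x - c x))"
        by simp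
      then show "norm (g (x + z n) - g x) \<le> norm (g (x + z n) - c (x + z n)) + (norm (c (x + z n) - c x) + norm (g x - c x))"
        using order_trans[OF norm_triangle_ineq add_left_mono[OF norm_triangle_ineq4]] by (simp only:)
    qed (use int g c(3) in auto)
    also have "\<dots> = (LINT x|lborel. norm (g (x + z n) - c (x + z n))) +
        ((LINT x|lborel. norm (c (x + z n) - c x)) + (LINT x|lborel. norm (g x - c x)))"
      using int g c(3) by simp
    also have "(LINT x|lborel. norm (g (x + z n) - c (x + z n))) = (LINT x|lborel. norm (g x - c x))"
      by (rule lborel_integral_translate[of "\<lambda>x. norm (g x - c x)"]) simp
    finally show ?thesis using c(4) N[OF that] by simp
  qed
  then show "\<exists>N. \<forall>n\<ge>N. norm ((LINT x|lborel. norm (g (x + z n) - g x)) - 0) < e"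
    by (intro exI[of _ N]) auto
qed

section \<open>Difference quotients\<close>

text \<open>
  Lebesgue measure on \<open>[0,1]\<close>, kept as a measure on all Borel sets of the line so that product measures involve no
  restricted spaces.
\<close>

definition unit_interval :: "real measure" where
  "unit_interval = density lborel (\<lambda>t. ennreal (indicator {0..1} t))"

lemma sets_unit_interval[simp, measurable_cong]: "sets unit_interval = sets borel"
  by (simp add: unit_interval_def)

lemma space_unit_interval[simp]: "space unit_interval = UNIV"
  by (simp add: unit_interval_def)

lemma emeasure_unit_interval: "emeasure unit_interval UNIV = 1"
proof -
  have "(\<lambda>t. ennreal (indicator {0..1::real} t)) = indicator {0..1}"
    by (auto split: split_indicator)
  then show ?thesis
    unfolding unit_interval_def by (simp add: emeasure_density)
qed

lemma measure_unit_interval[simp]: "measure unit_interval UNIV = 1"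
  by (simp add: measure_def emeasure_unit_interval)

lemma finite_measure_unit_interval: "finite_measure unit_interval"
  by (rule finite_measureI) (simp add: emeasure_unit_interval)

lemma integral_unit_interval:
  fixes f :: "real \<Rightarrow> real"
  assumes "f \<in> borel_measurable borel"
  shows "(LINT t|unit_interval. f t) = (LINT t|lborel. f t * indicator {0..1} t)"
  unfolding unit_interval_def using assms
  by (subst integral_density) (auto simp: mult.commute)

lemma integrable_pair_bounded_mult:
  fixes f G :: "_ \<Rightarrow> real"
  assumes M1: "sigma_finite_measure M1" and M2: "finite_measure M2"
    and f: "integrable M1 f" and G[measurable]: "G \<in> borel_measurable (M1 \<Otimes>\<^sub>M M2)" "\<And>z. \<bar>G z\<bar> \<le> C"
  shows "integrable (M1 \<Otimes>\<^sub>M M2) (\<lambda>z. f (fst z) * G z)"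
proof -
  interpret M1: sigma_finite_measure M1 by fact
  interpret M2: finite_measure M2 by fact
  interpret pair_sigma_finite M1 M2 ..
  have [measurable]: "f \<in> borel_measurable M1" using f by auto
  have "integrable (M1 \<Otimes>\<^sub>M M2) (\<lambda>z. f (fst z) * C)"
    by (rule Fubini_integrable) (use f in auto)
  then show ?thesis
  proof (rule Bochner_Integration.integrable_bound)
    have "\<bar>f (fst z)\<bar> * \<bar>G z\<bar> \<le> \<bar>f (fst z)\<bar> * \<bar>C\<bar>" for z
      using G(2)[of z] by (intro mult_left_mono) auto
    then show "AE z in M1 \<Otimes>\<^sub>M M2. norm (f (fst z) * G z) \<le> norm (f (fst z) * C)"
      by (auto simp: abs_mult)
  qed measurable
qed

lemma test_function_increment:
  assumes "test_function \<psi>"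
  shows "\<psi> (x - h) - \<psi> x =
    - (LINT t|unit_interval. (\<Sum>b\<in>Basis. (h \<bullet> b) * frechet_derivative \<psi> (at (x - t *\<^sub>R h)) b))"
proof -
  let ?D = "\<lambda>t. \<Sum>b\<in>Basis. (h \<bullet> b) * frechet_derivative \<psi> (at (x - t *\<^sub>R h)) b"
  have cont: "continuous_on UNIV (\<lambda>t. frechet_derivative \<psi> (at (x - t *\<^sub>R h)) b)" if "b \<in> Basis" for b
    by (rule continuous_on_compose2[OF test_function_partial_continuous[OF assms that]])
      (auto intro!: continuous_intros)
  then have D: "continuous_on UNIV ?D" by (intro continuous_intros)
  have deriv: "((\<lambda>t. \<psi> (x - t *\<^sub>R h)) has_real_derivative - ?D t) (at t)" for t
  proof -
    have "((\<lambda>t. x - t *\<^sub>R h) has_derivative (\<lambda>s. - (s *\<^sub>R h))) (at t)"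
      by (auto intro!: derivative_eq_intros)
    from has_derivative_compose[OF this test_function_derivative[OF assms]]
    have "((\<lambda>t. \<psi> (x - t *\<^sub>R h)) has_derivative
        (\<lambda>r. \<Sum>b\<in>Basis. (- (r *\<^sub>R h) \<bullet> b) * frechet_derivative \<psi> (at (x - t *\<^sub>R h)) b)) (at t)" .
    moreover have "(\<lambda>r. \<Sum>b\<in>Basis. (- (r *\<^sub>R h) \<bullet> b) * frechet_derivative \<psi> (at (x - t *\<^sub>R h)) b) = (*) (- ?D t)"
      by (intro ext) (simp add: sum_distrib_left sum_negf mult_ac)
    ultimately show ?thesis
      by (simp only: has_field_derivative_def)
  qed
  have "(LINT t|lborel. - ?D t * indicator {0..1} t) = \<psi> (x - 1 *\<^sub>R h) - \<psi> (x - 0 *\<^sub>R h)"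
  proof (rule integral_FTC_Icc_real[where F = "\<lambda>t. \<psi> (x - t *\<^sub>R h)"])
    have "continuous_on UNIV (\<lambda>t. - ?D t)" by (intro continuous_on_minus D)
    then show "isCont (\<lambda>t. - ?D t) t" for t
      by (simp only: continuous_on_eq_continuous_at[OF open_UNIV] UNIV_I simp_thms Ball_def)
  qed (use deriv in simp_all)
  moreover have "(LINT t|unit_interval. ?D t) = (LINT t|lborel. ?D t * indicator {0..1} t)"
    using D by (intro integral_unit_interval borel_measurable_continuous_onI)
  ultimately show ?thesis by simp
qed

text \<open>
  The distributional gradient of \<open>u\<close> is \<open>g dx + s W\<close>. In the application \<open>g\<close> is the density of the absolutely
  continuous part of \<open>Du\<close>, \<open>W\<close> the variation of the singular part and \<open>s\<close> its polar density.
\<close>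

locale gradient_decomposition =
  fixes u :: "'a::euclidean_space \<Rightarrow> real" and g s :: "'a \<Rightarrow> 'a" and W :: "'a measure"
  assumes u: "integrable lborel u" and g: "integrable lborel g"
    and W: "finite_measure W" "sets W = sets borel"
    and s_borel: "s \<in> borel_measurable borel" and s_le: "\<And>x. norm (s x) \<le> 1"
    and deriv: "\<And>\<psi> b. test_function \<psi> \<Longrightarrow> b \<in> Basis \<Longrightarrow>
      (LINT x|lborel. u x * frechet_derivative \<psi> (at x) b) =
      - ((LINT x|lborel. \<psi> x * (g x \<bullet> b)) + (LINT x|W. \<psi> x * (s x \<bullet> b)))"
begin

sublocale W: finite_measure W by (rule W)
sublocale U: finite_measure unit_interval by (rule finite_measure_unit_interval)
sublocale UW: pair_sigma_finite unit_interval W ..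
sublocale UL: pair_sigma_finite unit_interval lborel ..

lemma sets_W[simp, measurable_cong]: "sets W = sets borel" by (rule W)
lemma space_W[simp]: "space W = UNIV" using sets_eq_imp_space_eq[OF W(2)] by simp

lemma measurable_uges[measurable]:
  "u \<in> borel_measurable borel" "g \<in> borel_measurable borel" "s \<in> borel_measurable borel"
  using u g s_borel by auto

lemma integrable_s: "integrable W s"
  by (rule W.integrable_const_bound[of _ 1]) (auto simp: s_le)

lemma integrable_time_lborel:
  fixes f :: "'a \<Rightarrow> real"
  assumes f: "integrable lborel f" and [measurable]: "G \<in> borel_measurable (unit_interval \<Otimes>\<^sub>M lborel)"
    and G: "\<And>z. \<bar>G z\<bar> \<le> C"
  shows "integrable (unit_interval \<Otimes>\<^sub>M lborel) (\<lambda>(t, x). G (t, x) * f x)"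
proof -
  have [measurable]: "f \<in> borel_measurable borel" using f by auto
  have "integrable (lborel \<Otimes>\<^sub>M unit_interval) (\<lambda>z. f (fst z) * G (snd z, fst z))"
    using G by (intro integrable_pair_bounded_mult f sigma_finite_lborel finite_measure_unit_interval) auto
  from UL.integrable_product_swap_iff[THEN iffD1, of "\<lambda>(t, x). G (t, x) * f x"] this
  show ?thesis by (simp add: case_prod_unfold mult.commute)
qed

lemma integrable_time_W:
  fixes f :: "'a \<Rightarrow> real"
  assumes f: "integrable W f" and [measurable]: "G \<in> borel_measurable (unit_interval \<Otimes>\<^sub>M W)"
    and G: "\<And>z. \<bar>G z\<bar> \<le> C"
  shows "integrable (unit_interval \<Otimes>\<^sub>M W) (\<lambda>(t, x). G (t, x) * f x)"
proof -
  have [measurable]: "f \<in> borel_measurable W" using f by auto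
  have "integrable (W \<Otimes>\<^sub>M unit_interval) (\<lambda>z. f (fst z) * G (snd z, fst z))"
    using G by (intro integrable_pair_bounded_mult f W.sigma_finite_measure_axioms finite_measure_unit_interval) auto
  from UW.integrable_product_swap_iff[THEN iffD1, of "\<lambda>(t, x). G (t, x) * f x"] this
  show ?thesis by (simp add: case_prod_unfold mult.commute)
qed

text \<open>
  The increment is moved from \<open>u\<close> to \<open>\<psi>\<close>, where it is an integral of the derivative along a segment. For every \<open>t\<close>
  the translate of \<open>\<psi>\<close> by \<open>t h\<close> is again a test function, to which the weak formulation applies.
\<close>

lemma increment_test_function:
  assumes \<psi>: "test_function \<psi>"
  shows "(LINT x|lborel. \<psi> x * (u (x + h) - u x)) =
    (LINT t|unit_interval. (LINT x|lborel. \<psi> (x - t *\<^sub>R h) * (g x \<bullet> h)) + (LINT x|W. \<psi> (x - t *\<^sub>R h) * (s x \<bullet> h)))"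
proof -
  obtain C where C: "\<And>x. \<bar>\<psi> x\<bar> \<le> C" using test_function_bounded(1)[OF \<psi>] by blast
  have \<psi>_cont: "continuous_on UNIV \<psi>" using \<psi> Ck_continuous unfolding test_function_def by blast
  then have [measurable]: "\<psi> \<in> borel_measurable borel" by (rule borel_measurable_continuous_onI)
  have bb: "bounded_borel \<psi>" using C by (intro bounded_borelI) auto
  define D where "D x = (\<Sum>b\<in>Basis. (h \<bullet> b) * frechet_derivative \<psi> (at x) b)" for x
  have D_cont: "continuous_on UNIV D"
    unfolding D_def by (intro continuous_intros test_function_partial_continuous \<psi>)
  then have [measurable]: "D \<in> borel_measurable borel" by (rule borel_measurable_continuous_onI)
  have "\<exists>K. \<forall>b\<in>Basis. \<forall>x. \<bar>frechet_derivative \<psi> (at x) b\<bar> \<le> K b"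
    using test_function_bounded(2)[OF \<psi>] by (intro bchoice ballI) auto
  then obtain K where K: "\<And>b x. b \<in> Basis \<Longrightarrow> \<bar>frechet_derivative \<psi> (at x) b\<bar> \<le> K b" by blast
  have D_le: "\<bar>D x\<bar> \<le> (\<Sum>b\<in>Basis. \<bar>h \<bullet> b\<bar> * K b)" for x
    unfolding D_def by (rule order_trans[OF sum_abs]) (auto intro!: sum_mono mult_left_mono K simp: abs_mult)
  have int_D: "integrable lborel (\<lambda>x. u x * frechet_derivative \<psi> (at (x - z)) b)" if b: "b \<in> Basis" for z b
  proof -
    have "continuous_on UNIV (\<lambda>x. frechet_derivative \<psi> (at (x - z)) b)"
      by (rule continuous_on_compose2[OF test_function_partial_continuous[OF \<psi> b]]) (auto intro!: continuous_intros)
    then have "bounded_borel (\<lambda>x. frechet_derivative \<psi> (at (x - z)) b)"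
      using K[OF b] by (intro bounded_borelI borel_measurable_continuous_onI)
    from integrable_bounded_borel_mult[OF this u, of "\<lambda>x. x"]
    show ?thesis by (simp add: mult.commute)
  qed
  have "integrable lborel (\<lambda>x. u (x + h))"
    using u lborel_integrable_translate[OF measurable_uges(1), of h] by blast
  from integrable_bounded_borel_mult[OF bb this, of "\<lambda>x. x"]
    integrable_bounded_borel_mult[OF bb u, of "\<lambda>x. x"] integrable_bounded_borel_mult[OF bb u, of "\<lambda>x. x - h"]
  have int_u: "integrable lborel (\<lambda>x. \<psi> x * u (x + h))" "integrable lborel (\<lambda>x. \<psi> x * u x)"
    "integrable lborel (\<lambda>x. \<psi> (x - h) * u x)"
    by simp_all
  have "(LINT x|lborel. \<psi> x * (u (x + h) - u x)) = (LINT x|lborel. \<psi> x * u (x + h)) - (LINT x|lborel. \<psi> x * u x)"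
    using int_u by (simp add: right_diff_distrib)
  also have "(LINT x|lborel. \<psi> x * u (x + h)) = (LINT x|lborel. \<psi> (x - h) * u x)"
    using lborel_integral_translate[of "\<lambda>x. \<psi> (x - h) * u x" h] by simp
  also have "\<dots> - (LINT x|lborel. \<psi> x * u x) = (LINT x|lborel. u x * (\<psi> (x - h) - \<psi> x))"
    using int_u by (simp add: algebra_simps)
  also have "\<dots> = - (LINT x|lborel. LINT t|unit_interval. D (x - t *\<^sub>R h) * u x)"
    unfolding test_function_increment[OF \<psi>] D_def[symmetric] by (simp add: mult.commute)
  also have "(LINT x|lborel. LINT t|unit_interval. D (x - t *\<^sub>R h) * u x) =
      (LINT t|unit_interval. LINT x|lborel. D (x - t *\<^sub>R h) * u x)"
    using integrable_time_lborel[OF u, of "\<lambda>(t, x). D (x - t *\<^sub>R h)" "\<Sum>b\<in>Basis. \<bar>h \<bullet> b\<bar> * K b"] D_le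
    by (intro UL.Fubini_integral) (simp add: case_prod_unfold)
  also have "\<dots> = (LINT t|unit_interval. - ((LINT x|lborel. \<psi> (x - t *\<^sub>R h) * (g x \<bullet> h)) + (LINT x|W. \<psi> (x - t *\<^sub>R h) * (s x \<bullet> h))))"
  proof (rule Bochner_Integration.integral_cong[OF refl])
    fix t
    let ?\<psi> = "\<lambda>x. \<psi> (x - t *\<^sub>R h)"
    have test: "test_function ?\<psi>" using test_function_translate[OF \<psi>, of "- (t *\<^sub>R h)"] by simp
    have fd: "frechet_derivative ?\<psi> (at x) = frechet_derivative \<psi> (at (x - t *\<^sub>R h))" for x
    proof -
      have "\<psi> differentiable at (x + - (t *\<^sub>R h))"
        unfolding differentiable_def by (rule exI) (rule test_function_derivative[OF \<psi>])
      from frechet_derivative_at[OF frechet_derivative_translate[OF this]]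
      show ?thesis by simp
    qed
    have bbt: "bounded_borel ?\<psi>" using C by (intro bounded_borelI) auto
    have i1: "integrable lborel (\<lambda>x. ?\<psi> x * (g x \<bullet> w))" for w
      using integrable_bounded_borel_mult[OF bbt, of lborel "\<lambda>x. g x \<bullet> w" "\<lambda>x. x"] g by simp
    have i2: "integrable W (\<lambda>x. ?\<psi> x * (s x \<bullet> w))" for w
      using integrable_bounded_borel_mult[OF bbt, of W "\<lambda>x. s x \<bullet> w" "\<lambda>x. x"] integrable_s
      by simp
    have expand: "v \<bullet> h = (\<Sum>b\<in>Basis. (h \<bullet> b) * (v \<bullet> b))" for v :: 'a
      by (subst euclidean_inner) (simp add: mult.commute)
    have "(LINT x|lborel. D (x - t *\<^sub>R h) * u x) =
        (LINT x|lborel. (\<Sum>b\<in>Basis. (h \<bullet> b) * (u x * frechet_derivative \<psi> (at (x - t *\<^sub>R h)) b)))"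
      by (simp add: D_def sum_distrib_left mult_ac)
    also have "\<dots> = (\<Sum>b\<in>Basis. (h \<bullet> b) * (LINT x|lborel. u x * frechet_derivative \<psi> (at (x - t *\<^sub>R h)) b))"
      using int_D by simp
    also have "\<dots> = (\<Sum>b\<in>Basis. (h \<bullet> b) * - ((LINT x|lborel. ?\<psi> x * (g x \<bullet> b)) + (LINT x|W. ?\<psi> x * (s x \<bullet> b))))"
      using deriv[OF test] by (intro sum.cong refl) (simp add: fd)
    also have "\<dots> = - ((\<Sum>b\<in>Basis. (h \<bullet> b) * (LINT x|lborel. ?\<psi> x * (g x \<bullet> b))) + (\<Sum>b\<in>Basis. (h \<bullet> b) * (LINT x|W. ?\<psi> x * (s x \<bullet> b))))"
      by (simp add: sum.distrib[symmetric] sum_negf[symmetric] algebra_simps)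
    also have "(\<Sum>b\<in>Basis. (h \<bullet> b) * (LINT x|lborel. ?\<psi> x * (g x \<bullet> b))) = (LINT x|lborel. ?\<psi> x * (g x \<bullet> h))"
    proof -
      have "(\<Sum>b\<in>Basis. (h \<bullet> b) * (LINT x|lborel. ?\<psi> x * (g x \<bullet> b))) = (LINT x|lborel. (\<Sum>b\<in>Basis. (h \<bullet> b) * (?\<psi> x * (g x \<bullet> b))))"
        using i1 by simp
      also have "\<dots> = (LINT x|lborel. ?\<psi> x * (g x \<bullet> h))"
        unfolding expand by (simp add: sum_distrib_left mult_ac)
      finally show ?thesis .
    qed
    also have "(\<Sum>b\<in>Basis. (h \<bullet> b) * (LINT x|W. ?\<psi> x * (s x \<bullet> b))) = (LINT x|W. ?\<psi> x * (s x \<bullet> h))"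
    proof -
      have "(\<Sum>b\<in>Basis. (h \<bullet> b) * (LINT x|W. ?\<psi> x * (s x \<bullet> b))) = (LINT x|W. (\<Sum>b\<in>Basis. (h \<bullet> b) * (?\<psi> x * (s x \<bullet> b))))"
        using i2 by simp
      also have "\<dots> = (LINT x|W. ?\<psi> x * (s x \<bullet> h))"
        unfolding expand by (simp add: sum_distrib_left mult_ac)
      finally show ?thesis .
    qed
    finally show "(LINT x|lborel. D (x - t *\<^sub>R h) * u x) =
      - ((LINT x|lborel. ?\<psi> x * (g x \<bullet> h)) + (LINT x|W. ?\<psi> x * (s x \<bullet> h)))" .
  qed
  finally show ?thesis by (simp only: integral_minus minus_minus)
qed

lemma time_integrals:
  assumes \<psi>: "bounded_borel \<psi>"
  shows "integrable unit_interval (\<lambda>t. LINT x|lborel. \<psi> (x - t *\<^sub>R h) * (g x \<bullet> h))"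
    and "integrable unit_interval (\<lambda>t. LINT x|W. \<psi> (x - t *\<^sub>R h) * (s x \<bullet> h))"
    and "(LINT t|unit_interval. LINT x|lborel. \<psi> (x - t *\<^sub>R h) * (g x \<bullet> h)) =
      (LINT z|(unit_interval \<Otimes>\<^sub>M lborel). \<psi> (snd z - fst z *\<^sub>R h) * (g (snd z) \<bullet> h))"
    and "(LINT t|unit_interval. LINT x|W. \<psi> (x - t *\<^sub>R h) * (s x \<bullet> h)) =
      (LINT z|(unit_interval \<Otimes>\<^sub>M W). \<psi> (snd z - fst z *\<^sub>R h) * (s (snd z) \<bullet> h))"
proof -
  obtain C where C: "\<And>x. \<bar>\<psi> x\<bar> \<le> C" and [measurable]: "\<psi> \<in> borel_measurable borel"
    using \<psi> by (auto simp: bounded_borel_def)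
  have 1: "integrable (unit_interval \<Otimes>\<^sub>M lborel) (\<lambda>(t, x). \<psi> (x - t *\<^sub>R h) * (g x \<bullet> h))"
    using integrable_time_lborel[of "\<lambda>x. g x \<bullet> h" "\<lambda>(t, x). \<psi> (x - t *\<^sub>R h)" C] g C
    by (simp add: case_prod_unfold)
  have 2: "integrable (unit_interval \<Otimes>\<^sub>M W) (\<lambda>(t, x). \<psi> (x - t *\<^sub>R h) * (s x \<bullet> h))"
    using integrable_time_W[of "\<lambda>x. s x \<bullet> h" "\<lambda>(t, x). \<psi> (x - t *\<^sub>R h)" C] integrable_s C
    by (simp add: case_prod_unfold)
  show "integrable unit_interval (\<lambda>t. LINT x|lborel. \<psi> (x - t *\<^sub>R h) * (g x \<bullet> h))"
    "(LINT t|unit_interval. LINT x|lborel. \<psi> (x - t *\<^sub>R h) * (g x \<bullet> h)) =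
      (LINT z|(unit_interval \<Otimes>\<^sub>M lborel). \<psi> (snd z - fst z *\<^sub>R h) * (g (snd z) \<bullet> h))"
    using UL.integrable_fst[OF 1] UL.integral_fst[OF 1] by (simp_all add: case_prod_unfold)
  show "integrable unit_interval (\<lambda>t. LINT x|W. \<psi> (x - t *\<^sub>R h) * (s x \<bullet> h))"
    "(LINT t|unit_interval. LINT x|W. \<psi> (x - t *\<^sub>R h) * (s x \<bullet> h)) =
      (LINT z|(unit_interval \<Otimes>\<^sub>M W). \<psi> (snd z - fst z *\<^sub>R h) * (s (snd z) \<bullet> h))"
    using UW.integrable_fst[OF 2] UW.integral_fst[OF 2] by (simp_all add: case_prod_unfold)
qed

text \<open>
  All three integrals are dominated functionals of \<open>\<psi>\<close>, the last two as images of measures on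
  \<open>[0,1] \<times> \<real>\<^sup>N\<close> under \<open>(t, x) \<mapsto> x - t h\<close>.
\<close>

lemma increment_bounded_borel:
  assumes \<psi>: "bounded_borel \<psi>"
  shows "(LINT x|lborel. \<psi> x * (u (x + h) - u x)) =
    (LINT t|unit_interval. LINT x|lborel. \<psi> (x - t *\<^sub>R h) * (g x \<bullet> h)) +
    (LINT t|unit_interval. LINT x|W. \<psi> (x - t *\<^sub>R h) * (s x \<bullet> h))"
proof -
  define A where "A \<psi> = (LINT x|lborel. \<psi> x * (u (x + h) - u x))" for \<psi>
  define B where "B \<psi> = (LINT z|(unit_interval \<Otimes>\<^sub>M lborel). \<psi> (snd z - fst z *\<^sub>R h) * (g (snd z) \<bullet> h))" for \<psi>
  define D where "D \<psi> = (LINT z|(unit_interval \<Otimes>\<^sub>M W). \<psi> (snd z - fst z *\<^sub>R h) * (s (snd z) \<bullet> h))" for \<psi>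
  have "integrable lborel (\<lambda>x. u (x + h) - u x)"
    using u lborel_integrable_translate[OF measurable_uges(1), of h] by (intro Bochner_Integration.integrable_diff) blast+
  then have "dominated_functional A"
    unfolding A_def by (intro dominated_functional_integral) auto
  moreover have "dominated_functional B"
    unfolding B_def using integrable_time_lborel[of "\<lambda>x. g x \<bullet> h" "\<lambda>_. 1" 1] g
    by (intro dominated_functional_integral) (auto simp: case_prod_unfold)
  moreover have "dominated_functional D"
    unfolding D_def using integrable_time_W[of "\<lambda>x. s x \<bullet> h" "\<lambda>_. 1" 1] integrable_s
    by (intro dominated_functional_integral) (auto simp: case_prod_unfold)
  ultimately have "dominated_functional (\<lambda>\<psi>. A \<psi> + (- 1) * B \<psi> + (- 1) * D \<psi>)"
    by (intro dominated_functional_add_mult)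
  then have "A \<psi> + (- 1) * B \<psi> + (- 1) * D \<psi> = 0"
  proof (rule dominated_functional_eq_0_if_test_function[OF _ _ \<psi>])
    fix \<psi> :: "'a \<Rightarrow> real" assume test: "test_function \<psi>"
    then have "bounded_borel \<psi>"
      using test_function_bounded(1)[OF test] Ck_continuous
      by (auto simp: test_function_def bounded_borel_def intro!: borel_measurable_continuous_onI)
    note ti = time_integrals[OF this, of h]
    show "A \<psi> + (- 1) * B \<psi> + (- 1) * D \<psi> = 0"
      using increment_test_function[OF test, of h] ti unfolding A_def B_def D_def by simp
  qed
  then show ?thesis
    using time_integrals[OF \<psi>, of h] by (simp add: A_def B_def D_def)
qed

definition remainder :: "'a \<Rightarrow> 'a \<Rightarrow> real" where
  "remainder h x = u (x + h) - u x - g x \<bullet> h"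

definition modulus :: "'a \<Rightarrow> real" where
  "modulus z = (LINT x|lborel. norm (g (x + z) - g x))"

definition mean_modulus :: "'a \<Rightarrow> real" where
  "mean_modulus h = (LINT t|unit_interval. modulus (t *\<^sub>R h))"

definition mean_shift :: "('a \<Rightarrow> real) \<Rightarrow> 'a \<Rightarrow> real" where
  "mean_shift f h = (LINT z|(unit_interval \<Otimes>\<^sub>M W). \<bar>f (snd z - fst z *\<^sub>R h) - f (snd z)\<bar>)"

lemma integrable_translates:
  "integrable lborel (\<lambda>x. u (x + z))" "integrable lborel (\<lambda>x. g (x + z))"
  using u g lborel_integrable_translate[OF measurable_uges(1), of z]
    lborel_integrable_translate[OF measurable_uges(2), of z] by blast+

lemma integrable_remainder: "integrable lborel (remainder h)"
  unfolding remainder_def[abs_def] using integrable_translates u g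
  by (intro Bochner_Integration.integrable_diff integrable_inner_left) auto

lemma modulus_nonneg: "0 \<le> modulus z"
  unfolding modulus_def by (intro integral_nonneg_AE) auto

lemma modulus_le: "modulus z \<le> 2 * (LINT x|lborel. norm (g x))"
proof -
  have "modulus z \<le> (LINT x|lborel. norm (g (x + z)) + norm (g x))"
    unfolding modulus_def using integrable_translates g
    by (intro integral_mono norm_triangle_ineq4) auto
  also have "\<dots> = (LINT x|lborel. norm (g (x + z))) + (LINT x|lborel. norm (g x))"
    using integrable_translates g by (intro Bochner_Integration.integral_add) auto
  also have "(LINT x|lborel. norm (g (x + z))) = (LINT x|lborel. norm (g x))"
    by (rule lborel_integral_translate[of "\<lambda>x. norm (g x)"]) simp
  finally show ?thesis by simp
qed

lemma measurable_modulus[measurable]: "modulus \<in> borel_measurable borel"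
  unfolding modulus_def[abs_def] by measurable

lemma integrable_modulus: "integrable unit_interval (\<lambda>t. modulus (t *\<^sub>R h))"
  by (rule U.integrable_const_bound[of _ "2 * (LINT x|lborel. norm (g x))"])
    (auto simp: modulus_le modulus_nonneg)

lemma mean_modulus_tendsto:
  assumes "z \<longlonglongrightarrow> 0"
  shows "(\<lambda>n. mean_modulus (z n)) \<longlonglongrightarrow> 0"
proof -
  have "(\<lambda>n. mean_modulus (z n)) \<longlonglongrightarrow> (LINT t|unit_interval. (0::real))"
    unfolding mean_modulus_def
  proof (rule integral_dominated_convergence[where w = "\<lambda>_. 2 * (LINT x|lborel. norm (g x))"])
    show "AE t in unit_interval. (\<lambda>n. modulus (t *\<^sub>R z n)) \<longlonglongrightarrow> 0"
    proof (rule AE_I2)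
      fix t
      have "(\<lambda>n. t *\<^sub>R z n) \<longlonglongrightarrow> t *\<^sub>R 0" by (intro tendsto_intros assms)
      then show "(\<lambda>n. modulus (t *\<^sub>R z n)) \<longlonglongrightarrow> 0"
        unfolding modulus_def by (intro L1_translation_continuous[OF g]) simp
    qed
  qed (auto simp: modulus_le modulus_nonneg)
  then show ?thesis by simp
qed

sublocale UWfin: finite_measure "unit_interval \<Otimes>\<^sub>M W"
  by (rule finite_measure_pair_measure) unfold_locales

lemma integrable_UW:
  fixes f :: "real \<times> 'a \<Rightarrow> real"
  assumes "f \<in> borel_measurable (unit_interval \<Otimes>\<^sub>M W)" "\<And>z. \<bar>f z\<bar> \<le> C"
  shows "integrable (unit_interval \<Otimes>\<^sub>M W) f"
  using assms by (intro UWfin.integrable_const_bound[of _ C]) auto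

lemma integrable_shift:
  fixes f :: "'a \<Rightarrow> real"
  assumes [measurable]: "f \<in> borel_measurable borel" and C: "\<And>x. \<bar>f x\<bar> \<le> C"
  shows "integrable (unit_interval \<Otimes>\<^sub>M W) (\<lambda>z. \<bar>f (snd z - fst z *\<^sub>R h) - f (snd z)\<bar>)"
proof (rule integrable_UW[of _ "2 * C"])
  show "\<bar>\<bar>f (snd z - fst z *\<^sub>R h) - f (snd z)\<bar>\<bar> \<le> 2 * C" for z
    using C[of "snd z - fst z *\<^sub>R h"] C[of "snd z"] by simp
qed measurable

lemma integral_UW_snd:
  fixes f :: "'a \<Rightarrow> real"
  assumes [measurable]: "f \<in> borel_measurable borel" and C: "\<And>x. \<bar>f x\<bar> \<le> C"
  shows "(LINT z|(unit_interval \<Otimes>\<^sub>M W). f (snd z)) = (LINT x|W. f x)"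
proof -
  have "integrable (unit_interval \<Otimes>\<^sub>M W) (\<lambda>(t, x). f x)"
    using C by (intro integrable_UW[of _ C]) (auto simp: case_prod_unfold)
  from UW.integral_snd[OF this] show ?thesis by (simp add: case_prod_unfold)
qed

lemma mean_shift_tendsto:
  assumes [measurable]: "\<And>n. f n \<in> borel_measurable borel" and C: "\<And>n x. \<bar>f n x\<bar> \<le> C"
    and lim: "\<And>t x. (\<lambda>n. f n (x - t *\<^sub>R z n) - f n x) \<longlonglongrightarrow> 0"
  shows "(\<lambda>n. mean_shift (f n) (z n)) \<longlonglongrightarrow> 0"
proof -
  have "(\<lambda>n. mean_shift (f n) (z n)) \<longlonglongrightarrow> (LINT p|(unit_interval \<Otimes>\<^sub>M W). (0::real))"
    unfolding mean_shift_def
  proof (rule integral_dominated_convergence[where w = "\<lambda>_. 2 * C"])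
    show "AE p in unit_interval \<Otimes>\<^sub>M W. (\<lambda>n. \<bar>f n (snd p - fst p *\<^sub>R z n) - f n (snd p)\<bar>) \<longlonglongrightarrow> 0"
      by (intro AE_I2 tendsto_rabs_zero lim)
    show "AE p in unit_interval \<Otimes>\<^sub>M W. norm \<bar>f n (snd p - fst p *\<^sub>R z n) - f n (snd p)\<bar> \<le> 2 * C" for n
    proof (rule AE_I2)
      fix p :: "real \<times> 'a"
      show "norm \<bar>f n (snd p - fst p *\<^sub>R z n) - f n (snd p)\<bar> \<le> 2 * C"
        using C[of n "snd p - fst p *\<^sub>R z n"] C[of n "snd p"] by simp
    qed
  qed (auto intro: UWfin.integrable_const)
  then show ?thesis by simp
qed

text \<open>
  After a translation, the \<open>g\<close>-part of the increment is the average over \<open>t\<close> of \<open>\<integral> \<psi>(x) g(x + t h) \<cdot> h dx\<close>. Subtracting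
  \<open>g(x) \<cdot> h\<close> leaves differences of translates of \<open>g\<close>.
\<close>

lemma integral_remainder_approx:
  assumes \<psi>[measurable]: "\<psi> \<in> borel_measurable borel" and C: "\<And>x. \<bar>\<psi> x\<bar> \<le> C"
  shows "\<bar>(LINT x|lborel. \<psi> x * remainder h x) -
      (LINT z|(unit_interval \<Otimes>\<^sub>M W). \<psi> (snd z - fst z *\<^sub>R h) * (s (snd z) \<bullet> h))\<bar>
    \<le> C * norm h * mean_modulus h"
proof -
  have bb: "bounded_borel \<psi>" using C by (intro bounded_borelI) auto
  have "0 \<le> C" using order_trans[OF abs_ge_zero C] .
  have i: "integrable lborel (\<lambda>x. \<psi> x * f x)" if "integrable lborel f" for f
    using integrable_bounded_borel_mult[OF bb that, of "\<lambda>x. x"] by simp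
  note ti = time_integrals[OF bb, of h]
  have ig: "integrable lborel (\<lambda>x. \<psi> x * (g (x + z) \<bullet> h))" for z
    by (intro i integrable_inner_left integrable_translates)
  have ig0: "integrable lborel (\<lambda>x. \<psi> x * (g x \<bullet> h))"
    by (intro i integrable_inner_left g)
  have iu: "integrable lborel (\<lambda>x. \<psi> x * (u (x + h) - u x))"
    by (intro i Bochner_Integration.integrable_diff integrable_translates u)
  let ?G = "\<lambda>t. LINT x|lborel. \<psi> (x - t *\<^sub>R h) * (g x \<bullet> h)"
  let ?H = "LINT x|lborel. \<psi> x * (g x \<bullet> h)"
  have "(LINT x|lborel. \<psi> x * remainder h x) = (LINT x|lborel. \<psi> x * (u (x + h) - u x)) - ?H"
    unfolding remainder_def right_diff_distrib[of _ "_ - _"]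
    by (intro Bochner_Integration.integral_diff iu ig0)
  then have "(LINT x|lborel. \<psi> x * remainder h x) -
      (LINT z|(unit_interval \<Otimes>\<^sub>M W). \<psi> (snd z - fst z *\<^sub>R h) * (s (snd z) \<bullet> h)) = (LINT t|unit_interval. ?G t) - ?H"
    unfolding increment_bounded_borel[OF bb] ti(4) by simp
  also have "\<dots> = (LINT t|unit_interval. ?G t - ?H)"
    using ti(1) by simp
  finally have eq: "(LINT x|lborel. \<psi> x * remainder h x) -
      (LINT z|(unit_interval \<Otimes>\<^sub>M W). \<psi> (snd z - fst z *\<^sub>R h) * (s (snd z) \<bullet> h)) = (LINT t|unit_interval. ?G t - ?H)" .
  have bound: "\<bar>?G t - ?H\<bar> \<le> C * norm h * modulus (t *\<^sub>R h)" for t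
  proof -
    have "?G t = (LINT x|lborel. \<psi> x * (g (x + t *\<^sub>R h) \<bullet> h))"
      using lborel_integral_translate[of "\<lambda>x. \<psi> (x - t *\<^sub>R h) * (g x \<bullet> h)" "t *\<^sub>R h"] by simp
    then have "?G t - ?H = (LINT x|lborel. \<psi> x * (g (x + t *\<^sub>R h) \<bullet> h) - \<psi> x * (g x \<bullet> h))"
      using ig ig0 by simp
    also have "\<bar>\<dots>\<bar> \<le> (LINT x|lborel. \<bar>\<psi> x * (g (x + t *\<^sub>R h) \<bullet> h) - \<psi> x * (g x \<bullet> h)\<bar>)"
      by (rule integral_abs_bound)
    also have "\<dots> \<le> (LINT x|lborel. C * norm h * norm (g (x + t *\<^sub>R h) - g x))"
    proof (rule integral_mono)
      fix x
      have "\<bar>\<psi> x * (g (x + t *\<^sub>R h) \<bullet> h) - \<psi> x * (g x \<bullet> h)\<bar> = \<bar>\<psi> x\<bar> * \<bar>(g (x + t *\<^sub>R h) - g x) \<bullet> h\<bar>"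
        by (simp add: inner_diff_left abs_mult[symmetric] right_diff_distrib)
      also have "\<dots> \<le> C * (norm (g (x + t *\<^sub>R h) - g x) * norm h)"
        using \<open>0 \<le> C\<close> by (intro mult_mono C Cauchy_Schwarz_ineq2) auto
      finally show "\<bar>\<psi> x * (g (x + t *\<^sub>R h) \<bullet> h) - \<psi> x * (g x \<bullet> h)\<bar> \<le> C * norm h * norm (g (x + t *\<^sub>R h) - g x)"
        by (simp add: mult_ac)
    qed (use ig ig0 integrable_translates g in auto)
    finally show ?thesis by (simp add: modulus_def)
  qed
  have "\<bar>LINT t|unit_interval. ?G t - ?H\<bar> \<le> (LINT t|unit_interval. \<bar>?G t - ?H\<bar>)"
    by (rule integral_abs_bound)
  also have "\<dots> \<le> (LINT t|unit_interval. C * norm h * modulus (t *\<^sub>R h))"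
    using bound integrable_modulus ti(1) by (intro integral_mono) auto
  finally show ?thesis
    unfolding eq by (simp add: mean_modulus_def)
qed

definition quotient_mean :: "('a \<Rightarrow> real) \<Rightarrow> 'a \<Rightarrow> real" where
  "quotient_mean f h = (LINT x|lborel. \<bar>remainder h x\<bar> / norm h * f x)"

definition singular_mean :: "('a \<Rightarrow> real) \<Rightarrow> 'a \<Rightarrow> real" where
  "singular_mean f h = (LINT x|W. \<bar>s x \<bullet> h\<bar> / norm h * f x)"

lemma abs_s_inner_le: "\<bar>s x \<bullet> h\<bar> \<le> norm h"
  using order_trans[OF Cauchy_Schwarz_ineq2 mult_right_mono[OF s_le norm_ge_zero]] by simp

text \<open>
  The test function is \<open>f\<close> times the sign of the remainder; \<open>f(y - t h)\<close> is then compared with \<open>f(y)\<close>.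
\<close>

lemma quotient_mean_le:
  assumes [measurable]: "f \<in> borel_measurable borel" and f: "\<And>x. 0 \<le> f x" "\<And>x. f x \<le> C" and h: "h \<noteq> 0"
  shows "quotient_mean f h \<le> singular_mean f h + C * mean_modulus h + mean_shift f h"
proof -
  have C: "0 \<le> C" using f order_trans by blast
  have fC: "\<bar>f x\<bar> \<le> C" for x using f[of x] by simp
  have [measurable]: "remainder h \<in> borel_measurable borel" using integrable_remainder by auto
  define \<psi> where "\<psi> x = f x * sgn (remainder h x)" for x
  have [measurable]: "\<psi> \<in> borel_measurable borel" unfolding \<psi>_def by measurable
  have \<psi>_le: "\<bar>\<psi> x\<bar> \<le> f x" for x
    using f(1)[of x] by (simp add: \<psi>_def abs_mult abs_sgn_eq)
  have \<psi>C: "\<bar>\<psi> x\<bar> \<le> C" for x using \<psi>_le f(2) by (rule order_trans)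
  let ?P = "unit_interval \<Otimes>\<^sub>M W"
  have int_sf: "integrable ?P (\<lambda>z. \<bar>s (snd z) \<bullet> h\<bar> * f (snd z))"
    by (rule integrable_UW[of _ "norm h * C"]) (auto simp: abs_mult intro!: mult_mono fC abs_s_inner_le)
  have int_shift: "integrable ?P (\<lambda>z. \<bar>f (snd z - fst z *\<^sub>R h) - f (snd z)\<bar>)"
    using fC by (intro integrable_shift) auto
  have "norm h * quotient_mean f h = (LINT x|lborel. norm h * (\<bar>remainder h x\<bar> / norm h * f x))"
    by (simp add: quotient_mean_def)
  also have "\<dots> = (LINT x|lborel. \<psi> x * remainder h x)"
    using h by (intro Bochner_Integration.integral_cong) (auto simp: \<psi>_def abs_sgn mult_ac)
  also have "\<dots> \<le> (LINT z|?P. \<psi> (snd z - fst z *\<^sub>R h) * (s (snd z) \<bullet> h)) + C * norm h * mean_modulus h"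
    using integral_remainder_approx[of \<psi> C h] \<psi>C by simp
  also have "(LINT z|?P. \<psi> (snd z - fst z *\<^sub>R h) * (s (snd z) \<bullet> h)) \<le>
      (LINT z|?P. \<bar>s (snd z) \<bullet> h\<bar> * f (snd z) + norm h * \<bar>f (snd z - fst z *\<^sub>R h) - f (snd z)\<bar>)"
  proof (rule integral_mono)
    fix z :: "real \<times> 'a"
    let ?y = "snd z - fst z *\<^sub>R h"
    have "\<psi> ?y * (s (snd z) \<bullet> h) \<le> \<bar>\<psi> ?y\<bar> * \<bar>s (snd z) \<bullet> h\<bar>"
      by (metis abs_ge_self abs_mult)
    also have "\<dots> \<le> f ?y * \<bar>s (snd z) \<bullet> h\<bar>"
      by (intro mult_right_mono \<psi>_le) simp
    also have "\<dots> = f (snd z) * \<bar>s (snd z) \<bullet> h\<bar> + (f ?y - f (snd z)) * \<bar>s (snd z) \<bullet> h\<bar>"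
      by (simp add: algebra_simps)
    also have "(f ?y - f (snd z)) * \<bar>s (snd z) \<bullet> h\<bar> \<le> \<bar>f ?y - f (snd z)\<bar> * norm h"
      by (intro mult_mono abs_s_inner_le) auto
    finally show "\<psi> ?y * (s (snd z) \<bullet> h) \<le> \<bar>s (snd z) \<bullet> h\<bar> * f (snd z) + norm h * \<bar>f ?y - f (snd z)\<bar>"
      by (simp add: mult.commute)
  next
    show "integrable ?P (\<lambda>z. \<psi> (snd z - fst z *\<^sub>R h) * (s (snd z) \<bullet> h))"
      by (rule integrable_UW[of _ "C * norm h"]) (auto simp: abs_mult intro!: mult_mono \<psi>C abs_s_inner_le C)
    show "integrable ?P (\<lambda>z. \<bar>s (snd z) \<bullet> h\<bar> * f (snd z) + norm h * \<bar>f (snd z - fst z *\<^sub>R h) - f (snd z)\<bar>)"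
      using int_sf int_shift by (intro Bochner_Integration.integrable_add integrable_mult_right)
  qed
  also have "\<dots> = (LINT z|?P. \<bar>s (snd z) \<bullet> h\<bar> * f (snd z)) + norm h * mean_shift f h"
    using int_sf int_shift by (simp add: mean_shift_def)
  also have "(LINT z|?P. \<bar>s (snd z) \<bullet> h\<bar> * f (snd z)) = (LINT x|W. \<bar>s x \<bullet> h\<bar> * f x)"
    by (rule integral_UW_snd[of "\<lambda>x. \<bar>s x \<bullet> h\<bar> * f x" "norm h * C"])
      (auto simp: abs_mult intro!: mult_mono fC abs_s_inner_le)
  also have "\<dots> = norm h * singular_mean f h"
    using h unfolding singular_mean_def
    by (subst integral_mult_right_zero[symmetric]) (auto intro!: Bochner_Integration.integral_cong)
  finally have "norm h * quotient_mean f h \<le> norm h * (singular_mean f h + C * mean_modulus h + mean_shift f h)"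
    by (simp add: algebra_simps)
  then show ?thesis using h by simp
qed

text \<open>
  A Lipschitz substitute for the sign function: \<open>clamp1 (a / \<kappa>)\<close> is the sign of \<open>a\<close> unless \<open>|a| < \<kappa>\<close>.
\<close>

definition clamp1 :: "real \<Rightarrow> real" where "clamp1 t = max (- 1) (min 1 t)"

lemma abs_clamp1_le: "\<bar>clamp1 t\<bar> \<le> 1" by (auto simp: clamp1_def)

lemma clamp1_lipschitz: "\<bar>clamp1 a - clamp1 b\<bar> \<le> \<bar>a - b\<bar>" by (auto simp: clamp1_def max_def min_def)

lemma clamp1_mult_ge:
  assumes "\<kappa> > 0"
  shows "\<bar>a\<bar> - \<kappa> \<le> clamp1 (a / \<kappa>) * a"
proof (cases "\<bar>a\<bar> \<le> \<kappa>")
  case True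
  then have "clamp1 (a / \<kappa>) = a / \<kappa>"
    using assms by (auto simp: clamp1_def max_def min_def field_simps abs_le_iff)
  moreover have "0 \<le> a / \<kappa> * a" using assms by (simp add: zero_le_divide_iff)
  ultimately show ?thesis using True by (simp only:)
next
  case False
  then have "clamp1 (a / \<kappa>) = sgn a"
    using assms by (auto simp: clamp1_def max_def min_def field_simps sgn_if abs_if split: if_splits)
  then show ?thesis using assms by (simp add: sgn_mult_self_eq mult.commute[of "sgn a"] abs_sgn[symmetric])
qed

text \<open>
  The test function \<open>\<psi>\<close> is a regularised sign of \<open>s \<cdot> h\<close>, formed with an approximation \<open>c\<close> of \<open>s\<close>. The clamp costs
  \<open>\<kappa>\<close>, and \<open>|s - c|\<close> is paid twice: for replacing \<open>s\<close> by \<open>c\<close> in \<open>\<psi>(s \<cdot> h)\<close> and for returning from \<open>|c \<cdot> h|\<close> to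
  \<open>|s \<cdot> h|\<close>.
\<close>

lemma quotient_mean_ge:
  assumes [measurable]: "c \<in> borel_measurable borel" and c: "integrable W c" and h: "h \<noteq> 0" and \<kappa>: "\<kappa> > 0"
  defines "\<psi> \<equiv> \<lambda>x. clamp1 ((c x \<bullet> h) / norm h / \<kappa>)"
  shows "singular_mean (\<lambda>_. 1) h - \<kappa> * measure W UNIV - 2 * (LINT x|W. norm (s x - c x))
      - mean_modulus h - mean_shift \<psi> h \<le> quotient_mean (\<lambda>_. 1) h"
proof -
  have [measurable]: "clamp1 \<in> borel_measurable borel" unfolding clamp1_def by measurable
  have [measurable]: "\<psi> \<in> borel_measurable borel" unfolding \<psi>_def by measurable
  have \<psi>1: "\<bar>\<psi> x\<bar> \<le> 1" for x by (simp add: \<psi>_def abs_clamp1_le)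
  have [measurable]: "remainder h \<in> borel_measurable borel" using integrable_remainder by auto
  let ?P = "unit_interval \<Otimes>\<^sub>M W"
  have \<psi>s_le: "\<bar>\<psi> y * (s x \<bullet> h)\<bar> \<le> norm h" for x y
    using mult_mono[OF \<psi>1[of y] abs_s_inner_le[of x h]] by (simp add: abs_mult)
  have pointwise: "norm h * (\<bar>s x \<bullet> h\<bar> / norm h - \<kappa> - 2 * norm (s x - c x)) \<le> \<psi> x * (s x \<bullet> h)" for x
  proof -
    let ?w = "h /\<^sub>R norm h"
    have w: "norm ?w = 1" using h by simp
    have sc: "\<bar>(s x - c x) \<bullet> ?w\<bar> \<le> norm (s x - c x)"
      using Cauchy_Schwarz_ineq2[of "s x - c x" ?w] w by simp
    have "\<psi> x = clamp1 ((c x \<bullet> ?w) / \<kappa>)" by (simp add: \<psi>_def divide_inverse mult_ac)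
    then have "\<bar>c x \<bullet> ?w\<bar> - \<kappa> \<le> \<psi> x * (c x \<bullet> ?w)" using clamp1_mult_ge[OF \<kappa>] by simp
    moreover have "\<bar>\<psi> x * ((s x - c x) \<bullet> ?w)\<bar> \<le> norm (s x - c x)"
      using mult_mono[OF \<psi>1[of x] sc] by (simp add: abs_mult)
    moreover have "s x \<bullet> ?w = c x \<bullet> ?w + (s x - c x) \<bullet> ?w"
      by (simp only: inner_add_left[symmetric]) simp
    ultimately have "\<bar>s x \<bullet> ?w\<bar> - \<kappa> - 2 * norm (s x - c x) \<le> \<psi> x * (s x \<bullet> ?w)"
      using sc by (simp only: distrib_left)
    then have "norm h * (\<bar>s x \<bullet> ?w\<bar> - \<kappa> - 2 * norm (s x - c x)) \<le> norm h * (\<psi> x * (s x \<bullet> ?w))"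
      by (rule mult_left_mono) simp
    moreover have "norm h * (\<psi> x * (s x \<bullet> ?w)) = \<psi> x * (s x \<bullet> h)" "\<bar>s x \<bullet> ?w\<bar> = \<bar>s x \<bullet> h\<bar> / norm h"
      using h by (simp_all add: abs_mult divide_inverse mult_ac)
    ultimately show ?thesis by (simp only:)
  qed
  have int_abs: "integrable W (\<lambda>x. \<bar>s x \<bullet> h\<bar> / norm h)"
    by (intro integrable_divide integrable_abs integrable_inner_left) (simp add: integrable_s)
  have int_sc: "integrable W (\<lambda>x. norm (s x - c x))" using integrable_s c by simp
  have int_\<psi>s: "integrable W (\<lambda>x. \<psi> x * (s x \<bullet> h))"
    by (rule W.integrable_const_bound[of _ "norm h"]) (auto simp: \<psi>s_le)
  have int_\<psi>s': "integrable ?P (\<lambda>z. \<psi> (snd z - fst z *\<^sub>R h) * (s (snd z) \<bullet> h))"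
    by (rule integrable_UW[of _ "norm h"]) (auto simp: \<psi>s_le)
  have int_shift: "integrable ?P (\<lambda>z. \<bar>\<psi> (snd z - fst z *\<^sub>R h) - \<psi> (snd z)\<bar>)"
    using \<psi>1 by (intro integrable_shift) auto
  have "norm h * (singular_mean (\<lambda>_. 1) h - \<kappa> * measure W UNIV - 2 * (LINT x|W. norm (s x - c x))) =
      (LINT x|W. norm h * (\<bar>s x \<bullet> h\<bar> / norm h - \<kappa> - 2 * norm (s x - c x)))"
    using int_abs int_sc by (simp add: singular_mean_def mult.commute)
  also have "\<dots> \<le> (LINT x|W. \<psi> x * (s x \<bullet> h))"
    using int_abs int_sc int_\<psi>s pointwise by (intro integral_mono) auto
  also have "\<dots> = (LINT z|?P. \<psi> (snd z) * (s (snd z) \<bullet> h))"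
    by (rule integral_UW_snd[of "\<lambda>x. \<psi> x * (s x \<bullet> h)" "norm h", symmetric]) (auto simp: \<psi>s_le)
  also have "\<dots> \<le> (LINT z|?P. \<psi> (snd z - fst z *\<^sub>R h) * (s (snd z) \<bullet> h) + norm h * \<bar>\<psi> (snd z - fst z *\<^sub>R h) - \<psi> (snd z)\<bar>)"
  proof (rule integral_mono)
    show "integrable ?P (\<lambda>z. \<psi> (snd z) * (s (snd z) \<bullet> h))"
      by (rule integrable_UW[of _ "norm h"]) (auto simp: \<psi>s_le)
    show "integrable ?P (\<lambda>z. \<psi> (snd z - fst z *\<^sub>R h) * (s (snd z) \<bullet> h) + norm h * \<bar>\<psi> (snd z - fst z *\<^sub>R h) - \<psi> (snd z)\<bar>)"
      using int_\<psi>s' int_shift by (intro Bochner_Integration.integrable_add integrable_mult_right)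
    fix z :: "real \<times> 'a"
    let ?y = "snd z - fst z *\<^sub>R h"
    have "(\<psi> (snd z) - \<psi> ?y) * (s (snd z) \<bullet> h) \<le> \<bar>\<psi> (snd z) - \<psi> ?y\<bar> * \<bar>s (snd z) \<bullet> h\<bar>"
      by (metis abs_ge_self abs_mult)
    also have "\<dots> \<le> \<bar>\<psi> (snd z) - \<psi> ?y\<bar> * norm h"
      by (intro mult_left_mono abs_s_inner_le) simp
    finally show "\<psi> (snd z) * (s (snd z) \<bullet> h) \<le> \<psi> ?y * (s (snd z) \<bullet> h) + norm h * \<bar>\<psi> ?y - \<psi> (snd z)\<bar>"
      by (simp add: left_diff_distrib mult.commute[of _ "norm h"] abs_minus_commute)
  qed
  also have "\<dots> = (LINT z|?P. \<psi> (snd z - fst z *\<^sub>R h) * (s (snd z) \<bullet> h)) + norm h * mean_shift \<psi> h"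
    using int_\<psi>s' int_shift by (simp add: mean_shift_def)
  also have "(LINT z|?P. \<psi> (snd z - fst z *\<^sub>R h) * (s (snd z) \<bullet> h)) \<le> (LINT x|lborel. \<psi> x * remainder h x) + norm h * mean_modulus h"
    using integral_remainder_approx[of \<psi> 1 h] \<psi>1 by simp
  also have "(LINT x|lborel. \<psi> x * remainder h x) \<le> (LINT x|lborel. \<bar>remainder h x\<bar>)"
  proof (rule integral_mono)
    have "bounded_borel \<psi>" using \<psi>1 by (intro bounded_borelI) auto
    from integrable_bounded_borel_mult[OF this integrable_remainder, of "\<lambda>x. x" h]
    show "integrable lborel (\<lambda>x. \<psi> x * remainder h x)" by simp
    show "\<psi> x * remainder h x \<le> \<bar>remainder h x\<bar>" for x
      using mult_right_mono[OF \<psi>1[of x], of "\<bar>remainder h x\<bar>"] by (simp add: abs_mult[symmetric])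
  qed (simp add: integrable_remainder)
  also have "\<dots> = norm h * quotient_mean (\<lambda>_. 1) h"
    using h by (simp add: quotient_mean_def)
  finally have "norm h * (singular_mean (\<lambda>_. 1) h - \<kappa> * measure W UNIV - 2 * (LINT x|W. norm (s x - c x))
      - mean_modulus h - mean_shift \<psi> h) \<le> norm h * quotient_mean (\<lambda>_. 1) h"
    by (simp add: algebra_simps)
  then show ?thesis using h by simp
qed

lemma integrable_quotient:
  assumes "bounded_borel f"
  shows "integrable lborel (\<lambda>x. \<bar>remainder h x\<bar> / norm h * f x)"
  using integrable_bounded_borel_mult[OF assms, of lborel "\<lambda>x. \<bar>remainder h x\<bar> / norm h" "\<lambda>x. x"] integrable_remainder
  by (simp add: mult.commute)

lemma integrable_singular:
  assumes "bounded_borel f"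
  shows "integrable W (\<lambda>x. \<bar>s x \<bullet> h\<bar> / norm h * f x)"
  using integrable_bounded_borel_mult[OF assms, of W "\<lambda>x. \<bar>s x \<bullet> h\<bar> / norm h" "\<lambda>x. x"] integrable_s
  by (simp add: mult.commute)

lemma bounded_borel_const: "bounded_borel (\<lambda>x. c)"
  by (rule bounded_borelI[of _ "\<bar>c\<bar>"]) auto

lemma
  assumes f: "bounded_borel f"
  shows quotient_mean_affine: "quotient_mean (\<lambda>x. a + b * f x) h = a * quotient_mean (\<lambda>_. 1) h + b * quotient_mean f h"
    and singular_mean_affine: "singular_mean (\<lambda>x. a + b * f x) h = a * singular_mean (\<lambda>_. 1) h + b * singular_mean f h"
proof -
  have "quotient_mean (\<lambda>x. a + b * f x) h =
      (LINT x|lborel. a * (\<bar>remainder h x\<bar> / norm h * 1) + b * (\<bar>remainder h x\<bar> / norm h * f x))"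
    unfolding quotient_mean_def
    by (intro Bochner_Integration.integral_cong refl) (simp add: algebra_simps add_divide_distrib)
  then show "quotient_mean (\<lambda>x. a + b * f x) h = a * quotient_mean (\<lambda>_. 1) h + b * quotient_mean f h"
    unfolding quotient_mean_def
    by (simp only: integral_mult_right_zero Bochner_Integration.integral_add[OF
          integrable_mult_right[OF integrable_quotient[OF bounded_borel_const]]
          integrable_mult_right[OF integrable_quotient[OF f]]])
  have "singular_mean (\<lambda>x. a + b * f x) h =
      (LINT x|W. a * (\<bar>s x \<bullet> h\<bar> / norm h * 1) + b * (\<bar>s x \<bullet> h\<bar> / norm h * f x))"
    unfolding singular_mean_def
    by (intro Bochner_Integration.integral_cong refl) (simp add: algebra_simps add_divide_distrib)
  then show "singular_mean (\<lambda>x. a + b * f x) h = a * singular_mean (\<lambda>_. 1) h + b * singular_mean f h"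
    unfolding singular_mean_def
    by (simp only: integral_mult_right_zero Bochner_Integration.integral_add[OF
          integrable_mult_right[OF integrable_singular[OF bounded_borel_const]]
          integrable_mult_right[OF integrable_singular[OF f]]])
qed

lemma mean_shift_continuous_tendsto:
  assumes "continuous_on UNIV f" "\<And>x. \<bar>f x\<bar> \<le> C" "z \<longlonglongrightarrow> 0"
  shows "(\<lambda>n. mean_shift f (z n)) \<longlonglongrightarrow> 0"
proof (rule mean_shift_tendsto[of "\<lambda>_. f", OF borel_measurable_continuous_onI[OF assms(1)] assms(2)])
  fix t x
  have "(\<lambda>n. x - t *\<^sub>R z n) \<longlonglongrightarrow> x - t *\<^sub>R 0" by (intro tendsto_intros assms)
  then have "(\<lambda>n. f (x - t *\<^sub>R z n)) \<longlonglongrightarrow> f x"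
    using assms(1) by (auto intro: continuous_on_tendsto_compose)
  then show "(\<lambda>n. f (x - t *\<^sub>R z n) - f x) \<longlonglongrightarrow> 0" by (rule LIM_zero)
qed

text \<open>
  For the lower bound, \<open>s\<close> is approximated in \<open>L\<^sup>1(W)\<close> by a continuous \<open>c\<close>. The direction \<open>z n / |z n|\<close> need not
  converge, but the clamp is Lipschitz uniformly in the direction, so continuity of \<open>c\<close> makes the shift
  error vanish.
\<close>

lemma quotient_minus_singular_1_tendsto:
  assumes z: "z \<longlonglongrightarrow> 0" "\<And>n. z n \<noteq> 0"
  shows "(\<lambda>n. quotient_mean (\<lambda>_. 1) (z n) - singular_mean (\<lambda>_. 1) (z n)) \<longlonglongrightarrow> 0"
proof (rule tendstoI)
  let ?\<Delta> = "\<lambda>n. quotient_mean (\<lambda>_. 1) (z n) - singular_mean (\<lambda>_. 1) (z n)"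
  fix e :: real assume e: "e > 0"
  have up: "?\<Delta> n \<le> mean_modulus (z n) + mean_shift (\<lambda>_. 1) (z n)" for n
    using quotient_mean_le[of "\<lambda>_. 1" 1 "z n"] z(2) by simp
  have "(\<lambda>n. mean_modulus (z n) + mean_shift (\<lambda>_. 1) (z n)) \<longlonglongrightarrow> 0 + 0"
    by (intro tendsto_add mean_modulus_tendsto mean_shift_continuous_tendsto[of _ 1] z) auto
  then have ev_up: "\<forall>\<^sub>F n in sequentially. mean_modulus (z n) + mean_shift (\<lambda>_. 1) (z n) < e"
    by (rule order_tendstoD) (use e in simp)
  have "L1_approximable W s"
    using integrable_s W.emeasure_finite by (intro integrable_L1_approximable) (simp_all add: less_top[symmetric])
  then obtain c r where c: "continuous_on UNIV c" "\<And>x. r \<le> norm x \<Longrightarrow> c x = 0"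
    "integrable W c" "(LINT x|W. norm (s x - c x)) < e / 8"
    by (rule L1_approximableD[of _ _ "e / 8"]) (use e in auto)
  have [measurable]: "c \<in> borel_measurable borel" by (rule borel_measurable_continuous_onI[OF c(1)])
  \<comment> \<open>Adding \<open>1\<close> avoids division by \<open>0\<close> when \<open>W\<close> vanishes.\<close>
  define m where "m = measure W UNIV + 1"
  have m: "m > 0" unfolding m_def using measure_nonneg[of W UNIV] by linarith
  define \<kappa> where "\<kappa> = e / (4 * m)"
  have \<kappa>: "\<kappa> > 0" using e m by (simp add: \<kappa>_def)
  have "\<kappa> * measure W UNIV \<le> \<kappa> * m" using \<kappa> by (simp add: m_def)
  also have "\<dots> = e / 4"
    using m by (simp add: \<kappa>_def)
  finally have \<kappa>W: "\<kappa> * measure W UNIV \<le> e / 4" .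
  define \<psi> where "\<psi> n x = clamp1 ((c x \<bullet> z n) / norm (z n) / \<kappa>)" for n x
  have [measurable]: "clamp1 \<in> borel_measurable borel" unfolding clamp1_def by measurable
  have low: "singular_mean (\<lambda>_. 1) (z n) - \<kappa> * measure W UNIV - 2 * (LINT x|W. norm (s x - c x))
      - mean_modulus (z n) - mean_shift (\<psi> n) (z n) \<le> quotient_mean (\<lambda>_. 1) (z n)" for n
    unfolding \<psi>_def by (rule quotient_mean_ge) (use c z \<kappa> in auto)
  have "(\<lambda>n. mean_shift (\<psi> n) (z n)) \<longlonglongrightarrow> 0"
  proof (rule mean_shift_tendsto[of _ 1])
    show "\<psi> n \<in> borel_measurable borel" for n unfolding \<psi>_def by measurable
    show "\<bar>\<psi> n x\<bar> \<le> 1" for n x by (simp add: \<psi>_def abs_clamp1_le)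
    fix t x
    have "(\<lambda>n. x - t *\<^sub>R z n) \<longlonglongrightarrow> x - t *\<^sub>R 0" by (intro tendsto_intros z)
    then have "(\<lambda>n. c (x - t *\<^sub>R z n)) \<longlonglongrightarrow> c x"
      using c(1) by (auto intro: continuous_on_tendsto_compose)
    then have "(\<lambda>n. norm (c (x - t *\<^sub>R z n) - c x) / \<kappa>) \<longlonglongrightarrow> norm (c x - c x) / \<kappa>"
      using \<kappa> by (intro tendsto_intros) auto
    then have "(\<lambda>n. norm (c (x - t *\<^sub>R z n) - c x) / \<kappa>) \<longlonglongrightarrow> 0" by simp
    then show "(\<lambda>n. \<psi> n (x - t *\<^sub>R z n) - \<psi> n x) \<longlonglongrightarrow> 0"
    proof (rule Lim_null_comparison[rotated], intro always_eventually allI)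
      fix n
      have "\<bar>\<psi> n (x - t *\<^sub>R z n) - \<psi> n x\<bar> \<le>
          \<bar>(c (x - t *\<^sub>R z n) \<bullet> z n) / norm (z n) / \<kappa> - (c x \<bullet> z n) / norm (z n) / \<kappa>\<bar>"
        unfolding \<psi>_def by (rule clamp1_lipschitz)
      also have "\<dots> = \<bar>(c (x - t *\<^sub>R z n) - c x) \<bullet> z n\<bar> / norm (z n) / \<kappa>"
        using \<kappa> by (simp add: inner_diff_left diff_divide_distrib[symmetric] abs_divide)
      also have "\<dots> \<le> norm (c (x - t *\<^sub>R z n) - c x) * norm (z n) / norm (z n) / \<kappa>"
        using \<kappa> by (intro divide_right_mono Cauchy_Schwarz_ineq2) auto
      also have "\<dots> = norm (c (x - t *\<^sub>R z n) - c x) / \<kappa>" using z(2) by simp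
      finally show "norm (\<psi> n (x - t *\<^sub>R z n) - \<psi> n x) \<le> norm (c (x - t *\<^sub>R z n) - c x) / \<kappa>" by simp
    qed
  qed
  then have "(\<lambda>n. mean_modulus (z n) + mean_shift (\<psi> n) (z n)) \<longlonglongrightarrow> 0 + 0"
    by (intro tendsto_add mean_modulus_tendsto z)
  then have ev_low: "\<forall>\<^sub>F n in sequentially. mean_modulus (z n) + mean_shift (\<psi> n) (z n) < e / 4"
    by (rule order_tendstoD) (use e in simp)
  from ev_up ev_low show "\<forall>\<^sub>F n in sequentially. dist (?\<Delta> n) 0 < e"
  proof eventually_elim
    case (elim n)
    then show ?case
      using up[of n] low[of n] c(4) \<kappa>W e by (simp add: dist_real_def abs_less_iff)
  qed
qed

text \<open>
  The upper bounds for the nonnegative functions \<open>C + f\<close> and \<open>C - f\<close> bound the difference for \<open>f\<close> from both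
  sides, once it is known to vanish in the limit for the constant \<open>1\<close>.
\<close>

lemma quotient_minus_singular_tendsto_seq:
  assumes f: "continuous_on UNIV f" "\<And>x. \<bar>f x\<bar> \<le> C" and z: "z \<longlonglongrightarrow> 0" "\<And>n. z n \<noteq> 0"
  shows "(\<lambda>n. quotient_mean f (z n) - singular_mean f (z n)) \<longlonglongrightarrow> 0"
proof -
  define \<Delta> where "\<Delta> f n = quotient_mean f (z n) - singular_mean f (z n)" for f n
  have fb[measurable]: "f \<in> borel_measurable borel" by (rule borel_measurable_continuous_onI[OF f(1)])
  have bb: "bounded_borel f" using f(2) by (intro bounded_borelI) auto
  have affine: "\<Delta> (\<lambda>x. C + b * f x) n = C * \<Delta> (\<lambda>_. 1) n + b * \<Delta> f n" for b n
    unfolding \<Delta>_def quotient_mean_affine[OF bb] singular_mean_affine[OF bb] by (simp add: algebra_simps)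
  have one: "\<Delta> (\<lambda>_. 1) \<longlonglongrightarrow> 0"
    unfolding \<Delta>_def[abs_def] by (rule quotient_minus_singular_1_tendsto[OF z])
  let ?E = "\<lambda>b n. 2 * C * mean_modulus (z n) + mean_shift (\<lambda>x. C + b * f x) (z n)"
  have up: "\<Delta> (\<lambda>x. C + b * f x) n \<le> ?E b n" and E: "?E b \<longlonglongrightarrow> 0" if b: "\<bar>b\<bar> = 1" for b n
  proof -
    have range: "0 \<le> C + b * f x \<and> C + b * f x \<le> 2 * C" for x
    proof -
      have "\<bar>b * f x\<bar> \<le> C" using f(2)[of x] b by (simp add: abs_mult)
      then show ?thesis by (simp add: abs_le_iff)
    qed
    show "\<Delta> (\<lambda>x. C + b * f x) n \<le> ?E b n"
      using quotient_mean_le[of "\<lambda>x. C + b * f x" "2 * C" "z n"] range z(2) by (simp add: \<Delta>_def)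
    have "(\<lambda>n. mean_shift (\<lambda>x. C + b * f x) (z n)) \<longlonglongrightarrow> 0"
      using range by (intro mean_shift_continuous_tendsto[of _ "2 * C"] z continuous_intros f(1)) (simp add: abs_of_nonneg)
    moreover have "(\<lambda>n. 2 * C * mean_modulus (z n)) \<longlonglongrightarrow> 2 * C * 0"
      by (intro tendsto_intros mean_modulus_tendsto z)
    ultimately have "?E b \<longlonglongrightarrow> 2 * C * 0 + 0" by (intro tendsto_add)
    then show "?E b \<longlonglongrightarrow> 0" by simp
  qed
  have "\<Delta> f \<longlonglongrightarrow> 0"
  proof (rule real_tendsto_sandwich)
    show "\<forall>\<^sub>F n in sequentially. C * \<Delta> (\<lambda>_. 1) n - ?E (-1) n \<le> \<Delta> f n"
    proof (intro always_eventually allI)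
      fix n
      have "\<bar>- 1 :: real\<bar> = 1" by simp
      from up[OF this, of n] show "C * \<Delta> (\<lambda>_. 1) n - ?E (-1) n \<le> \<Delta> f n"
        unfolding affine by linarith
    qed
    show "\<forall>\<^sub>F n in sequentially. \<Delta> f n \<le> ?E 1 n - C * \<Delta> (\<lambda>_. 1) n"
    proof (intro always_eventually allI)
      fix n
      have "\<bar>1 :: real\<bar> = 1" by simp
      from up[OF this, of n] show "\<Delta> f n \<le> ?E 1 n - C * \<Delta> (\<lambda>_. 1) n"
        unfolding affine by linarith
    qed
    have "(\<lambda>n. C * \<Delta> (\<lambda>_. 1) n - ?E (-1) n) \<longlonglongrightarrow> C * 0 - 0"
      by (intro tendsto_diff tendsto_mult tendsto_const one E) simp
    then show "(\<lambda>n. C * \<Delta> (\<lambda>_. 1) n - ?E (-1) n) \<longlonglongrightarrow> 0" by simp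
    have "(\<lambda>n. ?E 1 n - C * \<Delta> (\<lambda>_. 1) n) \<longlonglongrightarrow> 0 - C * 0"
      by (intro tendsto_diff tendsto_mult tendsto_const one E) simp
    then show "(\<lambda>n. ?E 1 n - C * \<Delta> (\<lambda>_. 1) n) \<longlonglongrightarrow> 0" by simp
  qed
  then show ?thesis by (simp add: \<Delta>_def[abs_def])
qed

lemma quotient_minus_singular_tendsto:
  assumes f: "continuous_on UNIV f" "\<And>x. \<bar>f x\<bar> \<le> C"
  shows "((\<lambda>h. quotient_mean f h - singular_mean f h) \<longlongrightarrow> 0) (at 0)"
  unfolding tendsto_at_iff_sequentially comp_def
  using quotient_minus_singular_tendsto_seq[OF f] by auto

lemma quotient_mean_bounded:
  assumes f: "f \<in> borel_measurable borel" "\<And>x. \<bar>f x\<bar> \<le> C"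
  shows "\<bar>quotient_mean f h\<bar> \<le> C * (measure W UNIV + 2 * (LINT x|lborel. norm (g x)))"
proof -
  have C: "0 \<le> C" using order_trans[OF abs_ge_zero f(2)] .
  have bb: "bounded_borel f" using f by (intro bounded_borelI) auto
  have 1: "quotient_mean (\<lambda>_. 1) h \<le> measure W UNIV + 2 * (LINT x|lborel. norm (g x))"
  proof (cases "h = 0")
    case True
    then show ?thesis by (simp add: quotient_mean_def)
  next
    case False
    have "mean_modulus h \<le> (LINT t|unit_interval. 2 * (LINT x|lborel. norm (g x)))"
      unfolding mean_modulus_def
      by (intro integral_mono integrable_modulus modulus_le) auto
    moreover have "singular_mean (\<lambda>_. 1) h \<le> (LINT x|W. 1)"
      unfolding singular_mean_def
      using False abs_s_inner_le integrable_singular[OF bounded_borel_const, of h 1]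
      by (intro integral_mono) auto
    ultimately show ?thesis
      using quotient_mean_le[of "\<lambda>_. 1" 1 h] False by (simp add: mean_shift_def)
  qed
  have "\<bar>quotient_mean f h\<bar> \<le> (LINT x|lborel. \<bar>\<bar>remainder h x\<bar> / norm h * f x\<bar>)"
    unfolding quotient_mean_def by (rule integral_abs_bound)
  also have "\<dots> \<le> (LINT x|lborel. C * (\<bar>remainder h x\<bar> / norm h * 1))"
  proof (rule integral_mono)
    show "integrable lborel (\<lambda>x. \<bar>\<bar>remainder h x\<bar> / norm h * f x\<bar>)"
      by (rule integrable_abs[OF integrable_quotient[OF bb]])
    show "integrable lborel (\<lambda>x. C * (\<bar>remainder h x\<bar> / norm h * 1))"
      by (rule integrable_mult_right[OF integrable_quotient[OF bounded_borel_const]])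
    have "\<bar>\<bar>remainder h x\<bar> / norm h\<bar> * \<bar>f x\<bar> \<le> \<bar>\<bar>remainder h x\<bar> / norm h\<bar> * C" for x
      by (intro mult_left_mono f(2)) simp
    then show "\<bar>\<bar>remainder h x\<bar> / norm h * f x\<bar> \<le> C * (\<bar>remainder h x\<bar> / norm h * 1)" for x
      by (simp add: abs_mult mult.commute[of C])
  qed
  also have "\<dots> = C * quotient_mean (\<lambda>_. 1) h" by (simp add: quotient_mean_def)
  also have "\<dots> \<le> C * (measure W UNIV + 2 * (LINT x|lborel. norm (g x)))"
    using 1 C by (rule mult_left_mono)
  finally show ?thesis .
qed

lemma singular_mean_bounded:
  assumes f: "f \<in> borel_measurable borel" "\<And>x. \<bar>f x\<bar> \<le> C"
  shows "\<bar>singular_mean f h\<bar> \<le> C * measure W UNIV"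
proof -
  have bb: "bounded_borel f" using f by (intro bounded_borelI) auto
  have "\<bar>singular_mean f h\<bar> \<le> (LINT x|W. \<bar>\<bar>s x \<bullet> h\<bar> / norm h * f x\<bar>)"
    unfolding singular_mean_def by (rule integral_abs_bound)
  also have "\<dots> \<le> (LINT x|W. 1 * C)"
  proof (rule integral_mono)
    fix x
    have "\<bar>s x \<bullet> h\<bar> / norm h \<le> 1" using abs_s_inner_le[of x h] by (simp add: divide_le_eq)
    then show "\<bar>\<bar>s x \<bullet> h\<bar> / norm h * f x\<bar> \<le> 1 * C"
      unfolding abs_mult by (intro mult_mono f(2)) auto
    show "integrable W (\<lambda>x. \<bar>\<bar>s x \<bullet> h\<bar> / norm h * f x\<bar>)"
      by (rule integrable_abs[OF integrable_singular[OF bb]])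
  qed simp
  finally show ?thesis by (simp add: mult.commute)
qed

end

section \<open>Hausdorff measure\<close>

text \<open>
  Metric outer measures in the sense of Caratheodory: additive on sets at positive distance.
\<close>

locale metric_outer_measure =
  fixes f :: "'a::metric_space set \<Rightarrow> ennreal"
  assumes empty: "f {} = 0"
    and mono: "\<And>A B. A \<subseteq> B \<Longrightarrow> f A \<le> f B"
    and UN_le: "\<And>A :: nat \<Rightarrow> 'a set. f (\<Union>i. A i) \<le> (\<Sum>i. f (A i))"
    and separated: "\<And>A B d. 0 < d \<Longrightarrow> (\<And>x y. x \<in> A \<Longrightarrow> y \<in> B \<Longrightarrow> d \<le> dist x y) \<Longrightarrow> f A + f B \<le> f (A \<union> B)"
begin

lemma Un_le: "f (A \<union> B) \<le> f A + f B"
proof -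
  let ?S = "\<lambda>i::nat. if i = 0 then A else if i = 1 then B else {}"
  have "A \<union> B = (\<Union>i. ?S i)" by (auto split: if_splits)
  then have "f (A \<union> B) \<le> (\<Sum>i. f (?S i))" using UN_le[of ?S] by simp
  also have "\<dots> = (\<Sum>i\<in>{0, 1}. f (?S i))" by (rule suminf_finite) (auto simp: empty)
  finally show ?thesis by simp
qed

lemma outer_measure_space: "outer_measure_space (Pow UNIV) f"
  unfolding outer_measure_space_def
  by (auto simp: positive_def increasing_def countably_subadditive_def empty mono UN_le)

text \<open>
  Let \<open>D n\<close> be the part of \<open>E\<close> at distance at least \<open>1/(n+1)\<close> from \<open>C\<close>. It is separated from \<open>C\<close>, so it
  suffices that \<open>f (D n)\<close> approaches \<open>f (E - C)\<close>. The layers \<open>R n = D (n+1) - D n\<close> of equal parity are separated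
  from each other, hence the sum of all \<open>f (R n)\<close> is at most \<open>2 f E\<close>, and its tails control \<open>f (E - C) - f (D n)\<close>.
\<close>

lemma closed_in_lambda_system:
  assumes C: "closed C"
  shows "C \<in> lambda_system UNIV (Pow UNIV) f"
proof -
  have "f (C \<inter> E) + f ((UNIV - C) \<inter> E) = f E" for E
  proof (rule antisym)
    have "(C \<inter> E) \<union> ((UNIV - C) \<inter> E) = E" by blast
    then show "f E \<le> f (C \<inter> E) + f ((UNIV - C) \<inter> E)" using Un_le by metis
    show "f (C \<inter> E) + f ((UNIV - C) \<inter> E) \<le> f E"
    proof (cases "C = {} \<or> f E = \<infinity>")
      case True
      then show ?thesis by (auto simp: empty)
    next
      case False
      then have ne: "C \<noteq> {}" and fin: "f E < \<infinity>" by (auto simp: less_top)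
      define D where "D n = {x \<in> E. 1 / real (Suc n) \<le> infdist x C}" for n
      define R where "R n = D (Suc n) - D n" for n
      have D_sub: "D n \<subseteq> E" for n by (auto simp: D_def)
      have D_sep: "f (C \<inter> E) + f (D n) \<le> f E" for n
      proof -
        have "f (C \<inter> E) + f (D n) \<le> f ((C \<inter> E) \<union> D n)"
        proof (rule separated[of "1 / real (Suc n)"])
          fix x y assume "x \<in> C \<inter> E" "y \<in> D n"
          then have "1 / real (Suc n) \<le> infdist y C" "infdist y C \<le> dist y x"
            by (auto simp: D_def intro: infdist_le)
          then show "1 / real (Suc n) \<le> dist x y" by (simp add: dist_commute)
        qed simp
        also have "\<dots> \<le> f E" using D_sub[of n] by (intro mono) auto
        finally show ?thesis .
      qed
      have R_lower: "1 / real (n + 2) \<le> infdist x C" and R_upper: "infdist x C < 1 / real (n + 1)"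
        if "x \<in> R n" for n x
        using that by (auto simp: R_def D_def)
      have alternate: "(\<Sum>k<N. f (R (2 * k + p))) \<le> f (\<Union>k<N. R (2 * k + p))" for N p
      proof (induction N)
        case (Suc N)
        show ?case
        proof (cases "N = 0")
          case False
          \<comment> \<open>Earlier layers have distance at least \<open>1/(2N+p)\<close> from \<open>C\<close>, the new one less than \<open>1/(2N+p+1)\<close>.\<close>
          let ?d = "1 / real (2 * N + p) - 1 / real (2 * N + p + 1)"
          have "(\<Sum>k<Suc N. f (R (2 * k + p))) \<le> f (\<Union>k<N. R (2 * k + p)) + f (R (2 * N + p))"
            using Suc by (simp add: add_right_mono)
          also have "\<dots> \<le> f ((\<Union>k<N. R (2 * k + p)) \<union> R (2 * N + p))"
          proof (rule separated[of ?d])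
            show "0 < ?d" using False by (simp add: frac_less2)
            fix x y assume "x \<in> (\<Union>k<N. R (2 * k + p))" "y \<in> R (2 * N + p)"
            then obtain k where k: "k < N" "x \<in> R (2 * k + p)" by blast
            have "1 / real (2 * N + p) \<le> 1 / real (2 * k + p + 2)"
              using k(1) by (intro divide_left_mono) auto
            also have "\<dots> \<le> infdist x C" using R_lower[OF k(2)] by simp
            finally have "?d \<le> infdist x C - infdist y C"
              using R_upper[OF \<open>y \<in> _\<close>] by simp
            also have "\<dots> \<le> dist x y" using infdist_triangle_abs[of x C y] by simp
            finally show "?d \<le> dist x y" .
          qed
          also have "(\<Union>k<N. R (2 * k + p)) \<union> R (2 * N + p) = (\<Union>k<Suc N. R (2 * k + p))"
            by (auto simp: lessThan_Suc)
          finally show ?thesis .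
        qed (simp add: lessThan_Suc)
      qed simp
      have R_sub: "R n \<subseteq> E" for n using D_sub by (auto simp: R_def)
      have alt_le: "(\<Sum>k<N. f (R (2 * k + p))) \<le> f E" for N p
        using R_sub by (intro order_trans[OF alternate mono]) auto
      have sum_le: "(\<Sum>k<n. f (R k)) \<le> f E + f E" for n
      proof -
        have "(\<Sum>k<n. f (R k)) \<le> (\<Sum>k<2 * n. f (R k))" by (intro sum_mono2) auto
        also have "\<dots> = (\<Sum>k<n. f (R (2 * k + 0))) + (\<Sum>k<n. f (R (2 * k + 1)))"
          by (induction n) (auto simp: algebra_simps)
        also have "\<dots> \<le> f E + f E" by (intro add_mono alt_le)
        finally show ?thesis .
      qed
      have "(\<Sum>k. f (R k)) \<le> f E + f E" by (intro suminf_le_const sum_le) auto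
      also have "\<dots> < \<infinity>" using fin by simp
      finally have S: "(\<Sum>k. f (R k)) < \<infinity>" .
      have Rfin: "f (R k) < \<infinity>" for k using mono[OF R_sub] fin by (rule le_less_trans)
      define r where "r k = enn2real (f (R k))" for k
      have r: "f (R k) = ennreal (r k)" "0 \<le> r k" for k
        using Rfin[of k] by (simp_all add: r_def)
      have "summable r" using S r by (intro summable_suminf_not_top) auto
      show ?thesis
      proof (rule ennreal_le_epsilon)
        fix e :: real assume e: "0 < e"
        obtain n where n: "norm (\<Sum>i. r (i + n)) < e"
          using suminf_exist_split[OF e \<open>summable r\<close>] by blast
        have "(UNIV - C) \<inter> E \<subseteq> D n \<union> (\<Union>k. R (k + n))"
        proof
          fix x assume x: "x \<in> (UNIV - C) \<inter> E"
          then have "0 < infdist x C" using C ne by (intro infdist_pos_not_in_closed) auto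
          then obtain m where "1 / real (Suc m) < infdist x C"
            using reals_Archimedean by (metis inverse_eq_divide)
          then have "x \<in> D m" using x by (auto simp: D_def)
          \<comment> \<open>\<open>x\<close> lies in the layer just before the first \<open>D j\<close> that contains it, unless it is already in \<open>D n\<close>.\<close>
          define j where "j = (LEAST j. x \<in> D j)"
          have j: "x \<in> D j" unfolding j_def using \<open>x \<in> D m\<close> by (rule LeastI)
          show "x \<in> D n \<union> (\<Union>k. R (k + n))"
          proof (cases "j \<le> n")
            case True
            then have "1 / real (Suc n) \<le> 1 / real (Suc j)" by (intro divide_left_mono) auto
            with j have "x \<in> D n" by (auto simp: D_def)
            then show ?thesis ..
          next
            case False
            then obtain i where i: "j = Suc i" "n \<le> i" by (cases j) auto
            have "x \<notin> D i" using not_less_Least[of i "\<lambda>j. x \<in> D j"] i(1) by (simp add: j_def[symmetric])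
            then have "x \<in> R ((i - n) + n)" using j i by (simp add: R_def)
            then show ?thesis by blast
          qed
        qed
        then have "f ((UNIV - C) \<inter> E) \<le> f (D n \<union> (\<Union>k. R (k + n)))" by (rule mono)
        also have "\<dots> \<le> f (D n) + (\<Sum>k. f (R (k + n)))"
          by (rule order_trans[OF Un_le add_left_mono[OF UN_le]])
        also have "(\<Sum>k. f (R (k + n))) = ennreal (\<Sum>k. r (k + n))"
          unfolding r(1) using \<open>summable r\<close> by (intro suminf_ennreal2 r(2)) (simp add: summable_iff_shift)
        also have "\<dots> \<le> ennreal e" using n by (intro ennreal_leI) simp
        finally have "f (C \<inter> E) + f ((UNIV - C) \<inter> E) \<le> f (C \<inter> E) + (f (D n) + ennreal e)"
          by (intro add_left_mono) (simp add: add_left_mono)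
        also have "\<dots> \<le> f E + ennreal e"
          unfolding add.assoc[symmetric] by (intro add_right_mono D_sep)
        finally show "f (C \<inter> E) + f ((UNIV - C) \<inter> E) \<le> f E + ennreal e" .
      qed
    qed
  qed
  then show ?thesis by (simp add: lambda_system_def)
qed

lemma countably_additive_borel: "countably_additive (sets borel) f"
proof -
  have ms: "measure_space UNIV (lambda_system UNIV (Pow UNIV) f) f"
    using sigma_algebra.caratheodory_lemma[OF sigma_algebra_Pow outer_measure_space] .
  have "sets borel \<subseteq> lambda_system UNIV (Pow UNIV) f"
  proof -
    have "sigma_sets UNIV (Collect closed) \<subseteq> lambda_system UNIV (Pow UNIV) f"
      using ms closed_in_lambda_system
      by (intro sigma_algebra.sigma_sets_subset) (auto simp: measure_space_def)
    then show ?thesis by (simp add: borel_eq_closed)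
  qed
  then show ?thesis
    using ms unfolding measure_space_def countably_additive_def by (meson subset_trans subsetD)
qed

end

definition diam_power :: "nat \<Rightarrow> 'a::euclidean_space set \<Rightarrow> ennreal" where
  "diam_power s U = (if U = {} then 0 else ennreal (diameter U ^ s))"

definition covers :: "real \<Rightarrow> 'a::euclidean_space set \<Rightarrow> (nat \<Rightarrow> 'a set) set" where
  "covers \<delta> A = {U. A \<subseteq> (\<Union>i. U i) \<and> (\<forall>i. bounded (U i) \<and> diameter (U i) \<le> \<delta>)}"

text \<open>
  The outer contents of size \<open>\<delta>\<close> in Caratheodory's construction, whose supremum over \<open>\<delta>\<close> is the Hausdorff
  measure up to the normalising factor.
\<close>

definition size_content :: "nat \<Rightarrow> real \<Rightarrow> 'a::euclidean_space set \<Rightarrow> ennreal" where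
  "size_content s \<delta> A = (INF U\<in>covers \<delta> A. \<Sum>i. diam_power s (U i))"

definition unnormalized_hausdorff :: "nat \<Rightarrow> 'a::euclidean_space set \<Rightarrow> ennreal" where
  "unnormalized_hausdorff s A = (SUP \<delta>\<in>{0<..}. size_content s \<delta> A)"

lemma hausdorff_outer_eq:
  "hausdorff_outer s A = ennreal (unit_ball_vol (real s) / 2 ^ s) * unnormalized_hausdorff s A"
  by (simp add: hausdorff_outer_def unnormalized_hausdorff_def size_content_def covers_def diam_power_def)

lemma size_content_le: "U \<in> covers \<delta> A \<Longrightarrow> size_content s \<delta> A \<le> (\<Sum>i. diam_power s (U i))"
  unfolding size_content_def by (rule INF_lower)

lemma size_content_antimono: "\<delta> \<le> \<epsilon> \<Longrightarrow> size_content s \<epsilon> A \<le> size_content s \<delta> A"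
  unfolding size_content_def by (rule INF_superset_mono) (auto simp: covers_def intro: order_trans)

lemma size_content_mono: "A \<subseteq> B \<Longrightarrow> size_content s \<delta> A \<le> size_content s \<delta> B"
  unfolding size_content_def by (rule INF_superset_mono) (auto simp: covers_def)

lemma size_content_UN_le:
  assumes "\<delta> > 0"
  shows "size_content s \<delta> (\<Union>i. A i) \<le> (\<Sum>i. size_content s \<delta> (A i))"
proof (rule ennreal_le_epsilon)
  fix e :: real assume fin: "(\<Sum>i. size_content s \<delta> (A i)) < top" and e: "0 < e"
  have "\<exists>U. U \<in> covers \<delta> (A i) \<and> (\<Sum>j. diam_power s (U j)) \<le> size_content s \<delta> (A i) + ennreal (e * (1 / 2) ^ Suc i)" for i
  proof -
    have "size_content s \<delta> (A i) \<le> (\<Sum>i. size_content s \<delta> (A i))"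
      using sum_le_suminf[of "\<lambda>i. size_content s \<delta> (A i)" "{i}"] by simp
    then have "size_content s \<delta> (A i) < top" using fin by (rule le_less_trans)
    then have "size_content s \<delta> (A i) < size_content s \<delta> (A i) + ennreal (e * (1 / 2) ^ Suc i)"
      using e by (cases "size_content s \<delta> (A i)") (auto simp: ennreal_less_iff simp flip: ennreal_plus)
    then show ?thesis
      unfolding size_content_def[of s \<delta> "A i"] INF_less_iff by (blast intro: less_imp_le)
  qed
  then have "\<forall>i. \<exists>U. U \<in> covers \<delta> (A i) \<and> (\<Sum>j. diam_power s (U j)) \<le> size_content s \<delta> (A i) + ennreal (e * (1 / 2) ^ Suc i)" ..
  from choice[OF this] obtain U
    where U0: "\<forall>i. U i \<in> covers \<delta> (A i) \<and> (\<Sum>j. diam_power s (U i j)) \<le> size_content s \<delta> (A i) + ennreal (e * (1 / 2) ^ Suc i)" ..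
  note U = U0[THEN spec, THEN conjunct1] U0[THEN spec, THEN conjunct2]
  define U' where "U' n = U (fst (prod_decode n)) (snd (prod_decode n))" for n
  have "U' \<in> covers \<delta> (\<Union>i. A i)"
  proof -
    have "x \<in> (\<Union>n. U' n)" if "x \<in> A i" for x i
    proof -
      obtain j where "x \<in> U i j" using U(1)[of i] \<open>x \<in> A i\<close> by (auto simp: covers_def)
      then have "x \<in> U' (prod_encode (i, j))" by (simp add: U'_def)
      then show ?thesis by blast
    qed
    then have "(\<Union>i. A i) \<subseteq> (\<Union>n. U' n)" by blast
    then show ?thesis using U(1) by (simp add: covers_def U'_def)
  qed
  then have "size_content s \<delta> (\<Union>i. A i) \<le> (\<Sum>n. diam_power s (U' n))" by (rule size_content_le)
  also have "\<dots> = (\<Sum>i. \<Sum>j. diam_power s (U i j))"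
    unfolding U'_def
    by (rule suminf_ennreal_2dimen[where f = "\<lambda>p. diam_power s (U (fst p) (snd p))"]) (simp only: fst_conv snd_conv)
  also have "\<dots> \<le> (\<Sum>i. size_content s \<delta> (A i) + ennreal (e * (1 / 2) ^ Suc i))"
    by (intro suminf_le U(2)) auto
  also have "\<dots> = (\<Sum>i. size_content s \<delta> (A i)) + (\<Sum>i. ennreal (e * (1 / 2) ^ Suc i))"
    by (intro suminf_add[symmetric]) auto
  also have "(\<Sum>i. ennreal (e * (1 / 2) ^ Suc i)) = ennreal e"
  proof (rule suminf_ennreal_eq)
    show "(\<lambda>i. e * (1 / 2) ^ Suc i) sums e"
      using sums_mult[OF power_half_series, of e] by simp
  qed (use e in auto)
  finally show "size_content s \<delta> (\<Union>i. A i) \<le> (\<Sum>i. size_content s \<delta> (A i)) + ennreal e" .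
qed

text \<open>
  No set of diameter at most \<open>\<delta> < d\<close> meets both \<open>A\<close> and \<open>B\<close>, so a cover of the union splits into covers of the two sets.
\<close>

lemma size_content_separated:
  assumes "\<delta> < d" "\<And>x y. x \<in> A \<Longrightarrow> y \<in> B \<Longrightarrow> d \<le> dist x y"
  shows "size_content s \<delta> A + size_content s \<delta> B \<le> size_content s \<delta> (A \<union> B)"
  unfolding size_content_def[of s \<delta> "A \<union> B"]
proof (rule INF_greatest)
  fix U assume U: "U \<in> covers \<delta> (A \<union> B)"
  define P where "P X i = (if U i \<inter> X = {} then {} else U i)" for X i
  have P: "P X \<in> covers \<delta> X" if X: "X \<subseteq> A \<union> B" for X
  proof -
    have "0 \<le> \<delta>"
      using U diameter_ge_0[of "U 0"] by (force simp: covers_def intro: order_trans)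
    moreover have "X \<subseteq> (\<Union>i. P X i)"
    proof
      fix x assume "x \<in> X"
      then obtain i where "x \<in> U i" using U X unfolding covers_def by blast
      then have "x \<in> P X i" using \<open>x \<in> X\<close> by (auto simp: P_def)
      then show "x \<in> (\<Union>i. P X i)" by blast
    qed
    ultimately show ?thesis using U by (auto simp: covers_def P_def)
  qed
  have "diam_power s (P A i) + diam_power s (P B i) \<le> diam_power s (U i)" for i
  proof (cases "U i \<inter> A = {} \<or> U i \<inter> B = {}")
    case False
    then obtain x y where xy: "x \<in> U i" "x \<in> A" "y \<in> U i" "y \<in> B" by blast
    have "d \<le> dist x y" using assms(2) xy by blast
    also have "\<dots> \<le> \<delta>"
      using U xy diameter_bounded_bound[of "U i" x y] by (auto simp: covers_def intro: order_trans)
    finally show ?thesis using assms(1) by simp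
  qed (auto simp: P_def diam_power_def)
  then have "(\<Sum>i. diam_power s (P A i) + diam_power s (P B i)) \<le> (\<Sum>i. diam_power s (U i))"
    by (intro suminf_le) auto
  then have "(\<Sum>i. diam_power s (P A i)) + (\<Sum>i. diam_power s (P B i)) \<le> (\<Sum>i. diam_power s (U i))"
    by (simp add: suminf_add)
  then show "size_content s \<delta> A + size_content s \<delta> B \<le> (\<Sum>i. diam_power s (U i))"
    by (rule order_trans[rotated]) (intro add_mono size_content_le P; simp)
qed

lemma unnormalized_hausdorff_eq_SUP_nat:
  "unnormalized_hausdorff s A = (SUP n. size_content s (1 / real (Suc n)) A)"
  unfolding unnormalized_hausdorff_def
proof (rule antisym)
  show "(SUP \<delta>\<in>{0<..}. size_content s \<delta> A) \<le> (SUP n. size_content s (1 / real (Suc n)) A)"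
  proof (rule SUP_mono)
    fix \<delta> :: real assume "\<delta> \<in> {0<..}"
    then obtain n where "1 / real (Suc n) < \<delta>"
      using reals_Archimedean[of \<delta>] by (auto simp: inverse_eq_divide)
    then show "\<exists>n\<in>UNIV. size_content s \<delta> A \<le> size_content s (1 / real (Suc n)) A"
      by (intro bexI[of _ n] size_content_antimono) auto
  qed
  show "(SUP n. size_content s (1 / real (Suc n)) A) \<le> (SUP \<delta>\<in>{0<..}. size_content s \<delta> A)"
    by (intro SUP_least SUP_upper) simp
qed

interpretation unnormalized_hausdorff: metric_outer_measure "unnormalized_hausdorff s :: 'a::euclidean_space set \<Rightarrow> ennreal"
proof
  have "size_content s \<delta> ({} :: 'a set) \<le> 0" if "\<delta> > 0" for \<delta>
    using that size_content_le[of "\<lambda>_. {}" \<delta> "{} :: 'a set" s] by (auto simp: covers_def diam_power_def)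
  then show "unnormalized_hausdorff s ({} :: 'a set) = 0"
    unfolding unnormalized_hausdorff_def by (intro antisym SUP_least) auto
  show "unnormalized_hausdorff s A \<le> unnormalized_hausdorff s B" if "A \<subseteq> B" for A B :: "'a set"
    unfolding unnormalized_hausdorff_def by (intro SUP_mono) (use size_content_mono[OF that] in blast)
  show "unnormalized_hausdorff s (\<Union>i. A i) \<le> (\<Sum>i. unnormalized_hausdorff s (A i))" for A :: "nat \<Rightarrow> 'a set"
    unfolding unnormalized_hausdorff_def[of s "\<Union>i. A i"]
  proof (rule SUP_least)
    fix \<delta> :: real assume \<delta>: "\<delta> \<in> {0<..}"
    then have "size_content s \<delta> (\<Union>i. A i) \<le> (\<Sum>i. size_content s \<delta> (A i))"
      by (intro size_content_UN_le) simp
    also have "\<dots> \<le> (\<Sum>i. unnormalized_hausdorff s (A i))"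
      using \<delta> unfolding unnormalized_hausdorff_def by (intro suminf_le SUP_upper) auto
    finally show "size_content s \<delta> (\<Union>i. A i) \<le> (\<Sum>i. unnormalized_hausdorff s (A i))" .
  qed
  fix A B :: "'a set" and d :: real
  assume d: "0 < d" and sep: "\<And>x y. x \<in> A \<Longrightarrow> y \<in> B \<Longrightarrow> d \<le> dist x y"
  let ?c = "\<lambda>n X. size_content s (1 / real (Suc n)) X"
  have inc: "incseq (\<lambda>n. ?c n X)" for X :: "'a set"
    by (intro incseq_SucI size_content_antimono) (simp add: frac_le)
  have "unnormalized_hausdorff s A + unnormalized_hausdorff s B = (SUP n. ?c n A + ?c n B)"
    unfolding unnormalized_hausdorff_eq_SUP_nat by (rule ennreal_SUP_add[OF inc inc, symmetric])
  also have "\<dots> \<le> unnormalized_hausdorff s (A \<union> B)"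
  proof (rule SUP_least)
    fix n
    obtain m where m: "1 / real (Suc m) < d"
      using reals_Archimedean[OF d] by (auto simp: inverse_eq_divide)
    define k where "k = max n m"
    have "1 / real (Suc k) \<le> 1 / real (Suc m)" by (intro divide_left_mono) (auto simp: k_def)
    then have kd: "1 / real (Suc k) < d" using m by simp
    have "?c n A + ?c n B \<le> ?c k A + ?c k B"
      using inc by (intro add_mono) (auto simp: incseq_def k_def)
    also have "\<dots> \<le> ?c k (A \<union> B)" by (rule size_content_separated[OF kd sep])
    also have "\<dots> \<le> unnormalized_hausdorff s (A \<union> B)"
      unfolding unnormalized_hausdorff_eq_SUP_nat by (rule SUP_upper) simp
    finally show "?c n A + ?c n B \<le> unnormalized_hausdorff s (A \<union> B)" .
  qed
  finally show "unnormalized_hausdorff s A + unnormalized_hausdorff s B \<le> unnormalized_hausdorff s (A \<union> B)" .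
qed

lemma sets_hausdorff_measure[simp, measurable_cong]: "sets (hausdorff_measure s) = sets borel"
  and space_hausdorff_measure[simp]: "space (hausdorff_measure s) = UNIV"
  by (simp_all add: hausdorff_measure_def) (metis sets.sigma_sets_eq space_borel)

lemma emeasure_hausdorff_measure:
  assumes "A \<in> sets borel"
  shows "emeasure (hausdorff_measure s) A = hausdorff_outer s A"
  using assms unfolding hausdorff_measure_def
proof (intro emeasure_measure_of_sigma)
  show "sigma_algebra UNIV (sets borel :: 'a set set)" by (metis sets.sigma_algebra_axioms space_borel)
  show "positive (sets borel) (hausdorff_outer s :: 'a set \<Rightarrow> ennreal)"
    by (simp add: positive_def hausdorff_outer_eq unnormalized_hausdorff.empty)
  show "countably_additive (sets borel) (hausdorff_outer s :: 'a set \<Rightarrow> ennreal)"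
    using unnormalized_hausdorff.countably_additive_borel[of s, where 'a = 'a]
    by (auto simp: countably_additive_def hausdorff_outer_eq)
qed

lemma hausdorff_outer_isometry_le:
  fixes T :: "'a::euclidean_space \<Rightarrow> 'a"
  assumes T: "\<And>x y. dist (T x) (T y) = dist x y"
  shows "hausdorff_outer s (T ` A) \<le> hausdorff_outer s A"
proof -
  have diam: "diameter (T ` U) \<le> diameter U" and bdd: "bounded (T ` U)" if U: "bounded U" for U
  proof -
    show "diameter (T ` U) \<le> diameter U"
      using diameter_bounded_bound[OF U] diameter_ge_0[OF U]
      by (intro diameter_le) (auto simp: T dist_norm[symmetric])
    then show "bounded (T ` U)"
      using diameter_bounded_bound[OF U]
      unfolding bounded_two_points by (intro exI[of _ "diameter U"]) (auto simp: T)
  qed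
  have "size_content s \<delta> (T ` A) \<le> size_content s \<delta> A" for \<delta>
    unfolding size_content_def[of s \<delta> A]
  proof (rule INF_greatest)
    fix U assume U: "U \<in> covers \<delta> A"
    then have b: "bounded (U i)" for i by (simp add: covers_def)
    have "(\<lambda>i. T ` U i) \<in> covers \<delta> (T ` A)"
      using U image_mono[of A "\<Union>i. U i" T]
      by (auto simp: covers_def image_UN bdd intro: order_trans[OF diam])
    then have "size_content s \<delta> (T ` A) \<le> (\<Sum>i. diam_power s (T ` U i))" by (rule size_content_le)
    also have "\<dots> \<le> (\<Sum>i. diam_power s (U i))"
    proof (intro suminf_le allI)
      show "diam_power s (T ` U i) \<le> diam_power s (U i)" for i
        using diam[OF b[of i]] diameter_ge_0[OF bdd[OF b[of i]]]
        by (auto simp: diam_power_def intro!: ennreal_leI power_mono)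
    qed auto
    finally show "size_content s \<delta> (T ` A) \<le> (\<Sum>i. diam_power s (U i))" .
  qed
  then show ?thesis
    unfolding hausdorff_outer_eq unnormalized_hausdorff_def
    by (intro mult_left_mono SUP_mono) auto
qed

text \<open>
  An isometry preserves diameters of covering sets. For an involution preimages are images, so one inequality,
  applied twice, suffices.
\<close>

lemma distr_hausdorff_measure_isometry:
  fixes T :: "'a::euclidean_space \<Rightarrow> 'a"
  assumes T: "\<And>x y. dist (T x) (T y) = dist x y" and inv: "\<And>x. T (T x) = x"
  shows "distr (hausdorff_measure s) borel T = hausdorff_measure s"
proof (rule measure_eqI)
  have "continuous_on UNIV T"
    by (auto simp: continuous_on_iff T)
  then have [measurable]: "T \<in> borel_measurable borel" by (rule borel_measurable_continuous_onI)
  fix A assume "A \<in> sets (distr (hausdorff_measure s) borel T)"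
  then have A: "A \<in> sets borel" by simp
  have "T -` A = T ` A" using inv by (auto simp: image_iff) metis
  have "T -` A \<in> sets borel" using measurable_sets[OF \<open>T \<in> borel_measurable borel\<close> A] by simp
  then have "emeasure (distr (hausdorff_measure s) borel T) A = hausdorff_outer s (T ` A)"
    using A by (subst emeasure_distr) (auto simp: emeasure_hausdorff_measure \<open>T -` A = T ` A\<close>)
  also have "\<dots> = hausdorff_outer s A"
  proof (rule antisym)
    show "hausdorff_outer s (T ` A) \<le> hausdorff_outer s A" by (rule hausdorff_outer_isometry_le[OF T])
    have "T ` T ` A = A" using inv by (auto simp: image_image)
    then show "hausdorff_outer s A \<le> hausdorff_outer s (T ` A)"
      using hausdorff_outer_isometry_le[OF T, of s "T ` A"] by simp
  qed
  finally show "emeasure (distr (hausdorff_measure s) borel T) A = emeasure (hausdorff_measure s) A"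
    by (simp add: emeasure_hausdorff_measure A)
qed simp

section \<open>The Hausdorff measure of the unit sphere is finite and positive\<close>

lemma power_Suc_diff_le:
  fixes a b :: real
  assumes "0 \<le> b" "b \<le> a"
  shows "a ^ Suc n - b ^ Suc n \<le> real (Suc n) * (a - b) * a ^ n"
proof (induction n)
  case (Suc n)
  have "a ^ Suc (Suc n) - b ^ Suc (Suc n) = a * (a ^ Suc n - b ^ Suc n) + b ^ Suc n * (a - b)"
    by (simp add: algebra_simps)
  also have "\<dots> \<le> a * (real (Suc n) * (a - b) * a ^ n) + a ^ Suc n * (a - b)"
    using Suc assms by (intro add_mono mult_left_mono mult_right_mono power_mono) auto
  also have "\<dots> = real (Suc (Suc n)) * (a - b) * a ^ Suc n"
    by (simp add: algebra_simps)
  finally show ?case .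
qed simp

lemma measure_lborel_ball:
  "r \<ge> 0 \<Longrightarrow> measure lborel (ball (c :: 'a::euclidean_space) r) = unit_ball_vol (real DIM('a)) * r ^ DIM('a)"
  using emeasure_ball[of r c] by (simp add: measure_def)

text \<open>
  The constant from the volume comparison in the next lemma; the point is that it does not depend on \<open>\<epsilon>\<close>.
\<close>

definition packing_bound :: "'a::euclidean_space itself \<Rightarrow> real" where
  "packing_bound _ = real DIM('a) * 2 ^ DIM('a) * (3 / 2) ^ (DIM('a) - 1)"

text \<open>
  The balls of radius \<open>\<epsilon>/2\<close> around the points are disjoint and lie in a shell of width \<open>\<epsilon>\<close> around the sphere, whose
  volume is of order \<open>\<epsilon>\<close>.
\<close>

lemma card_separated_le:
  fixes P :: "'a::euclidean_space set"
  assumes P: "finite P" "P \<subseteq> sphere 0 1" and sep: "\<And>p q. p \<in> P \<Longrightarrow> q \<in> P \<Longrightarrow> p \<noteq> q \<Longrightarrow> \<epsilon> \<le> dist p q"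
    and \<epsilon>: "0 < \<epsilon>" "\<epsilon> \<le> 1"
  shows "real (card P) * \<epsilon> ^ (DIM('a) - 1) \<le> packing_bound TYPE('a)"
proof -
  define N where "N = DIM('a) - 1"
  have N: "DIM('a) = Suc N" by (simp add: N_def)
  let ?\<omega> = "unit_ball_vol (real DIM('a))"
  have disj: "disjoint_family_on (\<lambda>p. ball p (\<epsilon> / 2)) P"
    unfolding disjoint_family_on_def
  proof (intro ballI impI)
    fix p q assume pq: "p \<in> P" "q \<in> P" "p \<noteq> q"
    show "ball p (\<epsilon> / 2) \<inter> ball q (\<epsilon> / 2) = {}"
    proof (rule ccontr)
      assume "ball p (\<epsilon> / 2) \<inter> ball q (\<epsilon> / 2) \<noteq> {}"
      then obtain x where "dist p x < \<epsilon> / 2" "dist q x < \<epsilon> / 2" by auto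
      then have "dist p q < \<epsilon>" using dist_triangle2[of p q x] by simp
      with sep[OF pq] show False by simp
    qed
  qed
  have sub: "(\<Union>p\<in>P. ball p (\<epsilon> / 2)) \<subseteq> ball 0 (1 + \<epsilon> / 2) - ball 0 (1 - \<epsilon> / 2)"
  proof
    fix x assume "x \<in> (\<Union>p\<in>P. ball p (\<epsilon> / 2))"
    then obtain p where p: "p \<in> P" "dist p x < \<epsilon> / 2" by auto
    then have "norm p = 1" using P(2) by auto
    then show "x \<in> ball 0 (1 + \<epsilon> / 2) - ball 0 (1 - \<epsilon> / 2)"
      using p(2) norm_triangle_ineq2[of x p] norm_triangle_ineq2[of p x]
      by (auto simp: dist_norm norm_minus_commute)
  qed
  have fin: "emeasure lborel (ball (c::'a) r) < \<infinity>" for c r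
    by (rule emeasure_bounded_finite) simp
  have "real (card P) * (?\<omega> * (\<epsilon> / 2) ^ DIM('a)) = (\<Sum>p\<in>P. measure lborel (ball p (\<epsilon> / 2)))"
    using \<epsilon> by (simp add: measure_lborel_ball)
  also have "\<dots> = measure lborel (\<Union>p\<in>P. ball p (\<epsilon> / 2))"
    using P(1) disj fin by (intro measure_finite_Union[symmetric]) (auto simp: less_top)
  also have "\<dots> \<le> measure lborel (ball (0::'a) (1 + \<epsilon> / 2) - ball 0 (1 - \<epsilon> / 2))"
  proof (rule measure_mono_fmeasurable[OF sub])
    show "(\<Union>p\<in>P. ball p (\<epsilon> / 2)) \<in> sets lborel"
      using P(1) by (intro sets.finite_UN) auto
    show "ball (0::'a) (1 + \<epsilon> / 2) - ball 0 (1 - \<epsilon> / 2) \<in> fmeasurable lborel"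
      using fin[of 0 "1 + \<epsilon> / 2"] by (intro fmeasurable_Diff) (auto simp: fmeasurable_def)
  qed
  also have "\<dots> = measure lborel (ball (0::'a) (1 + \<epsilon> / 2)) - measure lborel (ball (0::'a) (1 - \<epsilon> / 2))"
    using \<epsilon> fin[of 0 "1 + \<epsilon> / 2"] by (intro measure_Diff) (auto simp: less_top)
  also have "\<dots> = ?\<omega> * ((1 + \<epsilon> / 2) ^ Suc N - (1 - \<epsilon> / 2) ^ Suc N)"
    using \<epsilon> by (simp add: measure_lborel_ball right_diff_distrib N)
  also have "\<dots> \<le> ?\<omega> * (real (Suc N) * \<epsilon> * (3 / 2) ^ N)"
  proof (rule mult_left_mono)
    have "(1 + \<epsilon> / 2) ^ Suc N - (1 - \<epsilon> / 2) ^ Suc N \<le> real (Suc N) * ((1 + \<epsilon> / 2) - (1 - \<epsilon> / 2)) * (1 + \<epsilon> / 2) ^ N"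
      using \<epsilon> by (intro power_Suc_diff_le) auto
    also have "\<dots> \<le> real (Suc N) * \<epsilon> * (3 / 2) ^ N"
      using \<epsilon> by (intro mult_mono power_mono) auto
    finally show "(1 + \<epsilon> / 2) ^ Suc N - (1 - \<epsilon> / 2) ^ Suc N \<le> real (Suc N) * \<epsilon> * (3 / 2) ^ N" .
  qed simp
  finally have "?\<omega> * (real (card P) * (\<epsilon> / 2) ^ Suc N) \<le> ?\<omega> * (real (Suc N) * \<epsilon> * (3 / 2) ^ N)"
    by (simp add: N mult_ac)
  moreover have "0 < ?\<omega>" by simp
  ultimately have "real (card P) * (\<epsilon> / 2) ^ Suc N \<le> real (Suc N) * \<epsilon> * (3 / 2) ^ N"
    by (rule mult_left_le_imp_le)
  then have "2 ^ Suc N * (real (card P) * (\<epsilon> / 2) ^ Suc N) \<le> 2 ^ Suc N * (real (Suc N) * \<epsilon> * (3 / 2) ^ N)"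
    by (rule mult_left_mono) simp
  moreover have "2 ^ Suc N * (real (card P) * (\<epsilon> / 2) ^ Suc N) = \<epsilon> * (real (card P) * \<epsilon> ^ N)"
    by (simp add: power_divide)
  moreover have "2 ^ Suc N * (real (Suc N) * \<epsilon> * (3 / 2) ^ N) = \<epsilon> * (real (Suc N) * 2 ^ Suc N * (3 / 2) ^ N)"
    by (simp only: mult_ac)
  ultimately have "\<epsilon> * (real (card P) * \<epsilon> ^ N) \<le> \<epsilon> * (real (Suc N) * 2 ^ Suc N * (3 / 2) ^ N)"
    by (simp only:)
  then have "real (card P) * \<epsilon> ^ N \<le> real (Suc N) * 2 ^ Suc N * (3 / 2) ^ N"
    using \<epsilon>(1) by (rule mult_left_le_imp_le)
  then show ?thesis by (simp add: packing_bound_def N)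
qed

text \<open>
  An \<open>\<epsilon>\<close>-separated set of maximal cardinality is an \<open>\<epsilon>\<close>-net.
\<close>

lemma finite_net_of_sphere:
  fixes \<epsilon> :: real
  assumes \<epsilon>: "0 < \<epsilon>" "\<epsilon> \<le> 1"
  obtains P :: "'a::euclidean_space set" where "finite P" "sphere 0 1 \<subseteq> (\<Union>p\<in>P. ball p \<epsilon>)"
    "real (card P) * \<epsilon> ^ (DIM('a) - 1) \<le> packing_bound TYPE('a)"
proof -
  define Q where "Q P \<longleftrightarrow> finite P \<and> P \<subseteq> sphere (0::'a) 1 \<and>
    (\<forall>p\<in>P. \<forall>q\<in>P. p \<noteq> q \<longrightarrow> \<epsilon> \<le> dist p q)" for P
  have bound: "real (card P) * \<epsilon> ^ (DIM('a) - 1) \<le> packing_bound TYPE('a)" if "Q P" for P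
    using that \<epsilon> by (intro card_separated_le) (auto simp: Q_def)
  obtain K :: nat where K: "packing_bound TYPE('a) / \<epsilon> ^ (DIM('a) - 1) < real K"
    using reals_Archimedean2 by blast
  have "card P < K" if "Q P" for P
  proof -
    have "real (card P) \<le> packing_bound TYPE('a) / \<epsilon> ^ (DIM('a) - 1)"
      using bound[OF that] \<epsilon> by (simp add: pos_le_divide_eq)
    then have "real (card P) < real K" using K by (rule le_less_trans)
    then show ?thesis by simp
  qed
  moreover have "Q {}" by (simp add: Q_def)
  ultimately obtain P where P: "Q P" "\<And>P'. Q P' \<Longrightarrow> card P' \<le> card P"
    using ex_has_greatest_nat[of Q "{}" card K] by (metis less_imp_le)
  have "x \<in> (\<Union>p\<in>P. ball p \<epsilon>)" if x: "x \<in> sphere 0 1" for x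
  proof (rule ccontr)
    assume "x \<notin> (\<Union>p\<in>P. ball p \<epsilon>)"
    then have far: "\<epsilon> \<le> dist p x" if "p \<in> P" for p using that by (auto simp: not_less)
    then have "x \<notin> P" using \<epsilon>(1) by force
    have "Q (insert x P)"
      using P(1) x far by (auto simp: Q_def dist_commute)
    from P(2)[OF this] \<open>x \<notin> P\<close> P(1) show False by (simp add: Q_def)
  qed
  then have "sphere 0 1 \<subseteq> (\<Union>p\<in>P. ball p \<epsilon>)" by (rule subsetI)
  moreover have "finite P" using P(1) by (simp add: Q_def)
  ultimately show ?thesis using that bound[OF P(1)] by blast
qed

lemma size_content_sphere_le:
  fixes \<delta> :: real
  assumes "\<delta> > 0"
  shows "size_content (DIM('a) - 1) \<delta> (sphere (0::'a::euclidean_space) 1) \<le>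
    ennreal (2 ^ (DIM('a) - 1) * packing_bound TYPE('a))"
proof -
  let ?N = "DIM('a) - 1"
  \<comment> \<open>Balls of radius \<open>\<epsilon>\<close> must have diameter at most \<open>\<delta>\<close>, and the packing bound needs \<open>\<epsilon> \<le> 1\<close>.\<close>
  define \<epsilon> where "\<epsilon> = min \<delta> 1 / 2"
  have \<epsilon>: "0 < \<epsilon>" "\<epsilon> \<le> 1" "2 * \<epsilon> \<le> \<delta>" using assms by (auto simp: \<epsilon>_def min_def)
  obtain P :: "'a set" where P: "finite P" "sphere 0 1 \<subseteq> (\<Union>p\<in>P. ball p \<epsilon>)"
    "real (card P) * \<epsilon> ^ ?N \<le> packing_bound TYPE('a)"
    using finite_net_of_sphere[OF \<epsilon>(1,2)] by blast
  obtain e where e: "bij_betw e {0..<card P} P" using ex_bij_betw_nat_finite[OF P(1)] by blast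
  define U where "U i = (if i < card P then ball (e i) \<epsilon> else {})" for i
  have diam: "diameter (ball p \<epsilon>) \<le> 2 * \<epsilon>" for p :: 'a
  proof (rule diameter_le)
    fix x y assume "x \<in> ball p \<epsilon>" "y \<in> ball p \<epsilon>"
    then show "norm (x - y) \<le> 2 * \<epsilon>"
      using dist_triangle3[of x y p] by (simp add: dist_norm)
  qed (use \<epsilon>(1) in simp)
  have "U \<in> covers \<delta> (sphere 0 1)"
  proof -
    have "x \<in> (\<Union>i. U i)" if "x \<in> sphere 0 1" for x
    proof -
      from P(2) that obtain p where p: "p \<in> P" "x \<in> ball p \<epsilon>" by blast
      moreover have "P = e ` {0..<card P}" using e by (simp add: bij_betw_def)
      ultimately obtain i where "i < card P" "e i = p" by force
      then have "x \<in> U i" using p by (simp add: U_def)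
      then show ?thesis by blast
    qed
    moreover have "diameter (U i) \<le> \<delta>" for i
      using diam[of "e i"] \<epsilon> assms by (auto simp: U_def)
    ultimately show ?thesis by (auto simp: covers_def U_def)
  qed
  then have "size_content ?N \<delta> (sphere (0::'a) 1) \<le> (\<Sum>i. diam_power ?N (U i))" by (rule size_content_le)
  also have "\<dots> = (\<Sum>i<card P. diam_power ?N (U i))"
    by (rule suminf_finite) (auto simp: U_def diam_power_def)
  also have "\<dots> \<le> (\<Sum>i<card P. ennreal ((2 * \<epsilon>) ^ ?N))"
  proof (rule sum_mono)
    fix i
    show "diam_power ?N (U i) \<le> ennreal ((2 * \<epsilon>) ^ ?N)"
      using diam[of "e i"] diameter_ge_0[of "ball (e i) \<epsilon>"]
      by (auto simp: diam_power_def U_def intro!: ennreal_leI power_mono)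
  qed
  also have "\<dots> = ennreal (real (card P) * (2 * \<epsilon>) ^ ?N)"
    using \<epsilon>(1) by (simp add: ennreal_mult ennreal_of_nat_eq_real_of_nat)
  also have "\<dots> \<le> ennreal (2 ^ ?N * packing_bound TYPE('a))"
    using P(3) by (intro ennreal_leI) (simp add: power_mult_distrib mult_ac)
  finally show ?thesis .
qed

text \<open>
  The cone over a set of diameter less than \<open>d\<close> stays close to one segment from the origin, and \<open>1/d + 2\<close> balls of
  radius \<open>2d\<close> cover such a neighbourhood. The resulting volume is of order \<open>d\<^sup>N\<^sup>-\<^sup>1\<close>, the power in the Hausdorff sum.
\<close>

lemma cone_in_few_balls:
  fixes U :: "'a::euclidean_space set"
  assumes U: "bounded U" "diameter U < d" and d: "0 < d" "d \<le> 2"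
  obtains B where "B \<in> sets borel" "\<And>t x. x \<in> U \<Longrightarrow> norm x = 1 \<Longrightarrow> 0 \<le> t \<Longrightarrow> t \<le> 1 \<Longrightarrow> t *\<^sub>R x \<in> B"
    "emeasure lborel B \<le> ennreal (5 * 2 ^ DIM('a) * unit_ball_vol (real DIM('a)) * d ^ (DIM('a) - 1))"
proof (cases "U \<inter> sphere 0 1 = {}")
  case True
  then show ?thesis by (intro that[of "{}"]) auto
next
  case False
  then obtain v where v: "v \<in> U" "norm v = 1" by auto
  define m where "m = nat \<lceil>1 / d\<rceil>"
  have m: "1 / d \<le> real m" "real m \<le> 1 / d + 1" "0 < m"
  proof -
    show "1 / d \<le> real m" "real m \<le> 1 / d + 1" using d by (auto simp: m_def)
    then have "0 < real m" using d by (meson divide_pos_pos less_le_trans zero_less_one)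
    then show "0 < m" by (simp only: of_nat_0_less_iff)
  qed
  let ?c = "\<lambda>j::nat. (real j / real m) *\<^sub>R v"
  let ?B = "\<Union>j\<in>{..m}. ball (?c j) (2 * d)"
  show ?thesis
  proof (rule that[of ?B])
    fix t x assume x: "x \<in> U" "norm x = 1" and t: "0 \<le> t" "t \<le> (1::real)"
    \<comment> \<open>The centre nearest to \<open>t v\<close> from below among the multiples of \<open>v / m\<close>.\<close>
    define j where "j = nat \<lfloor>t * real m\<rfloor>"
    have j: "real j \<le> t * real m" "t * real m < real j + 1"
      using t by (auto simp: j_def)
    have "real j \<le> real m" using j(1) mult_left_le_one_le[of "real m" t] t by linarith
    then have jm: "j \<le> m" by simp
    have "\<bar>t - real j / real m\<bar> \<le> 1 / real m"
    proof -
      have "real j / real m \<le> t" using j(1) m(3) by (simp add: pos_divide_le_eq)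
      moreover have "t < (real j + 1) / real m" using j(2) m(3) by (simp add: pos_less_divide_eq)
      ultimately show ?thesis by (simp add: abs_le_iff add_divide_distrib)
    qed
    also have "\<dots> \<le> d" using m(1,3) d by (simp add: field_simps)
    finally have tj: "\<bar>t - real j / real m\<bar> \<le> d" .
    have "norm (x - v) < d"
      using diameter_bounded_bound[OF U(1) x(1) v(1)] U(2) by (simp add: dist_norm)
    have "dist (?c j) (t *\<^sub>R x) = norm (t *\<^sub>R (x - v) + (t - real j / real m) *\<^sub>R v)"
      by (simp add: dist_norm norm_minus_commute[of "?c j"] algebra_simps)
    also have "\<dots> \<le> t * norm (x - v) + \<bar>t - real j / real m\<bar>"
      using norm_triangle_ineq[of "t *\<^sub>R (x - v)" "(t - real j / real m) *\<^sub>R v"] t v by simp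
    also have "\<dots> \<le> norm (x - v) + d"
      using t tj by (intro add_mono mult_left_le_one_le) auto
    also have "\<dots> < 2 * d" using \<open>norm (x - v) < d\<close> by simp
    finally show "t *\<^sub>R x \<in> ?B" using jm by (intro UN_I[of j]) auto
  next
    let ?\<omega> = "unit_ball_vol (real DIM('a))"
    have "emeasure lborel ?B \<le> (\<Sum>j\<in>{..m}. emeasure lborel (ball (?c j) (2 * d)))"
      by (rule emeasure_subadditive_finite) auto
    also have "\<dots> = (\<Sum>j\<in>{..m}. ennreal (?\<omega> * (2 * d) ^ DIM('a)))"
      using d by (simp add: emeasure_ball)
    also have "\<dots> = ennreal ((real m + 1) * (?\<omega> * (2 * d) ^ DIM('a)))"
      using d by (subst sum_ennreal) (auto simp: add.commute)
    also have "\<dots> \<le> ennreal (5 / d * (?\<omega> * (2 * d) ^ DIM('a)))"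
    proof (intro ennreal_leI mult_right_mono)
      have "2 \<le> 4 / d" using d by (simp add: field_simps)
      then show "real m + 1 \<le> 5 / d" using m(2) by (simp add: field_simps)
    qed (use d in auto)
    also have "5 / d * (?\<omega> * (2 * d) ^ DIM('a)) = 5 * 2 ^ DIM('a) * ?\<omega> * d ^ (DIM('a) - 1)"
    proof -
      obtain N where "DIM('a) = Suc N" by (metis DIM_positive Suc_pred')
      then show ?thesis using d by (simp add: power_mult_distrib)
    qed
    finally show "emeasure lborel ?B \<le> ennreal (5 * 2 ^ DIM('a) * ?\<omega> * d ^ (DIM('a) - 1))" .
  qed auto
qed

text \<open>
  The cones over the sets of a cover of the sphere fill the unit ball, so the volume of the ball bounds the
  Hausdorff sum from below. Each diameter is enlarged slightly, with total cost \<open>\<eta>\<close>, which also admits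
  covering sets that are single points.
\<close>

lemma size_content_sphere_ge:
  "ennreal (1 / (10 * 2 ^ DIM('a))) \<le> size_content (DIM('a) - 1) 1 (sphere (0::'a::euclidean_space) 1)"
  unfolding size_content_def
proof (rule INF_greatest)
  let ?N = "DIM('a) - 1" and ?\<omega> = "unit_ball_vol (real DIM('a))"
  define K :: real where "K = 5 * 2 ^ DIM('a)"
  have K: "0 < K" by (simp add: K_def)
  \<comment> \<open>The volume comparison reads \<open>1 \<le> K (sum + \<eta>)\<close>; this \<open>\<eta>\<close> leaves half of the unit for the sum.\<close>
  define \<eta> where "\<eta> = 1 / (2 * K)"
  have \<eta>: "0 < \<eta>" using K by (simp add: \<eta>_def)
  fix U assume U: "U \<in> covers 1 (sphere (0::'a) 1)"
  have "\<exists>B. B \<in> sets borel \<and> (\<forall>t x. x \<in> U i \<longrightarrow> norm x = 1 \<longrightarrow> 0 \<le> t \<longrightarrow> t \<le> 1 \<longrightarrow> t *\<^sub>R x \<in> B) \<and>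
    emeasure lborel B \<le> ennreal (K * ?\<omega>) * (diam_power ?N (U i) + ennreal (\<eta> * (1 / 2) ^ Suc i))" for i
  proof (cases "U i = {}")
    case True
    then show ?thesis by (intro exI[of _ "{}"]) auto
  next
    case False
    have b: "bounded (U i)" "diameter (U i) \<le> 1" using U by (auto simp: covers_def)
    have d0: "0 \<le> diameter (U i)" by (rule diameter_ge_0[OF b(1)])
    have "((\<lambda>d. d ^ ?N) \<longlongrightarrow> diameter (U i) ^ ?N) (at_right (diameter (U i)))"
      by (intro tendsto_intros)
    then have "\<forall>\<^sub>F d in at_right (diameter (U i)). d ^ ?N < diameter (U i) ^ ?N + \<eta> * (1 / 2) ^ Suc i"
      by (rule order_tendstoD) (use \<eta> in simp)
    moreover have "\<forall>\<^sub>F d in at_right (diameter (U i)). d \<in> {diameter (U i)<..<2}"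
      using b(2) by (intro eventually_at_right_real) simp
    ultimately have "\<forall>\<^sub>F d in at_right (diameter (U i)). d ^ ?N < diameter (U i) ^ ?N + \<eta> * (1 / 2) ^ Suc i
        \<and> d \<in> {diameter (U i)<..<2}" by (rule eventually_conj)
    then obtain d where d: "d ^ ?N < diameter (U i) ^ ?N + \<eta> * (1 / 2) ^ Suc i" "diameter (U i) < d" "d < 2"
      using eventually_happens'[OF trivial_limit_at_right_real] by fastforce
    obtain B where B: "B \<in> sets borel" "\<And>t x. x \<in> U i \<Longrightarrow> norm x = 1 \<Longrightarrow> 0 \<le> t \<Longrightarrow> t \<le> 1 \<Longrightarrow> t *\<^sub>R x \<in> B"
      "emeasure lborel B \<le> ennreal (5 * 2 ^ DIM('a) * ?\<omega> * d ^ ?N)"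
      using cone_in_few_balls[OF b(1) d(2)] d d0 by auto
    have "5 * 2 ^ DIM('a) * ?\<omega> * d ^ ?N \<le> K * ?\<omega> * (diameter (U i) ^ ?N + \<eta> * (1 / 2) ^ Suc i)"
      unfolding K_def using d(1) by (intro mult_left_mono) auto
    then have "emeasure lborel B \<le> ennreal (K * ?\<omega> * (diameter (U i) ^ ?N + \<eta> * (1 / 2) ^ Suc i))"
      by (rule order_trans[OF B(3) ennreal_leI])
    also have "\<dots> = ennreal (K * ?\<omega>) * (diam_power ?N (U i) + ennreal (\<eta> * (1 / 2) ^ Suc i))"
      using False K \<eta> d0 by (simp add: diam_power_def ennreal_mult ennreal_plus)
    finally show ?thesis using B(1,2) by blast
  qed
  then have "\<forall>i. \<exists>B. B \<in> sets borel \<and> (\<forall>t x. x \<in> U i \<longrightarrow> norm x = 1 \<longrightarrow> 0 \<le> t \<longrightarrow> t \<le> 1 \<longrightarrow> t *\<^sub>R x \<in> B) \<and>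
    emeasure lborel B \<le> ennreal (K * ?\<omega>) * (diam_power ?N (U i) + ennreal (\<eta> * (1 / 2) ^ Suc i))" ..
  from choice[OF this] obtain B where B: "\<And>i. B i \<in> sets borel"
    "\<And>i t x. x \<in> U i \<Longrightarrow> norm x = 1 \<Longrightarrow> 0 \<le> t \<Longrightarrow> t \<le> 1 \<Longrightarrow> t *\<^sub>R x \<in> B i"
    "\<And>i. emeasure lborel (B i) \<le> ennreal (K * ?\<omega>) * (diam_power ?N (U i) + ennreal (\<eta> * (1 / 2) ^ Suc i))"
    by metis
  have "ball (0::'a) 1 \<subseteq> (\<Union>i. B i)"
  proof
    fix y :: 'a assume "y \<in> ball 0 1"
    then have y: "norm y < 1" by simp
    \<comment> \<open>The origin lies on the ray of every unit vector; any one of them serves.\<close>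
    define x where "x = (if y = 0 then SOME b. b \<in> Basis else y /\<^sub>R norm y)"
    have x: "norm x = 1" "y = norm y *\<^sub>R x"
      using someI_ex[of "\<lambda>b. b \<in> (Basis::'a set)"] by (auto simp: x_def)
    then obtain i where "x \<in> U i" using U by (force simp: covers_def)
    from B(2)[OF this x(1), of "norm y"] y x(2) show "y \<in> (\<Union>i. B i)" by auto
  qed
  then have "emeasure lborel (ball (0::'a) 1) \<le> emeasure lborel (\<Union>i. B i)"
    using B(1) by (intro emeasure_mono) auto
  also have "\<dots> \<le> (\<Sum>i. emeasure lborel (B i))"
    using B(1) by (intro emeasure_subadditive_countably) auto
  also have "\<dots> \<le> (\<Sum>i. ennreal (K * ?\<omega>) * (diam_power ?N (U i) + ennreal (\<eta> * (1 / 2) ^ Suc i)))"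
    by (intro suminf_le B(3)) auto
  also have "\<dots> = ennreal (K * ?\<omega>) * ((\<Sum>i. diam_power ?N (U i)) + (\<Sum>i. ennreal (\<eta> * (1 / 2) ^ Suc i)))"
    by (simp only: ennreal_suminf_cmult) (simp add: suminf_add)
  also have "(\<Sum>i. ennreal (\<eta> * (1 / 2) ^ Suc i)) = ennreal \<eta>"
    using sums_mult[OF power_half_series, of \<eta>] \<eta> by (intro suminf_ennreal_eq) auto
  finally have le: "ennreal ?\<omega> \<le> ennreal (K * ?\<omega>) * ((\<Sum>i. diam_power ?N (U i)) + ennreal \<eta>)"
    by (simp add: emeasure_ball)
  show "ennreal (1 / (10 * 2 ^ DIM('a))) \<le> (\<Sum>i. diam_power ?N (U i))"
  proof (cases "\<Sum>i. diam_power ?N (U i)")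
    case (real r)
    then have "ennreal ?\<omega> \<le> ennreal (K * ?\<omega> * (r + \<eta>))"
      using le K \<eta> by (simp add: ennreal_mult ennreal_plus)
    then have "?\<omega> \<le> K * ?\<omega> * (r + \<eta>)"
      using K \<eta> real by (subst (asm) ennreal_le_iff) auto
    then have "?\<omega> * 1 \<le> ?\<omega> * (K * (r + \<eta>))" by (simp add: mult_ac)
    then have "1 \<le> K * (r + \<eta>)" by (rule mult_left_le_imp_le) simp
    then have "1 / (2 * K) \<le> r" using K by (simp add: \<eta>_def field_simps)
    then show ?thesis unfolding real by (intro ennreal_leI) (simp add: K_def)
  qed simp
qed

lemma
  defines "S \<equiv> sphere (0::'a::euclidean_space) 1"
  shows hausdorff_measure_sphere_finite: "emeasure (hausdorff_measure (DIM('a) - 1)) S < \<infinity>"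
    and hausdorff_measure_sphere_pos: "0 < measure (hausdorff_measure (DIM('a) - 1)) S"
proof -
  let ?N = "DIM('a) - 1"
  let ?c = "unit_ball_vol (real ?N) / 2 ^ ?N"
  have S: "S \<in> sets borel" by (simp add: S_def)
  have eq: "emeasure (hausdorff_measure ?N) S = ennreal ?c * unnormalized_hausdorff ?N S"
    using S by (simp add: emeasure_hausdorff_measure hausdorff_outer_eq)
  have "unnormalized_hausdorff ?N S \<le> ennreal (2 ^ ?N * packing_bound TYPE('a))"
    unfolding unnormalized_hausdorff_def S_def by (intro SUP_least size_content_sphere_le) simp
  also have "\<dots> < \<infinity>" by simp
  finally show fin: "emeasure (hausdorff_measure ?N) S < \<infinity>"
    unfolding eq by (simp add: ennreal_mult_less_top)
  have "size_content ?N 1 S \<le> unnormalized_hausdorff ?N S"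
    unfolding unnormalized_hausdorff_def by (rule SUP_upper) simp
  with size_content_sphere_ge have "ennreal (1 / (10 * 2 ^ DIM('a))) \<le> unnormalized_hausdorff ?N S"
    unfolding S_def by (rule order_trans)
  then have "0 < unnormalized_hausdorff ?N S"
    by (rule less_le_trans[rotated]) simp
  then have "0 < emeasure (hausdorff_measure ?N) S"
    unfolding eq by (simp add: ennreal_zero_less_mult_iff)
  with fin show "0 < measure (hausdorff_measure ?N) S"
    by (simp add: measure_def enn2real_positive_iff)
qed

section \<open>Orthogonal invariance and the averaging constant\<close>

text \<open>
  Reflections are enough symmetry: they move any vector to any other of the same length, and they are their own inverses.
\<close>

definition orthogonal_involution :: "('a::euclidean_space \<Rightarrow> 'a) \<Rightarrow> bool" where
  "orthogonal_involution T \<longleftrightarrow> linear T \<and> (\<forall>x. T (T x) = x) \<and> (\<forall>x y. T x \<bullet> T y = x \<bullet> y)"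

text \<open>
  The reflection in the hyperplane orthogonal to \<open>a - b\<close>.
\<close>

lemma orthogonal_involution_exists:
  fixes a b :: "'a::euclidean_space"
  assumes "norm a = norm b"
  obtains T where "orthogonal_involution T" "T a = b"
proof (cases "a = b")
  case True
  have "orthogonal_involution (\<lambda>x::'a. x)" by (simp add: orthogonal_involution_def linear_id[unfolded id_def])
  then show ?thesis using that True by blast
next
  case False
  define d where "d = a - b"
  have d: "d \<bullet> d \<noteq> 0" using False by (simp add: d_def)
  define T where "T x = x - (2 * (x \<bullet> d) / (d \<bullet> d)) *\<^sub>R d" for x
  have "linear T"
    unfolding T_def by (rule linearI) (simp_all add: inner_add_left algebra_simps add_divide_distrib)
  moreover have Td: "T x \<bullet> d = - (x \<bullet> d)" for x
    using d by (simp add: T_def inner_diff_left)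
  then have "T (T x) = x" for x
    by (simp add: T_def[of "T x"]) (simp add: T_def)
  moreover have "T x \<bullet> T y = x \<bullet> y" for x y
  proof -
    have "T x \<bullet> T y = T x \<bullet> y - (2 * (y \<bullet> d) / (d \<bullet> d)) * (T x \<bullet> d)"
      by (simp add: T_def[of y] inner_diff_right)
    also have "\<dots> = x \<bullet> y - (2 * (x \<bullet> d) / (d \<bullet> d)) * (y \<bullet> d) + (2 * (y \<bullet> d) / (d \<bullet> d)) * (x \<bullet> d)"
      unfolding Td by (simp add: T_def[of x] inner_diff_left inner_commute[of d y])
    also have "\<dots> = x \<bullet> y" by simp
    finally show ?thesis .
  qed
  moreover have "T a = b"
  proof -
    have "a \<bullet> a = b \<bullet> b" using assms by (simp add: norm_eq_sqrt_inner)
    then have "2 * (a \<bullet> d) = d \<bullet> d"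
      by (simp add: d_def inner_diff_left inner_diff_right inner_commute)
    then have "2 * (a \<bullet> d) / (d \<bullet> d) = 1" using d by simp
    then show ?thesis unfolding T_def by (simp only:) (simp add: d_def)
  qed
  ultimately show ?thesis by (intro that[of T]) (simp_all add: orthogonal_involution_def)
qed

context
  fixes T :: "'a::euclidean_space \<Rightarrow> 'a"
  assumes T: "orthogonal_involution T"
begin

lemma orthogonal_involution_simps:
  "T (T x) = x" "T x \<bullet> T y = x \<bullet> y" "norm (T x) = norm x" "T (x + y) = T x + T y" "T (x - y) = T x - T y"
  using T by (auto simp: orthogonal_involution_def norm_eq_sqrt_inner linear_add linear_diff)

lemma orthogonal_involution_dist: "dist (T x) (T y) = dist x y"
  by (simp add: dist_norm orthogonal_involution_simps flip: orthogonal_involution_simps(5))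

lemma orthogonal_involution_measurable: "T \<in> borel_measurable borel"
  by (intro borel_measurable_continuous_onI) (auto simp: continuous_on_iff orthogonal_involution_dist)

lemma nn_integral_lborel_translate:
  fixes f :: "'a \<Rightarrow> ennreal"
  assumes "f \<in> borel_measurable borel"
  shows "(\<integral>\<^sup>+x. f (x + z) \<partial>lborel) = (\<integral>\<^sup>+x. f x \<partial>lborel)"
proof -
  have "(\<integral>\<^sup>+x. f x \<partial>distr lborel borel (\<lambda>x. x + z)) = (\<integral>\<^sup>+x. f (x + z) \<partial>lborel)"
    using assms by (intro nn_integral_distr) auto
  then show ?thesis by (simp add: distr_lborel_translate)
qed

text \<open>
  The image measure is again invariant under translations. Computing the double integral of
  \<open>indicator (ball 0 1) x * indicator B (T y)\<close> in two ways, with translations in each variable, shows that such a measure is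
  proportional to Lebesgue measure; \<open>T\<close> preserves the unit ball, so the factor is \<open>1\<close>.
\<close>

lemma distr_lborel_orthogonal_involution: "distr lborel borel T = lborel"
proof (rule measure_eqI)
  note [measurable] = orthogonal_involution_measurable
  fix B assume "B \<in> sets (distr lborel borel T)"
  then have B[measurable]: "B \<in> sets borel" by simp
  let ?b = "ball (0::'a) 1"
  have [measurable]: "?b \<in> sets borel" by simp
  have "emeasure lborel ?b * emeasure (distr lborel borel T) B =
      (\<integral>\<^sup>+x. \<integral>\<^sup>+y. indicator ?b x * indicator B (T y) \<partial>lborel \<partial>lborel)"
  proof -
    have "emeasure (distr lborel borel T) B = (\<integral>\<^sup>+y. indicator B y \<partial>distr lborel borel T)"
      by simp
    also have "\<dots> = (\<integral>\<^sup>+y. indicator B (T y) \<partial>lborel)"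
      by (intro nn_integral_distr) auto
    finally show ?thesis by (simp add: nn_integral_cmult) (subst nn_integral_multc; measurable; simp)
  qed
  also have "\<dots> = (\<integral>\<^sup>+x. \<integral>\<^sup>+y. indicator ?b x * indicator B (T y + x) \<partial>lborel \<partial>lborel)"
  proof (rule nn_integral_cong)
    fix x :: 'a
    have "(\<integral>\<^sup>+y. indicator ?b x * indicator B (T (y + T x)) \<partial>lborel) =
        (\<integral>\<^sup>+y. (indicator ?b x * indicator B (T y) :: ennreal) \<partial>lborel)"
      by (rule nn_integral_lborel_translate) measurable
    then show "(\<integral>\<^sup>+y. indicator ?b x * indicator B (T y) \<partial>lborel) =
        (\<integral>\<^sup>+y. (indicator ?b x * indicator B (T y + x) :: ennreal) \<partial>lborel)"
      by (simp add: orthogonal_involution_simps)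
  qed
  also have "\<dots> = (\<integral>\<^sup>+y. \<integral>\<^sup>+x. indicator ?b x * indicator B (T y + x) \<partial>lborel \<partial>lborel)"
    by (rule lborel_pair.Fubini') measurable
  also have "\<dots> = (\<integral>\<^sup>+y. \<integral>\<^sup>+x. indicator ?b (x - T y) * indicator B x \<partial>lborel \<partial>lborel)"
  proof (rule nn_integral_cong)
    fix y :: 'a
    have "(\<integral>\<^sup>+x. indicator ?b (x + T y - T y) * indicator B (x + T y) \<partial>lborel) =
        (\<integral>\<^sup>+x. (indicator ?b (x - T y) * indicator B x :: ennreal) \<partial>lborel)"
      by (rule nn_integral_lborel_translate[of "\<lambda>x. indicator ?b (x - T y) * indicator B x"]) measurable
    then show "(\<integral>\<^sup>+x. indicator ?b x * indicator B (T y + x) \<partial>lborel) =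
        (\<integral>\<^sup>+x. (indicator ?b (x - T y) * indicator B x :: ennreal) \<partial>lborel)"
      by (simp add: add.commute)
  qed
  also have "\<dots> = (\<integral>\<^sup>+x. \<integral>\<^sup>+y. indicator ?b (x - T y) * indicator B x \<partial>lborel \<partial>lborel)"
    by (rule lborel_pair.Fubini') measurable
  also have "\<dots> = (\<integral>\<^sup>+x. emeasure lborel ?b * indicator B x \<partial>lborel)"
  proof (rule nn_integral_cong)
    fix x :: 'a
    have "norm (T y - x) = norm (T x - y)" for y
      using orthogonal_involution_simps(3)[of "T y - x"]
      by (simp add: orthogonal_involution_simps norm_minus_commute)
    then have "(\<lambda>y. indicator ?b (x - T y)) = (indicator (ball (T x) 1) :: 'a \<Rightarrow> ennreal)"
      by (intro ext) (simp add: indicator_def dist_norm)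
    then have "(\<integral>\<^sup>+y. indicator ?b (x - T y) \<partial>lborel) = emeasure lborel (ball (T x) 1)"
      by (simp only: nn_integral_indicator sets_lborel borel_open open_ball)
    then show "(\<integral>\<^sup>+y. indicator ?b (x - T y) * indicator B x \<partial>lborel) = emeasure lborel ?b * indicator B x"
      by (simp add: nn_integral_multc emeasure_ball)
  qed
  also have "\<dots> = emeasure lborel ?b * emeasure lborel B"
    by (simp add: nn_integral_cmult)
  finally have "emeasure lborel ?b * emeasure (distr lborel borel T) B = emeasure lborel ?b * emeasure lborel B" .
  moreover have "emeasure lborel ?b \<noteq> 0" "emeasure lborel ?b \<noteq> \<infinity>"
    by (simp_all add: emeasure_ball ennreal_eq_0_iff not_le)
  ultimately show "emeasure (distr lborel borel T) B = emeasure lborel B"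
    by (auto simp: ennreal_mult_cancel_left)
qed simp

end

lemma C1_orthogonal_involution:
  fixes T :: "'a::euclidean_space \<Rightarrow> 'a"
  assumes T: "orthogonal_involution T"
  shows "C1 (T e) = C1 e"
proof -
  note [measurable] = orthogonal_involution_measurable[OF T]
  note [simp] = orthogonal_involution_simps[OF T]
  let ?M = "hausdorff_measure (DIM('a) - 1) :: 'a measure"
  have [measurable]: "sphere (0::'a) 1 \<in> sets borel" by simp
  have "(LINT v|distr ?M borel T. indicator (sphere 0 1) v *\<^sub>R \<bar>T e \<bullet> v\<bar>) =
      (LINT v|?M. indicator (sphere 0 1) (T v) *\<^sub>R \<bar>T e \<bullet> T v\<bar>)"
    by (intro integral_distr) measurable
  also have "distr ?M borel T = ?M"
    by (intro distr_hausdorff_measure_isometry orthogonal_involution_dist[OF T]) simp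
  also have "(LINT v|?M. indicator (sphere 0 1) (T v) *\<^sub>R \<bar>T e \<bullet> T v\<bar>) = (LINT v|?M. indicator (sphere 0 1) v *\<^sub>R \<bar>e \<bullet> v\<bar>)"
    by (intro Bochner_Integration.integral_cong refl) (auto split: split_indicator)
  finally show ?thesis by (simp add: C1_def set_lebesgue_integral_def)
qed

lemma C1_unit:
  fixes v e :: "'a::euclidean_space"
  assumes "norm v = 1" "norm e = 1"
  shows "C1 v = C1 e"
  using orthogonal_involution_exists[of e v] C1_orthogonal_involution assms by metis

text \<open>
  By invariance the left side is \<open>|w|\<close> times its value \<open>A\<close> at a unit vector. Integrating \<open>A\<close> over the unit sphere gives
  \<open>A\<close> times the measure of the sphere; after Fubini the inner integral over the sphere is the constant \<^const>\<open>C1\<close> for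
  every \<open>h \<noteq> 0\<close>.
\<close>

lemma integral_abs_inner_radial:
  fixes r :: "'a::euclidean_space \<Rightarrow> real" and e w :: 'a
  assumes r: "integrable lborel r" and radial: "\<And>T. orthogonal_involution T \<Longrightarrow> AE h in lborel. r (T h) = r h"
    and e: "norm e = 1"
  shows "(LINT h|lborel. \<bar>w \<bullet> h\<bar> / norm h * r h) = K1 e * norm w * (LINT h|lborel. r h)"
proof -
  define A where "A w = (LINT h|lborel. \<bar>w \<bullet> h\<bar> / norm h * r h)" for w
  have [measurable]: "r \<in> borel_measurable borel" using r by auto
  have A_T: "A (T w) = A w" if T: "orthogonal_involution T" for T w
  proof -
    note [measurable] = orthogonal_involution_measurable[OF T]
    note [simp] = orthogonal_involution_simps[OF T]
    have "A (T w) = (LINT h|distr lborel borel T. \<bar>T w \<bullet> h\<bar> / norm h * r h)"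
      by (simp add: A_def distr_lborel_orthogonal_involution[OF T])
    also have "\<dots> = (LINT h|lborel. \<bar>T w \<bullet> T h\<bar> / norm (T h) * r (T h))"
      by (intro integral_distr) measurable
    also have "\<dots> = A w"
      unfolding A_def using radial[OF T]
      by (intro integral_cong_AE) (auto elim!: eventually_mono)
    finally show ?thesis .
  qed
  have A_unit: "A v = A e" if "norm v = 1" for v
    using orthogonal_involution_exists[of e v] A_T that e by metis
  have A_scale: "A w = norm w * A e"
  proof (cases "w = 0")
    case False
    have "A w = (LINT h|lborel. norm w * (\<bar>(w /\<^sub>R norm w) \<bullet> h\<bar> / norm h * r h))"
      unfolding A_def using False
      by (intro Bochner_Integration.integral_cong refl) (simp add: abs_mult)
    also have "\<dots> = norm w * A (w /\<^sub>R norm w)" unfolding A_def by (rule integral_mult_right_zero)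
    finally show ?thesis using A_unit[of "w /\<^sub>R norm w"] False by simp
  qed (simp add: A_def)
  let ?M = "hausdorff_measure (DIM('a) - 1) :: 'a measure" and ?S = "sphere (0::'a) 1"
  have [measurable]: "?S \<in> sets borel" by simp
  define MS where "MS = density ?M (\<lambda>v. ennreal (indicator ?S v))"
  have [simp, measurable_cong]: "sets MS = sets borel" by (simp add: MS_def)
  have MS_int: "(LINT v|MS. f v) = (LINT v:?S|?M. f v)" if "f \<in> borel_measurable borel" for f :: "'a \<Rightarrow> real"
    
  proof -
    have [measurable]: "f \<in> borel_measurable ?M" "indicator ?S \<in> borel_measurable ?M"
      using that by (auto intro!: borel_measurable_indicator)
    show ?thesis
      unfolding MS_def set_lebesgue_integral_def by (rule integral_density) auto
  qed
  have "emeasure MS UNIV = (\<integral>\<^sup>+v. indicator ?S v \<partial>?M)"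
  proof -
    have "(\<lambda>v. ennreal (indicator ?S v)) = indicator ?S" by (auto split: split_indicator)
    then show ?thesis
      unfolding MS_def by (simp only:, subst emeasure_density) (auto intro!: borel_measurable_indicator)
  qed
  also have "\<dots> < \<infinity>" using hausdorff_measure_sphere_finite[where 'a = 'a] by simp
  finally have MS_fin: "finite_measure MS"
    by (intro finite_measureI) (simp add: MS_def)
  interpret MS: finite_measure MS by (rule MS_fin)
  interpret P: pair_sigma_finite lborel MS ..
  define G where "G z = indicator ?S (snd z) * (\<bar>snd z \<bullet> fst z\<bar> / norm (fst z))" for z :: "'a \<times> 'a"
  have [measurable]: "G \<in> borel_measurable (lborel \<Otimes>\<^sub>M MS)" unfolding G_def by measurable
  have G_le: "\<bar>G z\<bar> \<le> 1" for z
    using Cauchy_Schwarz_ineq2[of "snd z" "fst z"] by (auto simp: G_def divide_le_eq split: split_indicator)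
  have int: "integrable (lborel \<Otimes>\<^sub>M MS) (\<lambda>(h, v). r h * G (h, v))"
    using integrable_pair_bounded_mult[OF sigma_finite_lborel MS_fin r, of G 1] G_le
    by (simp add: case_prod_unfold)
  have "(LINT v|MS. LINT h|lborel. r h * G (h, v)) = (LINT h|lborel. LINT v|MS. r h * G (h, v))"
    by (rule P.Fubini_integral[OF int])
  moreover have "(LINT v|MS. LINT h|lborel. r h * G (h, v)) = A e * measure ?M ?S"
  proof -
    have "(LINT v|MS. LINT h|lborel. r h * G (h, v)) = (LINT v:?S|?M. (LINT h|lborel. r h * G (h, v)))"
      by (rule MS_int) measurable
    also have "\<dots> = (LINT v|?M. A e * indicator ?S v)"
      unfolding set_lebesgue_integral_def
    proof (intro Bochner_Integration.integral_cong refl)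
      fix v
      show "indicator ?S v *\<^sub>R (LINT h|lborel. r h * G (h, v)) = A e * indicator ?S v"
        using A_unit[of v] by (auto simp: G_def A_def mult.commute split: split_indicator)
    qed
    also have "\<dots> = A e * measure ?M ?S" by simp
    finally show ?thesis .
  qed
  moreover have "(LINT h|lborel. LINT v|MS. r h * G (h, v)) = C1 e * (LINT h|lborel. r h)"
  proof -
    have inner: "(LINT v|MS. G (h, v)) = C1 e" if "h \<noteq> 0" for h
    proof -
      have "(LINT v|MS. G (h, v)) = (LINT v:?S|?M. G (h, v))" by (rule MS_int) (simp add: G_def)
      also have "\<dots> = C1 (h /\<^sub>R norm h)"
        unfolding C1_def set_lebesgue_integral_def
        by (intro Bochner_Integration.integral_cong refl)
          (auto simp: G_def inner_commute divide_inverse abs_mult mult.commute split: split_indicator)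
      also have "\<dots> = C1 e" using that e by (intro C1_unit) auto
      finally show ?thesis .
    qed
    have "(LINT h|lborel. LINT v|MS. r h * G (h, v)) = (LINT h|lborel. C1 e * r h)"
    proof (rule integral_cong_AE)
      show "AE h in lborel. (LINT v|MS. r h * G (h, v)) = C1 e * r h"
        using AE_lborel_singleton[of "0::'a"] by eventually_elim (simp add: inner)
    qed measurable
    then show ?thesis by simp
  qed
  ultimately have "A e * measure ?M ?S = C1 e * (LINT h|lborel. r h)" by simp
  then have "A e = K1 e * (LINT h|lborel. r h)"
    using hausdorff_measure_sphere_pos[where 'a = 'a] by (simp add: K1_def field_simps)
  then show ?thesis using A_scale by (simp add: A_def)
qed

section \<open>The gradient measure of a function of bounded variation\<close>

text \<open>
  \<open>u\<close> and the kernels are only Lebesgue measurable, while product measures need Borel measurability. All exchanges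
  of integrals are therefore carried out for Borel representatives.
\<close>

lemma lebesgue_integral_cong_lborel:
  fixes f g :: "'a::euclidean_space \<Rightarrow> real"
  assumes g: "g \<in> borel_measurable borel" and eq: "AE x in lborel. f x = g x"
  shows "(LINT x|lebesgue. f x) = (LINT x|lborel. g x)"
    and "integrable lebesgue f \<longleftrightarrow> integrable lborel g"
proof -
  have g': "g \<in> borel_measurable lebesgue" using g by (simp add: measurable_completion)
  have eq': "AE x in lebesgue. f x = g x" using eq by (rule AE_completion)
  have f': "f \<in> borel_measurable lebesgue"
    by (rule borel_measurable_AE[OF g']) (use eq' in \<open>auto elim!: eventually_mono\<close>)
  have "(LINT x|lebesgue. f x) = (LINT x|lebesgue. g x)"
    using f' g' eq' by (rule integral_cong_AE)
  also have "\<dots> = (LINT x|lborel. g x)" using g by (intro integral_completion) simp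
  finally show "(LINT x|lebesgue. f x) = (LINT x|lborel. g x)" .
  have "integrable lebesgue f \<longleftrightarrow> integrable lebesgue g"
    using f' g' eq' by (rule integrable_cong_AE)
  also have "\<dots> \<longleftrightarrow> integrable lborel g" using g by (intro integrable_completion) simp
  finally show "integrable lebesgue f \<longleftrightarrow> integrable lborel g" .
qed

lemma integrable_lebesgue_borel_representative:
  fixes f :: "'a::euclidean_space \<Rightarrow> real"
  assumes "integrable lebesgue f"
  obtains g where "integrable lborel g" "AE x in lborel. f x = g x"
proof -
  have "f \<in> borel_measurable lebesgue" using assms by auto
  then obtain g where g: "g \<in> borel_measurable lborel" "AE x in lborel. f x = g x"
    using completion_ex_borel_measurable_real by blast
  then show ?thesis
    using lebesgue_integral_cong_lborel(2)[of g f] assms by (intro that[of g]) auto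
qed

lemma test_function_bounded_borel:
  assumes "test_function \<psi>"
  shows "bounded_borel \<psi>"
    and "b \<in> Basis \<Longrightarrow> bounded_borel (\<lambda>x. frechet_derivative \<psi> (at x) b)"
proof -
  have "continuous_on UNIV \<psi>" using assms Ck_continuous unfolding test_function_def by blast
  then show "bounded_borel \<psi>"
    using test_function_bounded(1)[OF assms] by (auto simp: bounded_borel_def intro: borel_measurable_continuous_onI)
  show "bounded_borel (\<lambda>x. frechet_derivative \<psi> (at x) b)" if "b \<in> Basis"
    using test_function_bounded(2)[OF assms that] test_function_partial_continuous[OF assms that]
    by (auto simp: bounded_borel_def intro: borel_measurable_continuous_onI)
qed

text \<open>
  The weak formulation is stated through the Jordan parts of the components of \<open>Du\<close>. It is rewritten with the polar
  density of \<open>Du\<close>, and then split by comparing indicators, where it is the definition of the singular part.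
\<close>

lemma BV_gradient_decomposition:
  fixes u :: "'a::euclidean_space \<Rightarrow> real"
  assumes "u \<in> BV"
  obtains u' s where "AE x in lborel. u x = u' x"
    "gradient_decomposition u' (BV_grad u) s (variation (singular_deriv u))"
    "AE x in variation (singular_deriv u). norm (s x) = 1"
proof -
  define \<mu> where "\<mu> = distr_deriv u"
  have "integrable lebesgue u" and ex: "\<exists>\<mu>. is_distributional_derivative u \<mu> \<and> emeasure (variation \<mu>) UNIV < \<infinity>"
    using assms by (auto simp: BV_def)
  obtain u' where u': "integrable lborel u'" "AE x in lborel. u x = u' x"
    using integrable_lebesgue_borel_representative[OF \<open>integrable lebesgue u\<close>] by blast
  have D: "is_distributional_derivative u \<mu>" and fin: "emeasure (variation \<mu>) UNIV < \<infinity>"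
    using someI_ex[OF ex] by (simp_all add: \<mu>_def distr_deriv_def)
  then have \<mu>: "vector_measure \<mu>" by (simp add: is_distributional_derivative_def)
  let ?V = "variation \<mu>" and ?W = "variation (singular_deriv u)"
  have sing: "singular_deriv u = singular_part \<mu>" by (simp add: singular_deriv_def \<mu>_def)
  have grad: "BV_grad u = ac_density \<mu>" by (simp add: BV_grad_def \<mu>_def)
  have g: "integrable lborel (BV_grad u)" unfolding grad by (rule integrable_ac_density[OF \<mu> fin])
  have \<nu>: "vector_measure (singular_deriv u)" and \<nu>_fin: "emeasure ?W UNIV < \<infinity>"
    unfolding sing using vector_measure_singular_part[OF \<mu> fin] finite_variation_singular_part[OF \<mu> fin] by auto
  obtain \<sigma> where \<sigma>[measurable]: "\<sigma> \<in> borel_measurable borel" and \<sigma>_le: "\<And>x. norm (\<sigma> x) \<le> 1"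
    and \<mu>_eq: "\<And>A. A \<in> sets borel \<Longrightarrow> \<mu> A = (LINT x:A|?V. \<sigma> x)"
    using polar_decomposition[OF \<mu> fin] by metis
  obtain s where s[measurable]: "s \<in> borel_measurable borel" and s_le: "\<And>x. norm (s x) \<le> 1"
    and s_1: "AE x in ?W. norm (s x) = 1"
    and \<nu>_eq: "\<And>A. A \<in> sets borel \<Longrightarrow> singular_deriv u A = (LINT x:A|?W. s x)"
    using polar_decomposition[OF \<nu> \<nu>_fin] by metis
  note [simp, measurable_cong] = sets_variation[OF \<mu>] sets_variation[OF \<nu>]
  note [simp] = space_variation[OF \<mu>] space_variation[OF \<nu>]
  interpret V: finite_measure ?V using fin by (intro finite_measureI) auto
  interpret W: finite_measure ?W using \<nu>_fin by (intro finite_measureI) auto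
  have \<sigma>_int: "integrable ?V \<sigma>" by (rule V.integrable_const_bound[of _ 1]) (auto simp: \<sigma>_le)
  have s_int: "integrable ?W s" by (rule W.integrable_const_bound[of _ 1]) (auto simp: s_le)
  have inner_set_integral: "(LINT x:A|M. f x) \<bullet> b = (LINT x|M. indicator A x * (f x \<bullet> b))"
    if "A \<in> sets M" "integrable M f" for A b and f :: "'a \<Rightarrow> 'a" and M
    unfolding set_lebesgue_integral_def
    using integrable_mult_indicator[OF that] by (subst integral_inner_left[symmetric]) auto
  have split: "(LINT x|?V. \<psi> x * (\<sigma> x \<bullet> b)) = (LINT x|lborel. \<psi> x * (BV_grad u x \<bullet> b)) + (LINT x|?W. \<psi> x * (s x \<bullet> b))"
    if "bounded_borel \<psi>" for \<psi> b
  proof -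
    let ?T = "\<lambda>\<psi>. (LINT x|?V. \<psi> x * (\<sigma> x \<bullet> b)) + (- 1) * (LINT x|lborel. \<psi> x * (BV_grad u x \<bullet> b))
      + (- 1) * (LINT x|?W. \<psi> x * (s x \<bullet> b))"
    have "dominated_functional ?T"
      by (intro dominated_functional_add_mult dominated_functional_integral integrable_inner_left \<sigma>_int s_int g) simp_all
    then have "?T \<psi> = 0"
    proof (rule dominated_functional_eq_0_if_indicator[OF _ _ that])
      fix A :: "'a set" assume A: "A \<in> sets borel"
      have "singular_deriv u A = \<mu> A - (LINT x:A|lborel. BV_grad u x)"
        by (simp add: sing singular_part_def grad)
      then show "?T (indicator A) = 0"
        using inner_set_integral[of A ?V \<sigma> b] inner_set_integral[of A ?W s b] inner_set_integral[of A lborel "BV_grad u" b]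
          A \<sigma>_int s_int g by (simp add: \<mu>_eq[symmetric] \<nu>_eq[symmetric] inner_diff_left)
    qed
    then show ?thesis by simp
  qed
  have "gradient_decomposition u' (BV_grad u) s ?W"
  proof
    fix \<psi> :: "'a \<Rightarrow> real" and b :: 'a assume test: "test_function \<psi>" and b: "b \<in> Basis"
    note bb = test_function_bounded_borel[OF test]
    obtain C where \<psi>: "\<psi> \<in> borel_measurable borel" "\<And>x. \<bar>\<psi> x\<bar> \<le> C"
      using bb(1) by (auto simp: bounded_borel_def)
    have [measurable]: "(\<lambda>x. frechet_derivative \<psi> (at x) b) \<in> borel_measurable borel" "u' \<in> borel_measurable borel"
      using bb(2)[OF b] u'(1) by (auto simp: bounded_borel_def)
    have "(LINT x|lborel. u' x * frechet_derivative \<psi> (at x) b) = (LINT x|lebesgue. u x * frechet_derivative \<psi> (at x) b)"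
      using u'(2) by (intro lebesgue_integral_cong_lborel(1)[symmetric]) (auto elim!: eventually_mono)
    also have "\<dots> = - signed_integral (\<lambda>A. \<mu> A \<bullet> b) \<psi>"
      using D test b unfolding is_distributional_derivative_def by blast
    also have "signed_integral (\<lambda>A. \<mu> A \<bullet> b) \<psi> = (LINT x|?V. \<psi> x * (\<sigma> x \<bullet> b))"
    proof (rule signed_integral_density[OF _ _ _ \<psi>])
      show "\<mu> A \<bullet> b = (LINT x:A|?V. \<sigma> x \<bullet> b)" if "A \<in> sets borel" for A
        using inner_set_integral[of A ?V \<sigma> b] that \<sigma>_int by (simp add: \<mu>_eq set_lebesgue_integral_def)
    qed (use \<sigma>_int in auto)
    finally show "(LINT x|lborel. u' x * frechet_derivative \<psi> (at x) b) =
        - ((LINT x|lborel. \<psi> x * (BV_grad u x \<bullet> b)) + (LINT x|?W. \<psi> x * (s x \<bullet> b)))"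
      by (simp add: split[OF bb(1)])
  qed (use u' g s s_le W.finite_measure_axioms in auto)
  with u'(2) s_1 show ?thesis using that by blast
qed

section \<open>Concentration of the kernels\<close>

text \<open>
  The sets \<open>|h| < 2\<close> and \<open>|h| > 1\<close> overlap and cover the space, so the total mass is squeezed to \<open>1\<close>. For the second
  statement \<open>D\<close> is small near the origin and bounded elsewhere.
\<close>

lemma concentrating_kernel:
  fixes r :: "real \<Rightarrow> 'a::euclidean_space \<Rightarrow> real"
  assumes r: "\<And>\<epsilon>. \<epsilon> > 0 \<Longrightarrow> integrable lborel (r \<epsilon>)" "\<And>\<epsilon> h. \<epsilon> > 0 \<Longrightarrow> 0 \<le> r \<epsilon> h"
    and inside: "\<And>\<delta>. \<delta> > 0 \<Longrightarrow> ((\<lambda>\<epsilon>. LINT h:{h. norm h < \<delta>}|lborel. r \<epsilon> h) \<longlongrightarrow> 1) (at_right 0)"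
    and outside: "\<And>\<delta>. \<delta> > 0 \<Longrightarrow> ((\<lambda>\<epsilon>. LINT h:{h. norm h > \<delta>}|lborel. r \<epsilon> h) \<longlongrightarrow> 0) (at_right 0)"
  shows "((\<lambda>\<epsilon>. LINT h|lborel. r \<epsilon> h) \<longlongrightarrow> 1) (at_right 0)"
    and "D \<in> borel_measurable borel \<Longrightarrow> (\<And>h. \<bar>D h\<bar> \<le> B) \<Longrightarrow> (D \<longlongrightarrow> 0) (at 0) \<Longrightarrow> D 0 = 0 \<Longrightarrow>
      ((\<lambda>\<epsilon>. LINT h|lborel. r \<epsilon> h * D h) \<longlongrightarrow> 0) (at_right 0)"
proof -
  have pos: "\<forall>\<^sub>F \<epsilon> in at_right 0. (0::real) < \<epsilon>" by (rule eventually_at_right_less)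
  have [measurable]: "{h::'a. norm h < \<delta>} \<in> sets borel" "{h::'a. \<delta> < norm h} \<in> sets borel" for \<delta>
    by measurable
  have int_in: "integrable lborel (\<lambda>h. indicator {h. norm h < \<delta>} h *\<^sub>R r \<epsilon> h)"
    and int_out: "integrable lborel (\<lambda>h. indicator {h. \<delta> < norm h} h *\<^sub>R r \<epsilon> h)" if "\<epsilon> > 0" for \<delta> \<epsilon>
    using r(1)[OF that] by (intro integrable_mult_indicator; simp)+
  show mass: "((\<lambda>\<epsilon>. LINT h|lborel. r \<epsilon> h) \<longlongrightarrow> 1) (at_right 0)"
  proof (rule tendsto_sandwich)
    show "\<forall>\<^sub>F \<epsilon> in at_right 0. (LINT h:{h. norm h < 2}|lborel. r \<epsilon> h) \<le> (LINT h|lborel. r \<epsilon> h)"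
      using pos
    proof eventually_elim
      case (elim \<epsilon>)
      show ?case
        unfolding set_lebesgue_integral_def using r(2)[OF elim] int_in[OF elim] r(1)[OF elim]
        by (intro integral_mono) (auto split: split_indicator)
    qed
    show "\<forall>\<^sub>F \<epsilon> in at_right 0. (LINT h|lborel. r \<epsilon> h) \<le>
        (LINT h:{h. norm h < 2}|lborel. r \<epsilon> h) + (LINT h:{h. norm h > 1}|lborel. r \<epsilon> h)"
      using pos
    proof eventually_elim
      case (elim \<epsilon>)
      have "(LINT h|lborel. r \<epsilon> h) \<le> (LINT h|lborel. indicator {h. norm h < 2} h *\<^sub>R r \<epsilon> h + indicator {h. 1 < norm h} h *\<^sub>R r \<epsilon> h)"
        using r(2)[OF elim] int_in[OF elim] int_out[OF elim] r(1)[OF elim]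
        by (intro integral_mono Bochner_Integration.integrable_add) (auto split: split_indicator)
      then show ?case
        unfolding set_lebesgue_integral_def using int_in[OF elim] int_out[OF elim] by simp
    qed
    show "((\<lambda>\<epsilon>. LINT h:{h. norm h < 2}|lborel. r \<epsilon> h) \<longlongrightarrow> 1) (at_right 0)" by (rule inside) simp
    have "((\<lambda>\<epsilon>. (LINT h:{h. norm h < 2}|lborel. r \<epsilon> h) + (LINT h:{h. norm h > 1}|lborel. r \<epsilon> h)) \<longlongrightarrow> 1 + 0) (at_right 0)"
      by (intro tendsto_add inside outside) auto
    then show "((\<lambda>\<epsilon>. (LINT h:{h. norm h < 2}|lborel. r \<epsilon> h) + (LINT h:{h. norm h > 1}|lborel. r \<epsilon> h)) \<longlongrightarrow> 1) (at_right 0)"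
      by simp
  qed
  assume D[measurable]: "D \<in> borel_measurable borel" and B: "\<And>h. \<bar>D h\<bar> \<le> B"
    and D0: "(D \<longlongrightarrow> 0) (at 0)" "D 0 = 0"
  have B0: "0 \<le> B" using order_trans[OF abs_ge_zero B] .
  show "((\<lambda>\<epsilon>. LINT h|lborel. r \<epsilon> h * D h) \<longlongrightarrow> 0) (at_right 0)"
  proof (rule tendstoI)
    fix e :: real assume e: "0 < e"
    have "\<forall>\<^sub>F h in at 0. dist (D h) 0 < e / 4" using D0(1) by (rule tendstoD) (use e in simp)
    then obtain d where d: "0 < d" "\<And>h. h \<noteq> 0 \<Longrightarrow> norm h < d \<Longrightarrow> \<bar>D h\<bar> < e / 4"
      by (auto simp: eventually_at dist_real_def)
    have bound: "r \<epsilon> h * \<bar>D h\<bar> \<le> e / 4 * r \<epsilon> h + B * (indicator {h. d / 2 < norm h} h *\<^sub>R r \<epsilon> h)" if "\<epsilon> > 0" for \<epsilon> h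
    proof (cases "norm h < d")
      case True
      then have "\<bar>D h\<bar> \<le> e / 4" using d(2)[of h] D0(2) e by (cases "h = 0") auto
      then have "r \<epsilon> h * \<bar>D h\<bar> \<le> r \<epsilon> h * (e / 4)" by (intro mult_left_mono r(2) that)
      moreover have "0 \<le> B * (indicator {h. d / 2 < norm h} h *\<^sub>R r \<epsilon> h)"
        using B0 r(2)[OF that] by (auto split: split_indicator)
      ultimately show ?thesis by (simp add: mult.commute)
    next
      case False
      then have "indicator {h. d / 2 < norm h} h = (1::real)" using d(1) by (auto split: split_indicator)
      moreover have "r \<epsilon> h * \<bar>D h\<bar> \<le> r \<epsilon> h * B" by (intro mult_left_mono r(2) B that)
      moreover have "0 \<le> e / 4 * r \<epsilon> h" using e r(2)[OF that] by simp
      ultimately show ?thesis by (simp add: mult.commute)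
    qed
    have ev1: "\<forall>\<^sub>F \<epsilon> in at_right 0. (LINT h|lborel. r \<epsilon> h) < 2"
      using mass by (rule order_tendstoD) simp
    have "((\<lambda>\<epsilon>. B * (LINT h:{h. norm h > d / 2}|lborel. r \<epsilon> h)) \<longlongrightarrow> B * 0) (at_right 0)"
      by (intro tendsto_mult tendsto_const outside) (use d(1) in simp)
    then have ev2: "\<forall>\<^sub>F \<epsilon> in at_right 0. B * (LINT h:{h. norm h > d / 2}|lborel. r \<epsilon> h) < e / 4"
      by (rule order_tendstoD) (use e in simp)
    from pos ev1 ev2 show "\<forall>\<^sub>F \<epsilon> in at_right 0. dist (LINT h|lborel. r \<epsilon> h * D h) 0 < e"
    proof eventually_elim
      case (elim \<epsilon>)
      have [measurable]: "r \<epsilon> \<in> borel_measurable borel" using r(1)[OF elim(1)] by auto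
      have "bounded_borel D" using B by (intro bounded_borelI) auto
      from integrable_bounded_borel_mult[OF this r(1)[OF elim(1)], of "\<lambda>x. x"]
      have int: "integrable lborel (\<lambda>h. r \<epsilon> h * D h)" by (simp add: mult.commute)
      have "\<bar>LINT h|lborel. r \<epsilon> h * D h\<bar> \<le> (LINT h|lborel. \<bar>r \<epsilon> h * D h\<bar>)" by (rule integral_abs_bound)
      also have "\<dots> \<le> (LINT h|lborel. e / 4 * r \<epsilon> h + B * (indicator {h. d / 2 < norm h} h *\<^sub>R r \<epsilon> h))"
      proof (rule integral_mono)
        show "integrable lborel (\<lambda>h. \<bar>r \<epsilon> h * D h\<bar>)" by (rule integrable_abs[OF int])
        show "integrable lborel (\<lambda>h. e / 4 * r \<epsilon> h + B * (indicator {h. d / 2 < norm h} h *\<^sub>R r \<epsilon> h))"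
          by (intro Bochner_Integration.integrable_add integrable_mult_right r(1) int_out elim(1))
        show "\<bar>r \<epsilon> h * D h\<bar> \<le> e / 4 * r \<epsilon> h + B * (indicator {h. d / 2 < norm h} h *\<^sub>R r \<epsilon> h)" for h
          using bound[OF elim(1), of h] r(2)[OF elim(1), of h] by (simp add: abs_mult)
      qed
      also have "\<dots> = e / 4 * (LINT h|lborel. r \<epsilon> h) + B * (LINT h:{h. norm h > d / 2}|lborel. r \<epsilon> h)"
        unfolding set_lebesgue_integral_def
        by (subst Bochner_Integration.integral_add[OF integrable_mult_right[OF r(1)[OF elim(1)]] integrable_mult_right[OF int_out[OF elim(1)]]])
          (simp only: integral_mult_right_zero)
      also have "\<dots> < e / 4 * 2 + e / 4"
        using elim e by (intro add_strict_mono mult_strict_left_mono) auto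
      also have "\<dots> < e" using e by simp
      finally show ?case by (simp add: dist_real_def)
    qed
  qed
qed

section \<open>Passage to the limit\<close>

lemma AE_lborel_translate:
  fixes x :: "'a::euclidean_space"
  assumes "AE y in lborel. P y"
  shows "AE h in lborel. P (x + h)"
proof (rule AE_distrD[where M' = borel and f = "(+) x" and P = P])
  show "AE y in distr lborel borel ((+) x). P y" unfolding lborel_distr_plus by (rule assms)
qed simp

text \<open>
  Fubini in \<open>x\<close> and \<open>h\<close>; joint integrability comes from the bound on the quotient mean of \<open>|\<phi>|\<close>, which is uniform in \<open>h\<close>.
\<close>

lemma integral_R1:
  fixes u u' \<phi> \<rho> r :: "'a::euclidean_space \<Rightarrow> real"
  assumes gd: "gradient_decomposition u' (BV_grad u) s W" and u: "AE x in lborel. u x = u' x"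
    and r: "integrable lborel r" "AE h in lborel. \<rho> h = r h"
    and \<phi>: "\<phi> \<in> borel_measurable borel" "\<And>x. \<bar>\<phi> x\<bar> \<le> C"
  shows "(LINT x|lebesgue. R1 \<rho> u x * \<phi> x) =
    (LINT h|lborel. r h * gradient_decomposition.quotient_mean u' (BV_grad u) \<phi> h)"
proof -
  interpret G: gradient_decomposition u' "BV_grad u" s W by (rule gd)
  note [measurable] = G.measurable_uges \<phi>(1)
  have [measurable]: "r \<in> borel_measurable borel" using r by auto
  let ?q = "\<lambda>h x. \<bar>G.remainder h x\<bar> / norm h"
  have [measurable]: "(\<lambda>x. G.remainder (f x) (g x)) \<in> borel_measurable M"
    if "f \<in> borel_measurable M" "g \<in> borel_measurable M" for f g :: "'c \<Rightarrow> 'a" and M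
    unfolding G.remainder_def using that by measurable
  have R1: "AE x in lborel. R1 \<rho> u x * \<phi> x = (LINT h|lborel. r h * (?q h x * \<phi> x))"
    using u
  proof eventually_elim
    case (elim x)
    have "R1 \<rho> u x = (LINT h|lborel. ?q h x * r h)"
      unfolding R1_def
    proof (rule lebesgue_integral_cong_lborel(1))
      show "AE h in lborel. \<bar>u (x + h) - u x - BV_grad u x \<bullet> h\<bar> / norm h * \<rho> h = ?q h x * r h"
        using AE_lborel_translate[OF u, of x] r(2)
        by eventually_elim (simp add: G.remainder_def elim)
    qed measurable
    then have "R1 \<rho> u x * \<phi> x = (LINT h|lborel. ?q h x * r h) * \<phi> x" by simp
    also have "\<dots> = (LINT h|lborel. ?q h x * r h * \<phi> x)" by (rule integral_mult_left_zero[symmetric])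
    also have "\<dots> = (LINT h|lborel. r h * (?q h x * \<phi> x))"
      by (intro Bochner_Integration.integral_cong refl) (simp only: mult_ac)
    finally show ?case .
  qed
  have abs_\<phi>: "(\<lambda>x. \<bar>\<phi> x\<bar>) \<in> borel_measurable borel" "\<And>x. \<bar>\<bar>\<phi> x\<bar>\<bar> \<le> C" using \<phi> by auto
  have "G.quotient_mean f \<in> borel_measurable borel" if [measurable]: "f \<in> borel_measurable borel" for f
    unfolding G.quotient_mean_def[abs_def] by measurable
  then have qb: "bounded_borel (G.quotient_mean (\<lambda>x. \<bar>\<phi> x\<bar>))"
    using G.quotient_mean_bounded[OF abs_\<phi>] abs_\<phi>(1) by (intro bounded_borelI)
  have int: "integrable (lborel \<Otimes>\<^sub>M lborel) (\<lambda>(h, x). r h * (?q h x * \<phi> x))"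
  proof (rule lborel_pair.Fubini_integrable)
    have "(LINT x|lborel. norm (r h * (?q h x * \<phi> x))) = \<bar>r h\<bar> * G.quotient_mean (\<lambda>x. \<bar>\<phi> x\<bar>) h" for h
      unfolding G.quotient_mean_def by (simp add: abs_mult)
    then show "integrable lborel (\<lambda>h. LINT x|lborel. norm (case (h, x) of (h, x) \<Rightarrow> r h * (?q h x * \<phi> x)))"
      using integrable_bounded_borel_mult[OF qb integrable_abs[OF r(1)], of "\<lambda>x. x"] by (simp add: mult.commute)
    have "bounded_borel \<phi>" using \<phi> by (rule bounded_borelI)
    then show "AE h in lborel. integrable lborel (\<lambda>x. case (h, x) of (h, x) \<Rightarrow> r h * (?q h x * \<phi> x))"
      by (intro AE_I2) (simp only: prod.case, intro integrable_mult_right G.integrable_quotient)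
  qed measurable
  have "(LINT x|lebesgue. R1 \<rho> u x * \<phi> x) = (LINT x|lborel. LINT h|lborel. r h * (?q h x * \<phi> x))"
    by (rule lebesgue_integral_cong_lborel(1)[OF _ R1]) measurable
  also have "\<dots> = (LINT h|lborel. LINT x|lborel. r h * (?q h x * \<phi> x))"
    by (rule lborel_pair.Fubini_integral[OF int])
  finally show ?thesis
    by (simp only: integral_mult_right_zero G.quotient_mean_def)
qed

text \<open>
  For fixed \<open>x\<close> the integral over \<open>h\<close> is evaluated by rotation invariance, and \<open>|s x| = 1\<close> removes the direction.
\<close>

lemma integral_singular_mean:
  fixes u \<phi> r :: "'a::euclidean_space \<Rightarrow> real" and e :: 'a
  assumes gd: "gradient_decomposition u g s W" and s: "AE x in W. norm (s x) = 1"
    and r: "integrable lborel r" "\<And>T. orthogonal_involution T \<Longrightarrow> AE h in lborel. r (T h) = r h"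
    and \<phi>: "\<phi> \<in> borel_measurable borel" "\<And>x. \<bar>\<phi> x\<bar> \<le> C" and e: "norm e = 1"
  shows "(LINT h|lborel. r h * gradient_decomposition.singular_mean s W \<phi> h) =
    K1 e * (LINT x|W. \<phi> x) * (LINT h|lborel. r h)"
proof -
  interpret G: gradient_decomposition u g s W by (rule gd)
  note [measurable] = G.measurable_uges \<phi>(1)
  interpret LW: pair_sigma_finite lborel W ..
  have [measurable]: "r \<in> borel_measurable borel" using r by auto
  let ?G = "\<lambda>z. \<bar>s (snd z) \<bullet> fst z\<bar> / norm (fst z) * \<phi> (snd z)"
  have "\<bar>?G z\<bar> \<le> 1 * C" for z
  proof -
    have "\<bar>s (snd z) \<bullet> fst z\<bar> / norm (fst z) \<le> 1"
      using G.abs_s_inner_le[of "snd z" "fst z"] by (simp add: divide_le_eq)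
    then show ?thesis unfolding abs_mult by (intro mult_mono \<phi>(2)) auto
  qed
  then have int: "integrable (lborel \<Otimes>\<^sub>M W) (\<lambda>(h, x). r h * ?G (h, x))"
    using integrable_pair_bounded_mult[OF sigma_finite_lborel G.W(1) r(1), of ?G "1 * C"]
    by (simp add: case_prod_unfold)
  have "(LINT h|lborel. r h * G.singular_mean \<phi> h) = (LINT h|lborel. LINT x|W. r h * ?G (h, x))"
    by (simp only: integral_mult_right_zero G.singular_mean_def fst_conv snd_conv)
  also have "\<dots> = (LINT x|W. LINT h|lborel. r h * ?G (h, x))"
    by (rule LW.Fubini_integral[OF int, symmetric])
  also have "\<dots> = (LINT x|W. K1 e * (LINT h|lborel. r h) * \<phi> x)"
  proof (rule integral_cong_AE)
    show "AE x in W. (LINT h|lborel. r h * ?G (h, x)) = K1 e * (LINT h|lborel. r h) * \<phi> x"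
      using s
    proof eventually_elim
      case (elim x)
      have "(LINT h|lborel. r h * ?G (h, x)) = (LINT h|lborel. \<bar>s x \<bullet> h\<bar> / norm h * r h * \<phi> x)"
        by (intro Bochner_Integration.integral_cong refl) (simp add: mult_ac)
      also have "\<dots> = (LINT h|lborel. \<bar>s x \<bullet> h\<bar> / norm h * r h) * \<phi> x" by (rule integral_mult_left_zero)
      also have "\<dots> = K1 e * (LINT h|lborel. r h) * \<phi> x"
        using integral_abs_inner_radial[OF r e, of "s x"] elim by simp
      finally show ?case .
    qed
  qed measurable
  also have "\<dots> = K1 e * (LINT x|W. \<phi> x) * (LINT h|lborel. r h)" by simp
  finally show ?thesis .
qed

theorem proposition2p1:
  fixes \<rho> :: "real \<Rightarrow> real ^ 'n \<Rightarrow> real"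
    and u \<phi> :: "real ^ 'n \<Rightarrow> real"
    and e :: "real ^ 'n"
  assumes "\<And>\<epsilon>. \<epsilon> > 0 \<Longrightarrow> integrable lebesgue (\<rho> \<epsilon>)"
    and "\<And>\<epsilon> h. \<epsilon> > 0 \<Longrightarrow> \<rho> \<epsilon> h \<ge> 0"
    and "\<And>\<epsilon>. \<epsilon> > 0 \<Longrightarrow> radial (\<rho> \<epsilon>)"
    and "\<And>\<delta>. \<delta> > 0 \<Longrightarrow>
           ((\<lambda>\<epsilon>. LINT h:{h. norm h < \<delta>}|lebesgue. \<rho> \<epsilon> h) \<longlongrightarrow> 1) (at_right 0)"
    and "\<And>\<delta>. \<delta> > 0 \<Longrightarrow>
           ((\<lambda>\<epsilon>. LINT h:{h. norm h > \<delta>}|lebesgue. \<rho> \<epsilon> h) \<longlongrightarrow> 0) (at_right 0)"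
    and "u \<in> BV"
    and "continuous_on UNIV \<phi>" and "bounded (range \<phi>)"
    and "norm e = 1"
  shows "((\<lambda>\<epsilon>. LINT x|lebesgue. R1 (\<rho> \<epsilon>) u x * \<phi> x)
            \<longlongrightarrow> K1 e * (LINT x|variation (singular_deriv u). \<phi> x)) (at_right 0)"
proof -
  let ?W = "variation (singular_deriv u)"
  have "\<exists>r. \<epsilon> > 0 \<longrightarrow> integrable lborel r \<and> (\<forall>h. 0 \<le> r h) \<and> (AE h in lborel. \<rho> \<epsilon> h = r h)" for \<epsilon>
  proof (cases "\<epsilon> > 0")
    case True
    then obtain r where r: "integrable lborel r" "AE h in lborel. \<rho> \<epsilon> h = r h"
      using integrable_lebesgue_borel_representative[OF assms(1)] by blast
    have "AE h in lborel. \<rho> \<epsilon> h = max 0 (r h)"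
      using r(2) assms(2)[OF True] by (auto elim!: eventually_mono simp: max_def) (metis)
    then show ?thesis using r(1) by (intro exI[of _ "\<lambda>h. max 0 (r h)"]) auto
  qed auto
  then have "\<forall>\<epsilon>. \<exists>r. \<epsilon> > 0 \<longrightarrow> integrable lborel r \<and> (\<forall>h. 0 \<le> r h) \<and> (AE h in lborel. \<rho> \<epsilon> h = r h)" ..
  from choice[OF this] obtain r where r: "\<And>\<epsilon>. \<epsilon> > 0 \<Longrightarrow> integrable lborel (r \<epsilon>)"
    "\<And>\<epsilon> h. \<epsilon> > 0 \<Longrightarrow> 0 \<le> r \<epsilon> h" "\<And>\<epsilon>. \<epsilon> > 0 \<Longrightarrow> AE h in lborel. \<rho> \<epsilon> h = r \<epsilon> h" by blast
  have pos: "\<forall>\<^sub>F \<epsilon> in at_right 0. (0::real) < \<epsilon>" by (rule eventually_at_right_less)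
  have set_int: "(LINT h:A|lebesgue. \<rho> \<epsilon> h) = (LINT h:A|lborel. r \<epsilon> h)"
    if "\<epsilon> > 0" "A \<in> sets borel" for \<epsilon> A
    unfolding set_lebesgue_integral_def using that r[of \<epsilon>]
    by (intro lebesgue_integral_cong_lborel(1)) (auto elim!: eventually_mono)
  have inside: "((\<lambda>\<epsilon>. LINT h:{h. norm h < \<delta>}|lborel. r \<epsilon> h) \<longlongrightarrow> 1) (at_right 0)" if "\<delta> > 0" for \<delta>
    using assms(4)[OF that] pos
    by (rule Lim_transform_eventually[OF _ eventually_mono]) (intro set_int; simp)
  have outside: "((\<lambda>\<epsilon>. LINT h:{h. norm h > \<delta>}|lborel. r \<epsilon> h) \<longlongrightarrow> 0) (at_right 0)" if "\<delta> > 0" for \<delta>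
    using assms(5)[OF that] pos
    by (rule Lim_transform_eventually[OF _ eventually_mono]) (intro set_int; simp)
  have radial: "AE h in lborel. r \<epsilon> (T h) = r \<epsilon> h" if \<epsilon>: "\<epsilon> > 0" and T: "orthogonal_involution T" for \<epsilon> T
  proof -
    have "AE h in lborel. \<rho> \<epsilon> (T h) = r \<epsilon> (T h)"
    proof (rule AE_distrD[where M' = borel and f = T and P = "\<lambda>h. \<rho> \<epsilon> h = r \<epsilon> h"])
      show "AE h in distr lborel borel T. \<rho> \<epsilon> h = r \<epsilon> h"
        unfolding distr_lborel_orthogonal_involution[OF T] by (rule r(3)[OF \<epsilon>])
    qed (simp add: orthogonal_involution_measurable[OF T])
    then show ?thesis using r(3)[OF \<epsilon>]
    proof eventually_elim
      case (elim h)
      have "\<rho> \<epsilon> (T h) = \<rho> \<epsilon> h"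
        using assms(3)[OF \<epsilon>] orthogonal_involution_simps(3)[OF T] by (auto simp: radial_def)
      with elim show ?case by simp
    qed
  qed
  have \<phi>[measurable]: "\<phi> \<in> borel_measurable borel" by (rule borel_measurable_continuous_onI[OF assms(7)])
  obtain C where C: "\<And>x. \<bar>\<phi> x\<bar> \<le> C" using assms(8) by (auto simp: bounded_iff)
  obtain u' s where u': "AE x in lborel. u x = u' x" and gd: "gradient_decomposition u' (BV_grad u) s ?W"
    and s: "AE x in ?W. norm (s x) = 1"
    using BV_gradient_decomposition[OF assms(6)] by blast
  interpret G: gradient_decomposition u' "BV_grad u" s ?W by (rule gd)
  note [measurable] = G.measurable_uges
  define D where "D h = G.quotient_mean \<phi> h - G.singular_mean \<phi> h" for h
  have [measurable]: "G.quotient_mean \<phi> \<in> borel_measurable borel" "G.singular_mean \<phi> \<in> borel_measurable borel"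
    unfolding G.quotient_mean_def[abs_def] G.remainder_def G.singular_mean_def[abs_def] by measurable
  have D_borel: "D \<in> borel_measurable borel" unfolding D_def[abs_def] by measurable
  have D_le: "\<bar>D h\<bar> \<le> C * (measure ?W UNIV + 2 * (LINT x|lborel. norm (BV_grad u x))) + C * measure ?W UNIV" for h
    using G.quotient_mean_bounded[OF \<phi> C, of h] G.singular_mean_bounded[OF \<phi> C, of h] by (simp add: D_def)
  have D_lim: "((\<lambda>\<epsilon>. LINT h|lborel. r \<epsilon> h * D h) \<longlongrightarrow> 0) (at_right 0)"
  proof (rule concentrating_kernel(2)[OF r(1,2) inside outside _ D_le])
    show "(D \<longlongrightarrow> 0) (at 0)" unfolding D_def by (rule G.quotient_minus_singular_tendsto[OF assms(7) C])
    show "D 0 = 0" by (simp add: D_def G.quotient_mean_def G.singular_mean_def)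
    show "D \<in> borel_measurable borel" by (rule D_borel)
  qed
  have mass: "((\<lambda>\<epsilon>. LINT h|lborel. r \<epsilon> h) \<longlongrightarrow> 1) (at_right 0)"
    by (rule concentrating_kernel(1)[OF r(1,2) inside outside])
  have "((\<lambda>\<epsilon>. (LINT h|lborel. r \<epsilon> h * D h) + K1 e * (LINT x|?W. \<phi> x) * (LINT h|lborel. r \<epsilon> h)) \<longlongrightarrow>
      0 + K1 e * (LINT x|?W. \<phi> x) * 1) (at_right 0)"
    by (intro tendsto_intros D_lim mass)
  moreover have "(LINT h|lborel. r \<epsilon> h * D h) + K1 e * (LINT x|?W. \<phi> x) * (LINT h|lborel. r \<epsilon> h) =
      (LINT x|lebesgue. R1 (\<rho> \<epsilon>) u x * \<phi> x)" if \<epsilon>: "\<epsilon> > 0" for \<epsilon>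
  proof -
    have bD: "bounded_borel D" by (rule bounded_borelI[OF D_borel D_le])
    have bS: "bounded_borel (G.singular_mean \<phi>)"
      using G.singular_mean_bounded[OF \<phi> C] by (intro bounded_borelI) auto
    have i: "integrable lborel (\<lambda>h. r \<epsilon> h * f h)" if "bounded_borel f" for f
      using integrable_bounded_borel_mult[OF that r(1)[OF \<epsilon>], of "\<lambda>x. x"] by (simp add: mult.commute)
    have "(LINT x|lebesgue. R1 (\<rho> \<epsilon>) u x * \<phi> x) = (LINT h|lborel. r \<epsilon> h * G.quotient_mean \<phi> h)"
      by (rule integral_R1[OF gd u' r(1)[OF \<epsilon>] r(3)[OF \<epsilon>] \<phi> C])
    also have "\<dots> = (LINT h|lborel. r \<epsilon> h * D h + r \<epsilon> h * G.singular_mean \<phi> h)"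
      by (simp add: D_def right_diff_distrib)
    also have "\<dots> = (LINT h|lborel. r \<epsilon> h * D h) + (LINT h|lborel. r \<epsilon> h * G.singular_mean \<phi> h)"
      by (rule Bochner_Integration.integral_add[OF i[OF bD] i[OF bS]])
    also have "(LINT h|lborel. r \<epsilon> h * G.singular_mean \<phi> h) = K1 e * (LINT x|?W. \<phi> x) * (LINT h|lborel. r \<epsilon> h)"
      by (rule integral_singular_mean[OF gd s r(1)[OF \<epsilon>] radial[OF \<epsilon>] \<phi> C assms(9)])
    finally show ?thesis by simp
  qed
  ultimately show ?thesis
    by (simp only: add_0 mult_1_right)
      (rule Lim_transform_eventually, assumption, rule eventually_mono[OF pos], simp)
qed

end
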